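(* (Bounds of IFE shape functions.) Let $\mathcal T_h$ satisfy (H1)–(H3). There exists a constant $C$ independent of the interface location, the mesh size $h$ and the coefficients $\beta^\pm$ such that for every $T\in\mathcal T_h^i$ and every $i=1,\dots,8$, $$|\phi_{i,T}|_{k,\infty,\omega_T^+}\le Ch^{-k}\quad\text{and}\quad|\phi_{i,T}|_{k,\infty,\omega_T^-}\le C\frac{\beta^+}{\beta^-}h^{-k},\qquad k=0,1,2.$$
   Context: $\mathbb Q_1$ is the space of trilinear polynomials. $\Gamma$ is a closed $C^2$ surface separating a bounded domain $\Omega\subset\mathbb R^3$ (a union of finitely many rectangular parallelepipeds) into $\Omega^\pm$, with reach $r_\Gamma$ (largest $r$ such that normal segments of length $2r$ centered at distinct points of $\Gamma$ are disjoint); $\beta=\beta^\pm>0$ on $\Omega^\pm$, with $\beta^+\ge\beta^-$. $\mathcal T_h$ is a Cartesian mesh by cubes of edge length $h$; (H1) $h<r_\Gamma/(3\sqrt3)$; (H2) $\Gamma$ meets every mesh edge in at most one point; (H3) $\Gamma$ meets the boundary of every mesh face in at most two points; no vertex lies on $\Gamma$. $\mathcal T_h^i$: elements meeting $\Gamma$; $\omega_T$: union of elements $T'$ with $\overline{T'}\cap\overline T\ne\emptyset$; $\omega_T^\pm=\omega_T\cap\Omega^\pm$; $T^\pm=T\cap\Omega^\pm$. For $T\in\mathcal T_h^i$ with vertices $A_1,\dots,A_8$, $K_T$ is the triangle spanned by three points where $\Gamma$ meets edges of $T$, selected as: if $\Gamma$ cuts 3 faces, all three; if $\Gamma$ cuts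 4 faces separating the endpoints of an edge $e$ from the other vertices, the three farthest from $e$; if the four points lie on four parallel edges, any three; if $\Gamma$ cuts 5 faces, the three on parallel edges; if $\Gamma$ cuts 6 faces, every other one of the six (on three mutually orthogonal edges). $\tau(T)$ is its plane, $\bar{\mathbf n}$ a unit normal, $F$ the centroid of $K_T$, $L(X)=(X-D)\cdot\bar{\mathbf n}$ with $D$ a vertex of $K_T$. $\mathcal C_T(p)=p+\left(\frac{\beta^-}{\beta^+}-1\right)(\nabla p(F)\cdot\bar{\mathbf n})L$; $S_h(T)$ is the set of functions with component $p\in\mathbb Q_1$ on $T^-$ and $\mathcal C_T(p)$ on $T^+$. The IFE shape function $\phi_{i,T}$ is the unique element of $S_h(T)$ with $\phi_{i,T}(A_j)=\delta_{ij}$ (value taken from the piece on the side containing $A_j$). On $\omega_T$, $\phi_{i,T}$ is understood as the function equal to its $T^-$-polynomial component on $\omega_T^-$ and its $T^+$-polynomial component on $\omega_T^+$. $|\cdot|_{k,\infty,D}$ is the $W^{k,\infty}(D)$ seminorm. *)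

theory Defs
  imports "HOL-Analysis.Analysis"
begin

type_synonym pt = "real^3"

definition pd :: "3 \<Rightarrow> (pt \<Rightarrow> real) \<Rightarrow> pt \<Rightarrow> real" where
  "pd i f x = deriv (\<lambda>t. f (x + t *\<^sub>R axis i 1)) 0"

definition gradv :: "(pt \<Rightarrow> real) \<Rightarrow> pt \<Rightarrow> pt" where
  "gradv f x = (\<chi> i. pd i f x)"

definition C2_on :: "pt set \<Rightarrow> (pt \<Rightarrow> real) \<Rightarrow> (pt \<Rightarrow> pt) \<Rightarrow> bool" where
  "C2_on U g G \<longleftrightarrow>
     (\<forall>y\<in>U. (g has_derivative (\<lambda>v. G y \<bullet> v)) (at y)) \<and>
     (\<exists>H :: pt \<Rightarrow> real^3^3. (\<forall>y\<in>U. (G has_derivative (\<lambda>v. H y *v v)) (at y)) \<and> continuous_on U H)"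

definition C2_surface :: "pt set \<Rightarrow> bool" where
  "C2_surface \<Gamma> \<longleftrightarrow> (\<forall>x\<in>\<Gamma>. \<exists>U g G. open U \<and> x \<in> U \<and> C2_on U g G \<and>
      (\<forall>y\<in>U. G y \<noteq> 0) \<and> \<Gamma> \<inter> U = {y\<in>U. g y = 0})"

definition closed_C2_surface :: "pt set \<Rightarrow> bool" where
  "closed_C2_surface \<Gamma> \<longleftrightarrow> compact \<Gamma> \<and> \<Gamma> \<noteq> {} \<and> C2_surface \<Gamma>"

definition unit_normal :: "pt set \<Rightarrow> pt \<Rightarrow> pt \<Rightarrow> bool" where
  "unit_normal \<Gamma> x n \<longleftrightarrow> x \<in> \<Gamma> \<and> norm n = 1 \<and>
     (\<exists>U g G. open U \<and> x \<in> U \<and> C2_on U g G \<and> (\<forall>y\<in>U. G y \<noteq> 0) \<and>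
        \<Gamma> \<inter> U = {y\<in>U. g y = 0} \<and> (\<exists>c. n = c *\<^sub>R G x))"

definition normal_segment :: "pt \<Rightarrow> pt \<Rightarrow> real \<Rightarrow> pt set" where
  "normal_segment x n r = {x + t *\<^sub>R n | t. \<bar>t\<bar> \<le> r}"

definition reach :: "pt set \<Rightarrow> real" where
  "reach \<Gamma> = Sup {r. r > 0 \<and> (\<forall>x\<in>\<Gamma>. \<forall>y\<in>\<Gamma>. \<forall>n m. x \<noteq> y \<longrightarrow>
        unit_normal \<Gamma> x n \<longrightarrow> unit_normal \<Gamma> y m \<longrightarrow>
        normal_segment x n r \<inter> normal_segment y m r = {})}"

definition cube :: "pt \<Rightarrow> real \<Rightarrow> pt set" where
  "cube a h = cbox a (a + h *\<^sub>R One)"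

definition cube_vertices :: "pt \<Rightarrow> real \<Rightarrow> pt set" where
  "cube_vertices a h = {v. \<forall>i. v$i = a$i \<or> v$i = a$i + h}"

definition cube_edges_dir :: "pt \<Rightarrow> real \<Rightarrow> 3 \<Rightarrow> pt set set" where
  "cube_edges_dir a h k = {closed_segment v w | v w.
      v \<in> cube_vertices a h \<and> w \<in> cube_vertices a h \<and> v$k \<noteq> w$k \<and> (\<forall>j. j \<noteq> k \<longrightarrow> v$j = w$j)}"

definition cube_edges :: "pt \<Rightarrow> real \<Rightarrow> pt set set" where
  "cube_edges a h = (\<Union>k. cube_edges_dir a h k)"

definition cube_faces :: "pt \<Rightarrow> real \<Rightarrow> pt set set" where
  "cube_faces a h = {{x \<in> cube a h. x$k = c} | k c. c = a$k \<or> c = a$k + h}"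

definition face_boundary :: "pt \<Rightarrow> real \<Rightarrow> pt set \<Rightarrow> pt set" where
  "face_boundary a h F = \<Union>{E \<in> cube_edges a h. E \<subseteq> F}"

definition cut_points :: "pt set \<Rightarrow> pt \<Rightarrow> real \<Rightarrow> pt set" where
  "cut_points \<Gamma> a h = \<Gamma> \<inter> \<Union>(cube_edges a h)"

definition num_cut_faces :: "pt set \<Rightarrow> pt \<Rightarrow> real \<Rightarrow> nat" where
  "num_cut_faces \<Gamma> a h = card {F \<in> cube_faces a h. \<Gamma> \<inter> face_boundary a h F \<noteq> {}}"

definition cut_edges :: "pt set \<Rightarrow> pt \<Rightarrow> real \<Rightarrow> pt set set" where
  "cut_edges \<Gamma> a h = {E \<in> cube_edges a h. \<Gamma> \<inter> E \<noteq> {}}"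

text \<open>K is an admissible choice of the triangle K_T (given by its three vertices)
  for the cube with corner a and edge h, following the selection rules.\<close>
definition admissible_K :: "pt set \<Rightarrow> pt \<Rightarrow> real \<Rightarrow> pt set \<Rightarrow> bool" where
  "admissible_K \<Gamma> a h K \<longleftrightarrow>
     (let P = cut_points \<Gamma> a h; N = num_cut_faces \<Gamma> a h in
      K \<subseteq> P \<and> card K = 3 \<and>
      ((N = 3 \<and> K = P) \<or>
       (N = 4 \<and> (\<exists>v w. closed_segment v w \<in> cube_edges a h \<and> v \<noteq> w \<and>
            cut_edges \<Gamma> a h = {E \<in> cube_edges a h. E \<noteq> closed_segment v w \<and> (v \<in> E \<or> w \<in> E)} \<and>
            (\<exists>q\<in>P. K = P - {q} \<and>
               (\<forall>q'\<in>P. infdist q (closed_segment v w) \<le> infdist q' (closed_segment v w))))) \<or>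
       (N = 4 \<and> (\<exists>k. cut_edges \<Gamma> a h \<subseteq> cube_edges_dir a h k)) \<or>
       (N = 5 \<and> (\<exists>k. K = P \<inter> \<Union>(cube_edges_dir a h k))) \<or>
       (N = 6 \<and> (\<forall>p\<in>K. \<forall>q\<in>K. p \<noteq> q \<longrightarrow> \<not> (\<exists>F\<in>cube_faces a h. p \<in> F \<and> q \<in> F)))))"

definition Q1 :: "(pt \<Rightarrow> real) set" where
  "Q1 = {p. \<exists>c0 c1 c2 c3 c4 c5 c6 c7. \<forall>x. p x =
      c0 + c1 * x$1 + c2 * x$2 + c3 * x$3 + c4 * x$1 * x$2 + c5 * x$1 * x$3
      + c6 * x$2 * x$3 + c7 * x$1 * x$2 * x$3}"

text \<open>The map C_T with centroid F, unit normal nb, vertex D of K_T.\<close>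
definition CT :: "real \<Rightarrow> real \<Rightarrow> pt \<Rightarrow> pt \<Rightarrow> pt \<Rightarrow> (pt \<Rightarrow> real) \<Rightarrow> pt \<Rightarrow> real" where
  "CT bp bm F nb D p = (\<lambda>X. p X + (bm / bp - 1) * (gradv p F \<bullet> nb) * ((X - D) \<bullet> nb))"

end

theory Submission
  imports Defs
begin

text \<open>
  In coordinates mapping \<open>T\<close> to the unit cube let \<open>\<ell> b = L(b) / h\<close> and let \<open>s b\<close> be the normal derivative at \<open>F\<close> of the
  trilinear nodal function of the vertex \<open>b\<close>. With \<open>\<rho> = \<beta>\<^sup>- / \<beta>\<^sup>+\<close> the nodal conditions become one scalar equation
  \<open>\<sigma> (\<rho> + (1 - \<rho>) \<delta>) = \<gamma>\<close> for the normal derivative \<open>\<sigma>\<close> of \<open>p\<close> at \<open>F\<close>, where \<open>\<delta>\<close> is the sum of \<open>\<ell> b * s b\<close> over the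
  minus vertices and \<open>\<gamma>\<close> is bounded by the nodal values. Everything follows from the coercivity
  \<open>(\<Sum>b. \<bar>\<ell> b\<bar>) / 500 \<le> \<delta>\<close> over the minus vertices, and likewise over the plus vertices (since
  \<open>\<Sum>b. \<ell> b * s b = 1\<close> over the whole cube, this also gives \<open>\<delta> \<le> 1\<close>): the vertex values of the plus component are then
  bounded absolutely, those of the minus component by a multiple of \<open>1 / \<rho>\<close>.

  Coercivity is checked on representatives of the sign patterns up to the symmetries of the cube and exchange of the
  two sides; a checkerboard face is excluded because \<open>\<Gamma>\<close> meets the boundary of a face at most twice. The reach enters only
  to show that \<open>\<Gamma>\<close> does not touch an edge between two vertices on the same side: balls of radius at least \<open>5 h\<close>
  tangent to \<open>\<Gamma>\<close> lie on either side, so every point of \<open>\<Gamma>\<close> on an edge nearly supports the vertex set.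
\<close>

section \<open>Coercivity of the edge energies\<close>

text \<open>No positive lower bound for \<open>\<delta>\<close> can hold uniformly: when
  \<open>\<Gamma>\<close> cuts off a sliver at a vertex, the levels on the minus side tend to 0 and
  \<open>\<delta>\<close> with them, so \<open>\<sigma>\<close> may be of order
  \<open>1 / \<rho>\<close>. The plus component stays bounded nevertheless, because
  \<open>\<sigma>\<close> enters its vertex values only at minus vertices \<open>b\<close>, in the
  product \<open>(1 - \<rho>) * \<sigma> * \<ell> b\<close>. Coercivity bounds
  \<open>\<bar>\<ell> b\<bar>\<close> by \<open>500 * \<delta>\<close>, and
  \<open>(1 - \<rho>) * \<sigma> * \<delta>\<close> is at most \<open>\<bar>\<gamma>\<bar>\<close>
  in size. The minus component meets the same product at plus vertices, whose levels are not
  controlled by \<open>\<delta>\<close>; there only the bound on \<open>\<sigma>\<close> is left,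
  whence the factor \<open>1 / \<rho>\<close>. The scalar equation comes from writing
  \<open>p\<close> as the interpolant of its vertex values and differentiating along the normal at
  \<open>F\<close>: at a plus vertex the value of \<open>p\<close> is the nodal value plus
  \<open>(1 - \<rho>) * \<sigma> * \<ell> b\<close>, and over the plus vertices the sum of
  \<open>\<ell> b * s b\<close> is \<open>1 - \<delta>\<close>.\<close>

definition wt :: "bool \<Rightarrow> real \<Rightarrow> real" where
  "wt b x = (if b then x else 1 - x)"

definition sg :: "bool \<Rightarrow> real" where
  "sg b = (if b then 1 else -1)"

text \<open>Signed distance of the vertex \<open>(i, j, k)\<close> from the plane of the triangle in
  units of \<open>h\<close>, the plane being \<open>n1 * x + n2 * y + n3 * z = d\<close> in
  unit-cube coordinates.\<close>

definition lev :: "real \<Rightarrow> real \<Rightarrow> real \<Rightarrow> real \<Rightarrow> bool \<Rightarrow> bool \<Rightarrow> bool \<Rightarrow> real" where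
  "lev n1 n2 n3 d i j k = n1 * of_bool i + n2 * of_bool j + n3 * of_bool k - d"

text \<open>Derivative along the normal, at the point \<open>(x, y, z)\<close>, of the trilinear
  nodal function \<open>wt i x * wt j y * wt k z\<close> of the vertex; \<open>sg\<close> is the
  derivative of \<open>wt\<close>.\<close>

definition slope :: "real \<Rightarrow> real \<Rightarrow> real \<Rightarrow> real \<Rightarrow> real \<Rightarrow> real \<Rightarrow> bool \<Rightarrow> bool \<Rightarrow> bool \<Rightarrow> real" where
  "slope x y z n1 n2 n3 i j k =
     n1 * sg i * wt j y * wt k z + n2 * sg j * wt i x * wt k z + n3 * sg k * wt i x * wt j y"

definition vsum :: "(bool \<Rightarrow> bool \<Rightarrow> bool \<Rightarrow> bool) \<Rightarrow> (bool \<Rightarrow> bool \<Rightarrow> bool \<Rightarrow> real) \<Rightarrow> real" where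
  "vsum s f =
     of_bool (s False False False) * f False False False +
     of_bool (s False False True) * f False False True +
     of_bool (s False True False) * f False True False +
     of_bool (s False True True) * f False True True +
     of_bool (s True False False) * f True False False +
     of_bool (s True False True) * f True False True +
     of_bool (s True True False) * f True True False +
     of_bool (s True True True) * f True True True"

text \<open>Taken over the minus vertices, this is the number \<open>\<delta>\<close> in the
  equation for the normal derivative.\<close>

definition energy :: "(bool \<Rightarrow> bool \<Rightarrow> bool \<Rightarrow> bool) \<Rightarrow> real \<Rightarrow> real \<Rightarrow> real \<Rightarrow> real \<Rightarrow> real \<Rightarrow> real \<Rightarrow> real \<Rightarrow> real" where
  "energy s x y z n1 n2 n3 d = vsum s (\<lambda>i j k. lev n1 n2 n3 d i j k * slope x y z n1 n2 n3 i j k)"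

definition coercive :: "(bool \<Rightarrow> bool \<Rightarrow> bool \<Rightarrow> bool) \<Rightarrow> real \<Rightarrow> real \<Rightarrow> real \<Rightarrow> real \<Rightarrow> real \<Rightarrow> real \<Rightarrow> real \<Rightarrow> bool" where
  "coercive s x y z n1 n2 n3 d \<longleftrightarrow>
     vsum s (\<lambda>i j k. \<bar>lev n1 n2 n3 d i j k\<bar>) / 500 \<le> energy s x y z n1 n2 n3 d"

text \<open>Asking for both sides makes the property invariant under their exchange, so that sign
  patterns need to be treated only up to complement.\<close>

definition bicoercive :: "(bool \<Rightarrow> bool \<Rightarrow> bool \<Rightarrow> bool) \<Rightarrow> real \<Rightarrow> real \<Rightarrow> real \<Rightarrow> real \<Rightarrow> real \<Rightarrow> real \<Rightarrow> real \<Rightarrow> bool" where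
  "bicoercive s x y z n1 n2 n3 d \<longleftrightarrow>
     coercive s x y z n1 n2 n3 d \<and> coercive (\<lambda>i j k. \<not> s i j k) x y z n1 n2 n3 d"

lemmas energy_simps = energy_def vsum_def lev_def slope_def wt_def sg_def

section \<open>Symmetries of the cube acting on the energies\<close>

lemma bicoercive_compl:
  "bicoercive (\<lambda>i j k. \<not> s i j k) x y z n1 n2 n3 d \<longleftrightarrow> bicoercive s x y z n1 n2 n3 d"
  unfolding bicoercive_def by auto

lemma vsum_swap12: "vsum (\<lambda>i j k. s j i k) (\<lambda>i j k. f j i k) = vsum s f"
  unfolding vsum_def by simp

lemma vsum_swap23: "vsum (\<lambda>i j k. s i k j) (\<lambda>i j k. f i k j) = vsum s f"
  unfolding vsum_def by simp

lemma vsum_flip1: "vsum (\<lambda>i j k. s (\<not> i) j k) (\<lambda>i j k. f (\<not> i) j k) = vsum s f"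
  unfolding vsum_def by simp

lemma lev_swap12: "lev n2 n1 n3 d i j k = lev n1 n2 n3 d j i k"
  by (simp add: lev_def)

lemma lev_swap23: "lev n1 n3 n2 d i j k = lev n1 n2 n3 d i k j"
  by (simp add: lev_def)

text \<open>Under \<open>x \<mapsto> 1 - x\<close> the plane with data \<open>n1, n2, n3, d\<close>
  becomes the plane with data \<open>- n1, n2, n3, d - n1\<close>; hence the offset changes together
  with the sign of \<open>n1\<close>.\<close>

lemma lev_flip1: "lev (- n1) n2 n3 (d - n1) i j k = lev n1 n2 n3 d (\<not> i) j k"
  by (simp add: lev_def of_bool_def)

lemma slope_swap12: "slope y x z n2 n1 n3 i j k = slope x y z n1 n2 n3 j i k"
  by (simp add: slope_def)

lemma slope_swap23: "slope x z y n1 n3 n2 i j k = slope x y z n1 n2 n3 i k j"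
  by (simp add: slope_def)

lemma slope_flip1: "slope (1 - x) y z (- n1) n2 n3 i j k = slope x y z n1 n2 n3 (\<not> i) j k"
  by (simp add: slope_def wt_def sg_def)

lemma coercive_swap12:
  "coercive (\<lambda>i j k. s j i k) y x z n2 n1 n3 d \<longleftrightarrow> coercive s x y z n1 n2 n3 d"
  unfolding coercive_def energy_def
  unfolding lev_swap12[of n2 n1] slope_swap12[of y x z n2 n1]
  unfolding vsum_swap12[of s "\<lambda>i j k. \<bar>lev n1 n2 n3 d i j k\<bar>"]
    vsum_swap12[of s "\<lambda>i j k. lev n1 n2 n3 d i j k * slope x y z n1 n2 n3 i j k"] ..

lemma coercive_swap23:
  "coercive (\<lambda>i j k. s i k j) x z y n1 n3 n2 d \<longleftrightarrow> coercive s x y z n1 n2 n3 d"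
  unfolding coercive_def energy_def
  unfolding lev_swap23[of n1 n3 n2] slope_swap23[of x z y n1 n3]
  unfolding vsum_swap23[of s "\<lambda>i j k. \<bar>lev n1 n2 n3 d i j k\<bar>"]
    vsum_swap23[of s "\<lambda>i j k. lev n1 n2 n3 d i j k * slope x y z n1 n2 n3 i j k"] ..

lemma coercive_flip1:
  "coercive (\<lambda>i j k. s (\<not> i) j k) (1 - x) y z (- n1) n2 n3 (d - n1) \<longleftrightarrow> coercive s x y z n1 n2 n3 d"
  unfolding coercive_def energy_def
  unfolding lev_flip1 slope_flip1
  unfolding vsum_flip1[of s "\<lambda>i j k. \<bar>lev n1 n2 n3 d i j k\<bar>"]
    vsum_flip1[of s "\<lambda>i j k. lev n1 n2 n3 d i j k * slope x y z n1 n2 n3 i j k"] ..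

lemma bicoercive_swap12:
  "bicoercive (\<lambda>i j k. s j i k) y x z n2 n1 n3 d \<longleftrightarrow> bicoercive s x y z n1 n2 n3 d"
  unfolding bicoercive_def using coercive_swap12[of s] coercive_swap12[of "\<lambda>i j k. \<not> s i j k"] by simp

lemma bicoercive_swap23:
  "bicoercive (\<lambda>i j k. s i k j) x z y n1 n3 n2 d \<longleftrightarrow> bicoercive s x y z n1 n2 n3 d"
  unfolding bicoercive_def using coercive_swap23[of s] coercive_swap23[of "\<lambda>i j k. \<not> s i j k"] by simp

lemma bicoercive_flip1:
  "bicoercive (\<lambda>i j k. s (\<not> i) j k) (1 - x) y z (- n1) n2 n3 (d - n1) \<longleftrightarrow> bicoercive s x y z n1 n2 n3 d"
  unfolding bicoercive_def using coercive_flip1[of s] coercive_flip1[of "\<lambda>i j k. \<not> s i j k"] by simp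

section \<open>Energy identities and crude bounds\<close>

lemma vsum_compl: "vsum (\<lambda>i j k. \<not> s i j k) f = vsum (\<lambda>i j k. True) f - vsum s f"
  unfolding vsum_def by (simp add: of_bool_not_iff algebra_simps)

text \<open>The trilinear interpolant of the levels is the affine level function itself, and its
  derivative along its own gradient is the squared length of that gradient, at every point.\<close>

lemma energy_all: "energy (\<lambda>i j k. True) x y z n1 n2 n3 d = n1\<^sup>2 + n2\<^sup>2 + n3\<^sup>2"
  unfolding energy_simps by (simp add: algebra_simps power2_eq_square)

lemma energy_compl:
  "energy (\<lambda>i j k. \<not> s i j k) x y z n1 n2 n3 d = n1\<^sup>2 + n2\<^sup>2 + n3\<^sup>2 - energy s x y z n1 n2 n3 d"
  using energy_all[of x y z n1 n2 n3 d] unfolding energy_def vsum_compl by simp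

text \<open>A level is the inner product of the normal with the vector to the vertex from a point of
  the plane inside the cube. Cauchy-Schwarz bounds it by \<open>sqrt 3\<close>, rounded up to
  2.\<close>

lemma lev_bound:
  assumes "n1\<^sup>2 + n2\<^sup>2 + n3\<^sup>2 = 1" "d = n1 * x + n2 * y + n3 * z"
    and "0 \<le> x" "x \<le> 1" "0 \<le> y" "y \<le> 1" "0 \<le> z" "z \<le> 1"
  shows "\<bar>lev n1 n2 n3 d i j k\<bar> \<le> 2"
proof -
  define u v w where "u = of_bool i - x" and "v = of_bool j - y" and "w = of_bool k - z"
  have "\<bar>u\<bar> \<le> 1" "\<bar>v\<bar> \<le> 1" "\<bar>w\<bar> \<le> 1"
    using assms unfolding u_def v_def w_def by (auto simp: of_bool_def)
  then have "u\<^sup>2 \<le> 1" "v\<^sup>2 \<le> 1" "w\<^sup>2 \<le> 1"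
    by (simp_all add: abs_square_le_1)
  \<comment> \<open>Lagrange's identity; dropping the last three squares on the left gives
    Cauchy-Schwarz.\<close>
  moreover have "(n1 * u + n2 * v + n3 * w)\<^sup>2 + (n1 * v - n2 * u)\<^sup>2 + (n1 * w - n3 * u)\<^sup>2 + (n2 * w - n3 * v)\<^sup>2
      = (n1\<^sup>2 + n2\<^sup>2 + n3\<^sup>2) * (u\<^sup>2 + v\<^sup>2 + w\<^sup>2)"
    by (simp add: algebra_simps power2_eq_square)
  moreover have "X \<le> 2\<^sup>2"
    if "U \<le> 1" "V \<le> 1" "W \<le> 1" "X + P + Q + R = 1 * (U + V + W)" "0 \<le> P" "0 \<le> Q" "0 \<le> R" for U V W X P Q R :: real
    using that by simp
  ultimately have "(n1 * u + n2 * v + n3 * w)\<^sup>2 \<le> 2\<^sup>2"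
    unfolding assms(1) by (meson zero_le_power2)
  moreover have "lev n1 n2 n3 d i j k = n1 * u + n2 * v + n3 * w"
    unfolding lev_def u_def v_def w_def assms(2) by (simp add: algebra_simps)
  ultimately show ?thesis by (metis abs_le_square_iff abs_numeral)
qed

text \<open>Eight levels of size at most 2 add up to at most 16, and \<open>16 / 500\<close> is
  below \<open>1 / 30\<close>. This fixes the constant 500: a side whose energy stays away from 0
  requires no finer comparison.\<close>

lemma coercive_if_energy_ge:
  assumes "n1\<^sup>2 + n2\<^sup>2 + n3\<^sup>2 = 1" "d = n1 * u + n2 * v + n3 * w"
    and "0 \<le> u" "u \<le> 1" "0 \<le> v" "v \<le> 1" "0 \<le> w" "w \<le> 1"
    and e: "1 / 30 \<le> energy s x y z n1 n2 n3 d"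
  shows "coercive s x y z n1 n2 n3 d"
proof -
  have "of_bool (s i j k) * \<bar>lev n1 n2 n3 d i j k\<bar> \<le> 2" for i j k
    using lev_bound[OF assms(1-8), of i j k] by (auto simp: of_bool_def)
  then have "vsum s (\<lambda>i j k. \<bar>lev n1 n2 n3 d i j k\<bar>) \<le> 2 + 2 + 2 + 2 + 2 + 2 + 2 + 2"
    unfolding vsum_def by (intro add_mono)
  then show ?thesis unfolding coercive_def using e by simp
qed

text \<open>The energies of the two sides add up to 1, so an energy away from 1 on one side settles
  the other.\<close>

lemma coercive_compl_if_energy_le:
  assumes "n1\<^sup>2 + n2\<^sup>2 + n3\<^sup>2 = 1" "d = n1 * u + n2 * v + n3 * w"
    and "0 \<le> u" "u \<le> 1" "0 \<le> v" "v \<le> 1" "0 \<le> w" "w \<le> 1"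
    and "energy s x y z n1 n2 n3 d \<le> 29 / 30"
  shows "coercive (\<lambda>i j k. \<not> s i j k) x y z n1 n2 n3 d"
  by (rule coercive_if_energy_ge[OF assms(1-8)]) (use assms(1,9) energy_compl[of s] in simp)

lemma bicoercive_const:
  assumes "n1\<^sup>2 + n2\<^sup>2 + n3\<^sup>2 = 1" "d = n1 * u + n2 * v + n3 * w"
    and "0 \<le> u" "u \<le> 1" "0 \<le> v" "v \<le> 1" "0 \<le> w" "w \<le> 1"
  shows "bicoercive (\<lambda>i j k. False) x y z n1 n2 n3 d"
proof -
  have "energy (\<lambda>i j k. False) x y z n1 n2 n3 d = 0" unfolding energy_def vsum_def by simp
  with coercive_compl_if_energy_le[OF assms, of "\<lambda>i j k. False" x y z]
  show ?thesis unfolding bicoercive_def by (simp add: coercive_def vsum_def)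
qed

lemma abs_sum_ge_one:
  fixes n1 n2 n3 :: real
  assumes "n1\<^sup>2 + n2\<^sup>2 + n3\<^sup>2 = 1"
  shows "1 \<le> \<bar>n1\<bar> + \<bar>n2\<bar> + \<bar>n3\<bar>"
proof -
  have le1: "\<bar>n1\<bar> \<le> 1" "\<bar>n2\<bar> \<le> 1" "\<bar>n3\<bar> \<le> 1"
    using assms zero_le_power2[of n1] zero_le_power2[of n2] zero_le_power2[of n3]
    unfolding abs_square_le_1[symmetric] by linarith+
  have "t\<^sup>2 \<le> \<bar>t\<bar>" if "\<bar>t\<bar> \<le> 1" for t :: real
    using mult_left_mono[OF that, of "\<bar>t\<bar>"] by (simp add: power2_eq_square)
  with le1 have "n1\<^sup>2 \<le> \<bar>n1\<bar>" "n2\<^sup>2 \<le> \<bar>n2\<bar>" "n3\<^sup>2 \<le> \<bar>n3\<bar>" by auto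
  with assms show ?thesis by linarith
qed

section \<open>The sign patterns up to symmetry and their coercivity\<close>

definition corner_pat :: "bool \<Rightarrow> bool \<Rightarrow> bool \<Rightarrow> bool" where
  "corner_pat i j k \<longleftrightarrow> \<not> i \<and> \<not> j \<and> \<not> k"

definition edge_pat :: "bool \<Rightarrow> bool \<Rightarrow> bool \<Rightarrow> bool" where
  "edge_pat i j k \<longleftrightarrow> \<not> i \<and> \<not> j"

text \<open>The origin and its two neighbours in the face \<open>z = 0\<close>.\<close>

definition ell_pat :: "bool \<Rightarrow> bool \<Rightarrow> bool \<Rightarrow> bool" where
  "ell_pat i j k \<longleftrightarrow> \<not> k \<and> \<not> (i \<and> j)"

definition face_pat :: "bool \<Rightarrow> bool \<Rightarrow> bool \<Rightarrow> bool" where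
  "face_pat i j k \<longleftrightarrow> \<not> k"

text \<open>The origin and its three neighbours.\<close>

definition tripod_pat :: "bool \<Rightarrow> bool \<Rightarrow> bool \<Rightarrow> bool" where
  "tripod_pat i j k \<longleftrightarrow> \<not> (i \<and> j) \<and> \<not> (i \<and> k) \<and> \<not> (j \<and> k)"

text \<open>The vertices of the edge path from the origin through \<open>(1, 0, 0)\<close> and
  \<open>(1, 1, 0)\<close> to \<open>(1, 1, 1)\<close>.\<close>

definition path_pat :: "bool \<Rightarrow> bool \<Rightarrow> bool \<Rightarrow> bool" where
  "path_pat i j k \<longleftrightarrow> (k \<longrightarrow> j) \<and> (j \<longrightarrow> i)"

lemma energy_edge: "energy edge_pat x y z n1 n2 n3 d =
  d * (n1 * ((1 - y) * (1 - z)) + n2 * ((1 - x) * (1 - z)) + n3 * ((1 - x) * (1 - y)))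
  - (n3 - d) * (n1 * ((1 - y) * z) + n2 * ((1 - x) * z) - n3 * ((1 - x) * (1 - y)))"
  unfolding energy_simps edge_pat_def by (simp add: algebra_simps)

text \<open>The plane equations express all data as multiples of one normal component, so the energy
  becomes its square times a polynomial in the cut positions and in the ratio
  \<open>w\<close>.\<close>

lemma energy_edge_scaled: assumes d: "n3 - d = - (c * n2)" "d = b * n2" "n1 = w * n2"  shows "energy edge_pat x y (2/3) n1 n2 n3 d =
  n2\<^sup>2 * ((b + 2 * c) / 3 * (w * (1 - y) + (1 - x)) + (b - c)\<^sup>2 * ((1 - x) * (1 - y)))"
proof -
  have n3: "n3 = (b - c) * n2" using d by (simp add: algebra_simps)
  show ?thesis unfolding energy_edge d(1) unfolding d(2,3) n3 by (simp add: field_simps power2_eq_square)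
qed

lemma energy_ell: "energy ell_pat x y z n1 n2 n3 d =
    d * (n1 * ((1 - y) * (1 - z)) + n2 * ((1 - x) * (1 - z)) + n3 * ((1 - x) * (1 - y)))
    + (n1 - d) * (n1 * ((1 - y) * (1 - z)) - n2 * (x * (1 - z)) - n3 * (x * (1 - y)))
    + (n2 - d) * (n2 * ((1 - x) * (1 - z)) - n1 * (y * (1 - z)) - n3 * ((1 - x) * y))"
  unfolding energy_simps ell_pat_def by (simp add: algebra_simps)

lemma energy_ell_scaled: assumes d: "n1 - d = - (q * n3)" "n2 - d = - (r * n3)" "d = p * n3"
  shows "energy ell_pat (1/3) (1/3) z n1 n2 n3 d =
     n3\<^sup>2 * ((p + (q + r - 2 * p) / 3) + (1 - z) * ((q - p)\<^sup>2 + (r - p)\<^sup>2)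
       - (q + r - p) * (1 / 9 + (1 - z) * (q + r - 2 * p) / 3))"
proof -
  have n: "n1 = (p - q) * n3" "n2 = (p - r) * n3" using d by (simp_all add: algebra_simps)
  show ?thesis unfolding energy_ell d(1,2) unfolding n d(3) by (simp add: field_simps power2_eq_square)
qed

lemma energy_face: "energy face_pat x y z n1 n2 n3 d =
    (n1\<^sup>2 + n2\<^sup>2) * (1 - z) - n3 * (n1 * x + n2 * y - d)"
  unfolding energy_simps face_pat_def by (simp add: algebra_simps power2_eq_square)

lemma energy_face_scaled: assumes d: "n1 = (p - q) * n3" "n2 = (p - r) * n3" "d = p * n3"
  shows "energy face_pat (1/3) (1/3) z n1 n2 n3 d =
     n3\<^sup>2 * ((p + q + r) / 3 + (1 - z) * ((q - p)\<^sup>2 + (r - p)\<^sup>2))"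
  unfolding energy_face d by (simp add: field_simps power2_eq_square)

text \<open>The weight \<open>k\<close> is small only if \<open>a\<close> is close to 1 and
  \<open>b\<close> close to 0. Then \<open>a * m = b * n\<close> makes \<open>n\<close> the dominant
  component, and its weight \<open>l\<close> is at least \<open>1 / 2\<close>.\<close>

lemma bicoercive_corner_aux:
  fixes a b m n k l :: real
  assumes "0 < a" "a < 1" "0 < b" "b < 1" "a * m = b * n"
    and "1 - a \<le> k" "b / 3 \<le> k" "1 - b \<le> l" "a / 3 \<le> l"
  shows "m\<^sup>2 \<le> 6 * (k * m\<^sup>2) + 6 * (l * n\<^sup>2)"
proof -
  have kl: "0 \<le> k" "0 \<le> l" using assms by auto
  show ?thesis
  proof (cases "a \<le> 1/2 \<or> 1/2 \<le> b")
    case True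
    with assms have "1/6 \<le> k" by auto
    then have "1/6 * m\<^sup>2 \<le> k * m\<^sup>2" by (intro mult_right_mono) auto
    then show ?thesis using kl mult_nonneg_nonneg[OF kl(2) zero_le_power2[of n]] by linarith
  next
    case False
    then have ab: "b \<le> a" "1/2 \<le> l" using assms by auto
    have "b * \<bar>n\<bar> = a * \<bar>m\<bar>"
      using arg_cong[OF assms(5), of abs] assms(1,3) by (simp add: abs_mult)
    also have "a * \<bar>m\<bar> \<ge> b * \<bar>m\<bar>" by (intro mult_right_mono ab) auto
    finally have "\<bar>m\<bar> \<le> \<bar>n\<bar>" using assms(3) by simp
    then have "m\<^sup>2 \<le> n\<^sup>2" by (simp add: abs_le_square_iff)
    moreover have "1/2 * n\<^sup>2 \<le> l * n\<^sup>2" by (intro mult_right_mono ab) auto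
    ultimately show ?thesis using mult_nonneg_nonneg[OF kl(1) zero_le_power2[of m]]
        zero_le_power2[of n] by linarith
  qed
qed

text \<open>The plane equations give \<open>d * n1 = a * n1\<^sup>2\<close> and its analogues, so
  the energy is a combination of the squared components with weights \<open>a * A\<close>,
  \<open>b * B\<close>, \<open>c * C\<close> between 0 and 1. It is at least a fixed multiple of
  \<open>\<bar>d\<bar>\<close>, the only level on the minus side. It stays away from 1 because a
  component whose weight is near 1 is controlled by another one, by
  \<open>bicoercive_corner_aux\<close>.\<close>

lemma bicoercive_corner:
  assumes unit: "n1\<^sup>2 + n2\<^sup>2 + n3\<^sup>2 = 1"
    and a: "0 < a" "a < 1" and b: "0 < b" "b < 1" and c: "0 < c" "c < 1"
    and d: "n1 * a = d" "n2 * b = d" "n3 * c = d"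
  shows "bicoercive corner_pat (a / 3) (b / 3) (c / 3) n1 n2 n3 d"
proof -
  define A B C where "A = (1 - b/3) * (1 - c/3)" and "B = (1 - a/3) * (1 - c/3)" and "C = (1 - a/3) * (1 - b/3)"
  have lower: "4/9 \<le> A" "4/9 \<le> B" "4/9 \<le> C"
    using mult_mono[of "2/3" "1 - b/3" "2/3" "1 - c/3"] mult_mono[of "2/3" "1 - a/3" "2/3" "1 - c/3"]
      mult_mono[of "2/3" "1 - a/3" "2/3" "1 - b/3"] a b c
    unfolding A_def B_def C_def by auto
  have upper: "A \<le> 1 - b/3" "A \<le> 1 - c/3" "B \<le> 1 - a/3" "B \<le> 1 - c/3" "C \<le> 1 - a/3" "C \<le> 1 - b/3"
    using a b c unfolding A_def B_def C_def by (simp_all add: mult_left_le mult_left_le_one_le)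
  have "energy corner_pat (a / 3) (b / 3) (c / 3) n1 n2 n3 d
      = d * (n1 * A + n2 * B + n3 * C)"
    unfolding energy_simps corner_pat_def A_def B_def C_def by (simp add: field_simps)
  also have "\<dots> = (d * n1) * A + (d * n2) * B + (d * n3) * C" by (simp add: algebra_simps)
  finally have E: "energy corner_pat (a / 3) (b / 3) (c / 3) n1 n2 n3 d
      = (d * n1) * A + (d * n2) * B + (d * n3) * C" .
  have dn: "d * n1 = a * n1\<^sup>2" "d * n2 = b * n2\<^sup>2" "d * n3 = c * n3\<^sup>2"
    by (simp add: d(1)[symmetric] power2_eq_square, simp add: d(2)[symmetric] power2_eq_square,
        simp add: d(3)[symmetric] power2_eq_square)
  have "0 \<le> d * n1" "0 \<le> d * n2" "0 \<le> d * n3" unfolding dn using a b c by auto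
  then have dn': "d * n1 = \<bar>d\<bar> * \<bar>n1\<bar>" "d * n2 = \<bar>d\<bar> * \<bar>n2\<bar>" "d * n3 = \<bar>d\<bar> * \<bar>n3\<bar>"
    by (simp_all add: abs_mult[symmetric])
  have "energy corner_pat (a / 3) (b / 3) (c / 3) n1 n2 n3 d
     \<ge> (d * n1) * (4/9) + (d * n2) * (4/9) + (d * n3) * (4/9)"
    unfolding E by (intro add_mono mult_left_mono lower \<open>0 \<le> d * n1\<close> \<open>0 \<le> d * n2\<close> \<open>0 \<le> d * n3\<close>)
  also have "(d * n1) * (4/9) + (d * n2) * (4/9) + (d * n3) * (4/9) = \<bar>d\<bar> * (\<bar>n1\<bar> + \<bar>n2\<bar> + \<bar>n3\<bar>) * (4/9)"
    unfolding dn' by (simp add: algebra_simps)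
  also have "\<dots> \<ge> \<bar>d\<bar> * 1 * (4/9)"
    by (intro mult_right_mono mult_left_mono abs_sum_ge_one[OF unit]) auto
  finally have "coercive corner_pat (a / 3) (b / 3) (c / 3) n1 n2 n3 d"
    unfolding coercive_def vsum_def lev_def corner_pat_def by simp
  moreover have "energy corner_pat (a / 3) (b / 3) (c / 3) n1 n2 n3 d \<le> 29/30"
  proof -
    have pos: "0 \<le> A" "0 \<le> B" "0 \<le> C" using lower by auto
    have small: "a * A \<le> a" "a * A \<le> A" "b * B \<le> b" "b * B \<le> B" "c * C \<le> c" "c * C \<le> C"
      using upper pos a b c by (auto intro!: mult_left_le mult_left_le_one_le)
    define k1 k2 k3 where "k1 = 1 - a * A" and "k2 = 1 - b * B" and "k3 = 1 - c * C"
    have k: "1 - a \<le> k1" "b/3 \<le> k1" "c/3 \<le> k1" "1 - b \<le> k2" "a/3 \<le> k2" "c/3 \<le> k2" "1 - c \<le> k3" "a/3 \<le> k3" "b/3 \<le> k3"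
      unfolding k1_def k2_def k3_def using small upper by linarith+
    have "n1\<^sup>2 \<le> 6 * (k1 * n1\<^sup>2) + 6 * (k2 * n2\<^sup>2)"
      by (rule bicoercive_corner_aux[OF a b]) (use k d in \<open>auto simp: mult.commute\<close>)
    moreover have "n2\<^sup>2 \<le> 6 * (k2 * n2\<^sup>2) + 6 * (k1 * n1\<^sup>2)"
      by (rule bicoercive_corner_aux[OF b a]) (use k d in \<open>auto simp: mult.commute\<close>)
    moreover have "n3\<^sup>2 \<le> 6 * (k3 * n3\<^sup>2) + 6 * (k1 * n1\<^sup>2)"
      by (rule bicoercive_corner_aux[OF c a]) (use k d in \<open>auto simp: mult.commute\<close>)
    moreover have "0 \<le> k1 * n1\<^sup>2" "0 \<le> k2 * n2\<^sup>2" "0 \<le> k3 * n3\<^sup>2" using k a b c by auto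
    \<comment> \<open>The term with \<open>k1\<close> occurs in all three estimates, so its
      coefficient adds up to 18, the largest of the three.\<close>
    ultimately have "1 / 18 \<le> k1 * n1\<^sup>2 + k2 * n2\<^sup>2 + k3 * n3\<^sup>2"
      using unit by linarith
    moreover have "k1 * n1\<^sup>2 + k2 * n2\<^sup>2 + k3 * n3\<^sup>2 = (n1\<^sup>2 + n2\<^sup>2 + n3\<^sup>2) - energy corner_pat (a / 3) (b / 3) (c / 3) n1 n2 n3 d"
      unfolding E dn k1_def k2_def k3_def by (simp add: algebra_simps)
    ultimately show ?thesis using unit by linarith
  qed
  ultimately show ?thesis
    using coercive_compl_if_energy_le[OF unit, of d a 0 0 corner_pat] a d(1)
    unfolding bicoercive_def by auto
qed

text \<open>The triangle has the vertices \<open>(0, b, 0)\<close>, \<open>(a, 0, 1)\<close>,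
  \<open>(0, c, 1)\<close>. As \<open>a\<close> may be arbitrarily small, the ratio
  \<open>w = c / a\<close> of the first two normal components is unbounded, and both estimates have
  to be uniform in it.\<close>

lemma bicoercive_edge:
  assumes unit: "n1\<^sup>2 + n2\<^sup>2 + n3\<^sup>2 = 1"
    and b: "0 < b" "b < 1" and a: "0 < a" "a < 1" and c: "0 < c" "c < 1"
    and d: "n2 * b = d" "n1 * a + n3 = d" "n2 * c + n3 = d"
  shows "bicoercive edge_pat (a / 3) ((b + c) / 3) (2 / 3) n1 n2 n3 d"
proof -
  define w where "w = c / a"
  have w: "0 \<le> w" "c \<le> w" using a c by (auto simp: w_def field_simps)
  have "n1 * a = n2 * c" using d by simp
  then have n1: "n1 = w * n2" using a by (simp add: w_def field_simps)
  have n3: "n3 = (b - c) * n2" using d by (simp add: algebra_simps)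
  have d': "d = b * n2" using d by (simp add: mult.commute)
  have n_sq: "n2\<^sup>2 * (w\<^sup>2 + 1 + (b - c)\<^sup>2) = 1"
    using unit unfolding n1 n3 by (simp add: algebra_simps power2_eq_square)
  have bc: "\<bar>b - c\<bar> \<le> 1" using b c by auto
  then have bc2: "(b - c)\<^sup>2 \<le> 1" by (simp add: abs_square_le_1)
  define T x y where "T = (b + 2 * c) / 3" and "x = a / 3" and "y = (b + c) / 3"
  have T: "0 \<le> T" "T \<le> y + 1/3" "T \<le> (1 + 2 * w) / 3" "(b + c) / 3 \<le> T"
    using b c w unfolding T_def y_def by (auto simp: add_divide_distrib)
  have x: "0 \<le> x" "x \<le> 1/3" and y: "0 \<le> y" "y \<le> 2/3" using a b c by (auto simp: x_def y_def)
  have E: "energy edge_pat (a / 3) ((b + c) / 3) (2 / 3) n1 n2 n3 d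
      = n2\<^sup>2 * (T * (w * (1 - y) + (1 - x)) + (b - c)\<^sup>2 * ((1 - x) * (1 - y)))"
    unfolding T_def x_def y_def
  proof (rule energy_edge_scaled)
    show "n3 - d = - (c * n2)" using d(3) by (simp add: algebra_simps)
  qed (fact d' n1)+
  have xy: "0 \<le> (1 - x) * (1 - y)" "(1 - x) * (1 - y) \<le> 1" using x y
    by (auto intro!: mult_le_one)
  \<comment> \<open>Lets one factor \<open>\<bar>n2\<bar>\<close> be traded against
    \<open>w + 2\<close>, so that the lower bound survives large \<open>w\<close>.\<close>
  have sum_abs: "1 \<le> \<bar>n2\<bar> * (w + 2)"
  proof -
    have "\<bar>n1\<bar> + \<bar>n2\<bar> + \<bar>n3\<bar> = \<bar>n2\<bar> * (w + 1 + \<bar>b - c\<bar>)"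
      unfolding n1 n3 abs_mult abs_of_nonneg[OF w(1)] by (simp add: distrib_left mult.commute)
    also have "\<dots> \<le> \<bar>n2\<bar> * (w + 2)" by (intro mult_left_mono) (use bc in auto)
    finally show ?thesis using abs_sum_ge_one[OF unit] by linarith
  qed
  have "coercive edge_pat (a / 3) ((b + c) / 3) (2 / 3) n1 n2 n3 d"
  proof -
    have "\<bar>n2\<bar> * ((b + c) / 9) \<le> (\<bar>n2\<bar> * (\<bar>n2\<bar> * (w + 2))) * ((b + c) / 9)"
      by (intro mult_right_mono) (use sum_abs b c mult_left_mono[OF sum_abs, of "\<bar>n2\<bar>"] in auto)
    also have "\<dots> = n2\<^sup>2 * (((b + c) / 3) * (w * (1/3) + 2/3))"
      by (simp add: field_simps power2_eq_square)
    also have "\<dots> \<le> n2\<^sup>2 * (T * (w * (1 - y) + (1 - x)) + (b - c)\<^sup>2 * ((1 - x) * (1 - y)))"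
    proof (intro mult_left_mono)
      have "((b + c) / 3) * (w * (1/3) + 2/3) \<le> T * (w * (1 - y) + (1 - x))"
        by (intro mult_mono add_mono mult_left_mono) (use T x y w in auto)
      then show "((b + c) / 3) * (w * (1/3) + 2/3) \<le> T * (w * (1 - y) + (1 - x)) + (b - c)\<^sup>2 * ((1 - x) * (1 - y))"
        using mult_nonneg_nonneg[OF zero_le_power2[of "b - c"] xy(1)] by linarith
    qed auto
    finally have "\<bar>n2\<bar> * ((b + c) / 9) \<le> energy edge_pat (a / 3) ((b + c) / 3) (2 / 3) n1 n2 n3 d" unfolding E .
    moreover have "vsum edge_pat (\<lambda>i j k. \<bar>lev n1 n2 n3 d i j k\<bar>) = \<bar>n2\<bar> * (b + c)"
    proof -
      have "n3 - d = - (c * n2)" using d by (simp add: algebra_simps)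
      then have "\<bar>n3 - d\<bar> = c * \<bar>n2\<bar>" using c by (simp add: abs_mult)
      moreover have "\<bar>d\<bar> = b * \<bar>n2\<bar>" using b unfolding d' by (simp add: abs_mult)
      ultimately show ?thesis unfolding vsum_def edge_pat_def lev_def by (simp add: algebra_simps)
    qed
    moreover have "0 \<le> \<bar>n2\<bar> * (b + c)" using b c by auto
    ultimately show ?thesis unfolding coercive_def by simp
  qed
  moreover have "energy edge_pat (a / 3) ((b + c) / 3) (2 / 3) n1 n2 n3 d \<le> 29 / 30"
  proof -
    \<comment> \<open>The bound \<open>T \<le> y + 1/3\<close> comes from \<open>c < 1\<close>, and
      the product on the right is largest at \<open>y = 1/3\<close>.\<close>
    have "T * (1 - y) \<le> (y + 1/3) * (1 - y)" by (intro mult_right_mono) (use T y in auto)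
    also have "\<dots> = 4/9 - (y - 1/3)\<^sup>2" by (simp add: field_simps power2_eq_square)
    also have "\<dots> \<le> 4/9" by simp
    finally have "w * (T * (1 - y)) \<le> w * (4/9)" using w by (intro mult_left_mono)
    moreover have "T * (1 - x) \<le> T" using T x by (intro mult_left_le) auto
    moreover have "(b - c)\<^sup>2 * ((1 - x) * (1 - y)) \<le> (b - c)\<^sup>2" using xy by (intro mult_left_le) auto
    ultimately have "w\<^sup>2 + 1 + (b - c)\<^sup>2 - (T * (w * (1 - y) + (1 - x)) + (b - c)\<^sup>2 * ((1 - x) * (1 - y)))
        \<ge> w\<^sup>2 + 1 - w * (4/9) - T"
      by (simp add: algebra_simps)
    moreover have "w\<^sup>2 + 1 - w * (4/9) - T \<ge> w\<^sup>2 - (10/9) * w + 2/3" using T by (simp add: field_simps)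
    moreover have "w\<^sup>2 - (10/9) * w + 2/3 \<ge> (w\<^sup>2 + 1 + 1) / 20"
    proof -
      \<comment> \<open>Completing the square: \<open>100 / 171\<close> is the minimiser of the
        difference.\<close>
      have "w\<^sup>2 - (10/9) * w + 2/3 - (w\<^sup>2 + 1 + 1) / 20 = (19/20) * (w - 100/171)\<^sup>2 + (17/30 - (19/20) * (100/171)\<^sup>2)"
        by (simp add: field_simps power2_eq_square)
      moreover have "0 \<le> (17/30 - (19/20) * (100/171)\<^sup>2 :: real)" by (simp add: power2_eq_square)
      moreover have "0 \<le> (19/20) * (w - 100/171)\<^sup>2" by simp
      ultimately show ?thesis by linarith
    qed
    ultimately have "(w\<^sup>2 + 1 + (b - c)\<^sup>2) / 20 \<le> w\<^sup>2 + 1 + (b - c)\<^sup>2 - (T * (w * (1 - y) + (1 - x)) + (b - c)\<^sup>2 * ((1 - x) * (1 - y)))"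
      using bc2 unfolding add_divide_distrib by linarith
    from mult_left_mono[OF this, of "n2\<^sup>2"]
    have "1 / 20 \<le> 1 - energy edge_pat (a / 3) ((b + c) / 3) (2 / 3) n1 n2 n3 d"
      unfolding E right_diff_distrib n_sq times_divide_eq_right by simp
    then show ?thesis by simp
  qed
  ultimately show ?thesis
    using coercive_compl_if_energy_le[OF unit, of d 0 b 0 edge_pat] b d(1)
    unfolding bicoercive_def by auto
qed

text \<open>The triangle has its vertices at the heights \<open>p\<close>, \<open>q\<close>,
  \<open>r\<close> on three parallel edges, and \<open>p + t = q + r - p\<close> is the height of
  its plane over the fourth one, possibly outside the cube. The energy is therefore not termwise
  nonnegative; completing squares in \<open>t\<close> controls the mixed terms.\<close>

lemma bicoercive_ell:
  assumes unit: "n1\<^sup>2 + n2\<^sup>2 + n3\<^sup>2 = 1"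
    and p: "0 < p" "p < 1" and q: "0 < q" "q < 1" and r: "0 < r" "r < 1"
    and d: "n3 * p = d" "n1 + n3 * q = d" "n2 + n3 * r = d"
  shows "bicoercive ell_pat (1 / 3) (1 / 3) ((p + q + r) / 3) n1 n2 n3 d"
proof -
  define t where "t = q + r - 2 * p"
  define z where "z = (p + q + r) / 3"
  have n1: "n1 = (p - q) * n3" and n2: "n2 = (p - r) * n3" and d': "d = p * n3"
    using d by (simp_all add: algebra_simps)
  have z: "0 \<le> z" "z \<le> 1" using p q r by (auto simp: z_def)
  have zt: "z = p + t / 3" unfolding z_def t_def by (simp add: field_simps)
  define R where "R = (q - p)\<^sup>2 + (r - p)\<^sup>2"
  have R: "t\<^sup>2 / 2 \<le> R"
  proof -
    have "R - t\<^sup>2 / 2 = (q - r)\<^sup>2 / 2" unfolding R_def t_def by (simp add: field_simps power2_eq_square)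
    then show ?thesis using zero_le_power2[of "q - r"] by linarith
  qed
  have n_sq: "n3\<^sup>2 * (1 + R) = 1"
    using unit unfolding n1 n2 R_def by (simp add: algebra_simps power2_eq_square)
  define f where "f = z + (1 - z) * R - (p + t) * (1 / 9 + (1 - z) * t / 3)"
  have E: "energy ell_pat (1 / 3) (1 / 3) z n1 n2 n3 d = n3\<^sup>2 * f"
  proof -
    have "q + r - p = p + t" unfolding t_def by simp
    moreover have "n1 - d = - (q * n3)" "n2 - d = - (r * n3)" using d by (simp_all add: algebra_simps)
    from energy_ell_scaled[OF this d', of z]
    have "energy ell_pat (1 / 3) (1 / 3) z n1 n2 n3 d =
      n3\<^sup>2 * (p + t / 3 + (1 - z) * R - (q + r - p) * (1 / 9 + (1 - z) * t / 3))"
      unfolding R_def t_def .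
    ultimately show ?thesis unfolding f_def zt[symmetric] by simp
  qed
  \<comment> \<open>Like the levels, \<open>f\<close> has to be compared with the sum of the
    heights. The only negative contribution left is \<open>- p\<^sup>2 / 6\<close>, absorbed by the
    term \<open>(4 / 9) * p\<close>.\<close>
  have f_low: "(2 / 9) * (p + q + r) \<le> f"
  proof -
    have "(1 - z) * (t\<^sup>2 / 2) \<le> (1 - z) * R" using R z by (intro mult_left_mono) auto
    moreover have "(1 - z) * (t\<^sup>2 / 2 - (p + t) * t / 3) \<ge> - (p\<^sup>2 / 6)"
    proof -
      have "t\<^sup>2 / 2 - (p + t) * t / 3 = (t - p)\<^sup>2 / 6 - p\<^sup>2 / 6" by (simp add: field_simps power2_eq_square)
      then have "- (p\<^sup>2 / 6) \<le> t\<^sup>2 / 2 - (p + t) * t / 3" by simp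
      then have "(1 - z) * (- (p\<^sup>2 / 6)) \<le> (1 - z) * (t\<^sup>2 / 2 - (p + t) * t / 3)"
        using z by (intro mult_left_mono) auto
      moreover have "(1 - z) * (p\<^sup>2 / 6) \<le> 1 * (p\<^sup>2 / 6)" using z by (intro mult_right_mono) auto
      ultimately show ?thesis by simp
    qed
    moreover have "p\<^sup>2 \<le> p" using p by (simp add: power2_eq_square mult_left_le)
    moreover have "f = (z - (p + t) / 9) + (1 - z) * R - (1 - z) * (t\<^sup>2 / 2) + (1 - z) * (t\<^sup>2 / 2 - (p + t) * t / 3)"
      unfolding f_def by (simp add: field_simps)
    moreover have "z - (p + t) / 9 = (4 / 9) * p + (2 / 9) * q + (2 / 9) * r"
      unfolding z_def t_def by (simp add: field_simps)
    ultimately show ?thesis using p by (simp add: distrib_left)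
  qed
  have f_high: "f \<le> 1 + R - 1 / 10"
  proof -
    have "1 + R - f = (1 - z) + z * R + (p + t) / 9 + (1 - z) * ((t\<^sup>2 + p * t) / 3)"
      unfolding f_def by (simp add: field_simps power2_eq_square)
    moreover have "z * (t\<^sup>2 / 2) \<le> z * R" using R z by (intro mult_left_mono)
    moreover have "(1 - z) * (- (1 / 12)) \<le> (1 - z) * ((t\<^sup>2 + p * t) / 3)"
    proof (intro mult_left_mono)
      have "t\<^sup>2 + p * t = (t + p / 2)\<^sup>2 - p\<^sup>2 / 4" by (simp add: field_simps power2_eq_square)
      moreover have "p\<^sup>2 \<le> 1" using p by (simp add: abs_square_le_1)
      ultimately have "- (1 / 4) \<le> t\<^sup>2 + p * t" using zero_le_power2[of "t + p/2"] by linarith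
      then show "- (1 / 12) \<le> (t\<^sup>2 + p * t) / 3" by simp
    qed (use z in auto)
    moreover have "(p + t) / 9 = z / 9 + 2 * t / 27" unfolding zt by (simp add: field_simps)
    moreover have "(11 / 12) * (1 - z) + X + z / 9 + 2 * t / 27 \<le> Q"
      if "Q = (1 - z) + E1 + E2 + E3" "X \<le> E1" "(1 - z) * (- (1 / 12)) \<le> E3" "E2 = z / 9 + 2 * t / 27"
      for X Q E1 E2 E3 :: real using that by (simp add: field_simps)
    ultimately have ge: "(11 / 12) * (1 - z) + z * (t\<^sup>2 / 2) + z / 9 + 2 * t / 27 \<le> 1 + R - f" by blast
    \<comment> \<open>For small \<open>z\<close> the first term outweighs \<open>2 * t / 27\<close>,
      which is at least \<open>- 4 / 27\<close>; for larger \<open>z\<close> the quadratic term in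
      \<open>t\<close> absorbs the linear one.\<close>
    have "1 / 10 \<le> (11 / 12) * (1 - z) + z * (t\<^sup>2 / 2) + z / 9 + 2 * t / 27"
    proof (cases "z \<le> 1 / 3")
      case True
      have "- 2 \<le> t" using p q r unfolding t_def by simp
      moreover have "0 \<le> z * (t\<^sup>2 / 2)" using z by simp
      ultimately show ?thesis using True z unfolding right_diff_distrib by linarith
    next
      case False
      have "1/3 * (t\<^sup>2 / 2) \<le> z * (t\<^sup>2 / 2)" using False by (intro mult_right_mono) auto
      moreover have "1/3 * (t\<^sup>2 / 2) + 2 * t / 27 = (t + 2/9)\<^sup>2 / 6 - 2 / 243"
        by (simp add: field_simps power2_eq_square)
      ultimately show ?thesis using z zero_le_power2[of "t + 2/9"] unfolding right_diff_distrib by linarith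
    qed
    with ge show ?thesis by linarith
  qed
  have abs: "\<bar>p - q\<bar> \<le> 1" "\<bar>p - r\<bar> \<le> 1" using p q r by auto
  have "coercive ell_pat (1 / 3) (1 / 3) z n1 n2 n3 d"
  proof -
    have "\<bar>n1\<bar> + \<bar>n2\<bar> + \<bar>n3\<bar> \<le> 1 * \<bar>n3\<bar> + 1 * \<bar>n3\<bar> + \<bar>n3\<bar>"
      unfolding n1 n2 abs_mult by (intro add_mono mult_right_mono abs order_refl) auto
    then have n3: "1 / 3 \<le> \<bar>n3\<bar>" using abs_sum_ge_one[OF unit] by linarith
    have "\<bar>n3\<bar> * (p + q + r) * (2 / 27) \<le> n3\<^sup>2 * (2 / 9 * (p + q + r))"
    proof -
      have "\<bar>n3\<bar> * (1/3) \<le> n3\<^sup>2" using mult_left_mono[OF n3, of "\<bar>n3\<bar>"] by (simp add: power2_eq_square)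
      from mult_right_mono[OF this, of "2 / 9 * (p + q + r)"] show ?thesis using p q r by (simp add: mult_ac)
    qed
    also have "\<dots> \<le> n3\<^sup>2 * f" by (intro mult_left_mono f_low) auto
    finally have "\<bar>n3\<bar> * (p + q + r) * (2 / 27) \<le> energy ell_pat (1 / 3) (1 / 3) z n1 n2 n3 d" unfolding E .
    moreover have "vsum ell_pat (\<lambda>i j k. \<bar>lev n1 n2 n3 d i j k\<bar>) = \<bar>n3\<bar> * (p + q + r)"
    proof -
      have "n1 - d = - (n3 * q)" "n2 - d = - (n3 * r)" using d by (simp_all add: algebra_simps)
      then have "\<bar>n1 - d\<bar> = \<bar>n3\<bar> * q" "\<bar>n2 - d\<bar> = \<bar>n3\<bar> * r" using q r by (simp_all add: abs_mult)
      moreover have "\<bar>d\<bar> = \<bar>n3\<bar> * p" using p unfolding d' by (simp add: abs_mult)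
      ultimately show ?thesis unfolding vsum_def ell_pat_def lev_def by (simp add: distrib_left)
    qed
    moreover have "0 \<le> \<bar>n3\<bar> * (p + q + r)" using p q r by auto
    ultimately show ?thesis unfolding coercive_def by linarith
  qed
  moreover have "energy ell_pat (1 / 3) (1 / 3) z n1 n2 n3 d \<le> 29 / 30"
  proof -
    have "R \<le> 1 + 1" unfolding R_def using abs
      by (intro add_mono) (auto simp: abs_square_le_1 abs_minus_commute)
    then have "(1 + R) / 30 \<le> (1 + R) - f" using f_high unfolding add_divide_distrib by linarith
    from mult_left_mono[OF this, of "n3\<^sup>2"]
    show ?thesis unfolding E right_diff_distrib times_divide_eq_right n_sq by simp
  qed
  ultimately show ?thesis
    using coercive_compl_if_energy_le[OF unit, of d 0 0 p ell_pat] p d(1)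
    unfolding bicoercive_def z_def by auto
qed

text \<open>Either energy can degenerate, the minus one as the plane approaches the face
  \<open>z = 0\<close>, the plus one at the opposite face, so each is compared with the levels of
  its own side. The level over the fourth edge, where the triangle has no vertex, may have the wrong
  sign, but its size is dominated by the other three.\<close>

lemma bicoercive_face:
  assumes unit: "n1\<^sup>2 + n2\<^sup>2 + n3\<^sup>2 = 1"
    and p: "0 < p" "p < 1" and q: "0 < q" "q < 1" and r: "0 < r" "r < 1"
    and d: "n3 * p = d" "n1 + n3 * q = d" "n2 + n3 * r = d"
  shows "bicoercive face_pat (1 / 3) (1 / 3) ((p + q + r) / 3) n1 n2 n3 d"
proof -
  define z where "z = (p + q + r) / 3"
  have n1: "n1 = (p - q) * n3" and n2: "n2 = (p - r) * n3" and d': "d = p * n3"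
    using d by (simp_all add: algebra_simps)
  have z: "0 \<le> z" "z \<le> 1" using p q r by (auto simp: z_def)
  define R where "R = (q - p)\<^sup>2 + (r - p)\<^sup>2"
  have R: "0 \<le> R" unfolding R_def by simp
  have n_sq: "n3\<^sup>2 * (1 + R) = 1"
    using unit unfolding n1 n2 R_def by (simp add: algebra_simps power2_eq_square)
  have E: "energy face_pat (1 / 3) (1 / 3) z n1 n2 n3 d = n3\<^sup>2 * (z + (1 - z) * R)"
    unfolding R_def z_def by (rule energy_face_scaled[OF n1 n2 d'])
  have abs: "\<bar>p - q\<bar> \<le> 1" "\<bar>p - r\<bar> \<le> 1" using p q r by auto
  have "\<bar>n1\<bar> + \<bar>n2\<bar> + \<bar>n3\<bar> \<le> 1 * \<bar>n3\<bar> + 1 * \<bar>n3\<bar> + \<bar>n3\<bar>"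
    unfolding n1 n2 abs_mult by (intro add_mono mult_right_mono abs order_refl) auto
  then have "1 / 3 \<le> \<bar>n3\<bar>" using abs_sum_ge_one[OF unit] by linarith
  from mult_left_mono[OF this, of "\<bar>n3\<bar>"]
  have n3: "\<bar>n3\<bar> / 3 \<le> n3\<^sup>2" by (simp add: power2_eq_square)
  have lev4: "n1 + n2 - d = - (n3 * (q + r - p))" using d by (simp add: algebra_simps)
  have "coercive face_pat (1 / 3) (1 / 3) z n1 n2 n3 d"
  proof -
    have "\<bar>n3\<bar> * z / 3 \<le> n3\<^sup>2 * (z + (1 - z) * R)"
      using mult_mono[OF n3, of z "z + (1 - z) * R"] z R by simp
    moreover have "vsum face_pat (\<lambda>i j k. \<bar>lev n1 n2 n3 d i j k\<bar>) = \<bar>n3\<bar> * (p + q + r + \<bar>q + r - p\<bar>)"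
    proof -
      have "n1 - d = - (n3 * q)" "n2 - d = - (n3 * r)" using d by (simp_all add: algebra_simps)
      then have "\<bar>n1 - d\<bar> = \<bar>n3\<bar> * q" "\<bar>n2 - d\<bar> = \<bar>n3\<bar> * r" using q r by (simp_all add: abs_mult)
      moreover have "\<bar>d\<bar> = \<bar>n3\<bar> * p" using p unfolding d' by (simp add: abs_mult)
      moreover have "\<bar>n1 + n2 - d\<bar> = \<bar>n3\<bar> * \<bar>q + r - p\<bar>" unfolding lev4 by (simp add: abs_mult)
      ultimately show ?thesis unfolding vsum_def face_pat_def lev_def by (simp add: distrib_left)
    qed
    moreover have "\<bar>n3\<bar> * (p + q + r + \<bar>q + r - p\<bar>) \<le> \<bar>n3\<bar> * z * 6"
    proof (unfold mult.assoc, intro mult_left_mono)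
      have "\<bar>q + r - p\<bar> \<le> p + q + r" by (rule abs_leI) (use p q r in auto)
      then show "p + q + r + \<bar>q + r - p\<bar> \<le> z * 6" unfolding z_def by simp
    qed auto
    moreover have "0 \<le> \<bar>n3\<bar> * z" using z by auto
    ultimately show ?thesis unfolding coercive_def E by linarith
  qed
  moreover have "coercive (\<lambda>i j k. \<not> face_pat i j k) (1 / 3) (1 / 3) z n1 n2 n3 d"
  proof -
    \<comment> \<open>The plus energy has the form of the minus energy with \<open>z\<close>
      replaced by \<open>1 - z\<close>, as the reflection of the cube suggests.\<close>
    have "1 - n3\<^sup>2 * (z + (1 - z) * R) = n3\<^sup>2 * ((1 - z) + z * R)"
      using n_sq by (simp add: algebra_simps)
    then have E': "energy (\<lambda>i j k. \<not> face_pat i j k) (1 / 3) (1 / 3) z n1 n2 n3 d = n3\<^sup>2 * ((1 - z) + z * R)"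
      unfolding energy_compl[of face_pat] unit E .
    have "\<bar>n3\<bar> * (1 - z) / 3 \<le> n3\<^sup>2 * ((1 - z) + z * R)"
      using mult_mono[OF n3, of "1 - z" "(1 - z) + z * R"] z R by simp
    moreover have "vsum (\<lambda>i j k. \<not> face_pat i j k) (\<lambda>i j k. \<bar>lev n1 n2 n3 d i j k\<bar>)
      = \<bar>n3\<bar> * ((1 - p) + (1 - q) + (1 - r) + \<bar>1 - (q + r - p)\<bar>)"
    proof -
      have lev: "n1 + n3 - d = n3 * (1 - q)" "n2 + n3 - d = n3 * (1 - r)" "n3 - d = n3 * (1 - p)"
        "n1 + n2 + n3 - d = n3 * (1 - (q + r - p))"
        using d by (simp_all add: algebra_simps)
      have "\<bar>n1 + n3 - d\<bar> = \<bar>n3\<bar> * (1 - q)" "\<bar>n2 + n3 - d\<bar> = \<bar>n3\<bar> * (1 - r)"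
        "\<bar>n3 - d\<bar> = \<bar>n3\<bar> * (1 - p)" "\<bar>n1 + n2 + n3 - d\<bar> = \<bar>n3\<bar> * \<bar>1 - (q + r - p)\<bar>"
        unfolding lev abs_mult using p q r by simp_all
      then show ?thesis unfolding vsum_def face_pat_def lev_def by (simp add: distrib_left right_diff_distrib)
    qed
    moreover have "\<bar>n3\<bar> * ((1 - p) + (1 - q) + (1 - r) + \<bar>1 - (q + r - p)\<bar>) \<le> \<bar>n3\<bar> * (1 - z) * 6"
    proof (unfold mult.assoc, intro mult_left_mono)
      have "\<bar>1 - (q + r - p)\<bar> \<le> (1 - p) + (1 - q) + (1 - r)" by (rule abs_leI) (use p q r in auto)
      then show "(1 - p) + (1 - q) + (1 - r) + \<bar>1 - (q + r - p)\<bar> \<le> (1 - z) * 6"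
        unfolding z_def by (simp add: add_divide_distrib)
    qed auto
    moreover have "0 \<le> \<bar>n3\<bar> * (1 - z)" using z by auto
    ultimately show ?thesis unfolding coercive_def E' by linarith
  qed
  ultimately show ?thesis unfolding bicoercive_def z_def by auto
qed

text \<open>Solving the cyclic system for the plane gives
  \<open>(n1, n2, n3) = m * (A, B, C)\<close> with nonnegative \<open>A\<close>, \<open>B\<close>,
  \<open>C\<close>, so products of two normal components are nonnegative. Then both energies have
  nonnegative terms only, and the diagonal ones alone contribute \<open>1 / 9\<close>.\<close>

lemma bicoercive_tripod:
  assumes unit: "n1\<^sup>2 + n2\<^sup>2 + n3\<^sup>2 = 1"
    and a: "0 < a" "a < 1" and b: "0 < b" "b < 1" and c: "0 < c" "c < 1"
    and d: "n1 + n2 * a = d" "n2 + n3 * b = d" "n3 + n1 * c = d"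
  shows "bicoercive tripod_pat ((1 + c) / 3) ((1 + a) / 3) ((1 + b) / 3) n1 n2 n3 d"
proof -
  define m where "m = d / (1 + a * b * c)"
  define A B C where "A = 1 - a + a * b" and "B = 1 - b + b * c" and "C = 1 - c + c * a"
  have abc: "0 < 1 + a * b * c" using a b c by (simp add: add_pos_pos)
  have d_eq: "d = (1 + a * b * c) * m" using abc by (simp add: m_def)
  have lin: "(1 + a * b * c) * n1 = d * A" "(1 + a * b * c) * n2 = d * B" "(1 + a * b * c) * n3 = d * C"
  proof -
    have e: "d - n1 * c = n3" "d - n3 * b = n2" "d - n2 * a = n1" using d by auto
    have "(1 + a * b * c) * n1 - d * A = n1 - (d - (d - (d - n1 * c) * b) * a)"
      "(1 + a * b * c) * n2 - d * B = n2 - (d - (d - (d - n2 * a) * c) * b)"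
      "(1 + a * b * c) * n3 - d * C = n3 - (d - (d - (d - n3 * b) * a) * c)"
      unfolding A_def B_def C_def by (simp_all add: algebra_simps)
    then show "(1 + a * b * c) * n1 = d * A" "(1 + a * b * c) * n2 = d * B" "(1 + a * b * c) * n3 = d * C"
      unfolding e by auto
  qed
  have n: "n1 = A * m" "n2 = B * m" "n3 = C * m"
    using lin abc unfolding m_def by (simp_all add: field_simps)
  have ABC: "0 \<le> A" "0 \<le> B" "0 \<le> C" using a b c by (auto simp: A_def B_def C_def)
  have nn: "0 \<le> n1 * n2" "0 \<le> n1 * n3" "0 \<le> n2 * n3"
  proof -
    have "n1 * n2 = A * B * m\<^sup>2" "n1 * n3 = A * C * m\<^sup>2" "n2 * n3 = B * C * m\<^sup>2"
      unfolding n by (simp_all add: power2_eq_square)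
    then show "0 \<le> n1 * n2" "0 \<le> n1 * n3" "0 \<le> n2 * n3" using ABC by auto
  qed
  define x y z where "x = (1 + c) / 3" and "y = (1 + a) / 3" and "z = (1 + b) / 3"
  have xyz: "1/3 \<le> x" "x \<le> 2/3" "1/3 \<le> y" "y \<le> 2/3" "1/3 \<le> z" "z \<le> 2/3"
    using a b c by (auto simp: x_def y_def z_def)
  have nonneg: "0 \<le> k * p * (v * w)" if "0 \<le> k" "0 \<le> p" "0 \<le> v" "0 \<le> w" for k p v w :: real
    using that by simp
  have third: "1 / 9 \<le> u * v" if "1/3 \<le> u" "1/3 \<le> v" for u v :: real
    using mult_mono[OF that] that by auto
  have "energy tripod_pat x y z n1 n2 n3 d =
      n1\<^sup>2 * ((1 - y) * (1 - z)) + n2\<^sup>2 * ((1 - x) * (1 - z)) + n3\<^sup>2 * ((1 - x) * (1 - y))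
      + (n1 - d) * (- n2 * (x * (1 - z)) - n3 * (x * (1 - y)))
      + (n2 - d) * (- n1 * (y * (1 - z)) - n3 * ((1 - x) * y))
      + (n3 - d) * (- n1 * ((1 - y) * z) - n2 * ((1 - x) * z))"
    unfolding energy_simps tripod_pat_def by (simp add: algebra_simps power2_eq_square)
  also have "n1 - d = - (a * n2)" using d by (simp add: algebra_simps)
  also have "n2 - d = - (b * n3)" using d by (simp add: algebra_simps)
  also have "n3 - d = - (c * n1)" using d by (simp add: algebra_simps)
  finally have E: "energy tripod_pat x y z n1 n2 n3 d =
      n1\<^sup>2 * ((1 - y) * (1 - z)) + n2\<^sup>2 * ((1 - x) * (1 - z)) + n3\<^sup>2 * ((1 - x) * (1 - y))
      + (a * n2\<^sup>2 * (x * (1 - z)) + a * (n2 * n3) * (x * (1 - y))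
      + b * (n1 * n3) * (y * (1 - z)) + b * n3\<^sup>2 * ((1 - x) * y)
      + c * n1\<^sup>2 * ((1 - y) * z) + c * (n1 * n2) * ((1 - x) * z))"
    by (simp add: algebra_simps power2_eq_square)
  have "n1\<^sup>2 * (1 / 9) + n2\<^sup>2 * (1 / 9) + n3\<^sup>2 * (1 / 9) + (0 + 0 + 0 + 0 + 0 + 0) \<le> energy tripod_pat x y z n1 n2 n3 d"
    unfolding E by (intro add_mono mult_left_mono third nonneg) (use xyz a b c nn in auto)
  then have low: "1 / 30 \<le> energy tripod_pat x y z n1 n2 n3 d" using unit by linarith
  have "energy (\<lambda>i j k. \<not> tripod_pat i j k) x y z n1 n2 n3 d =
      n1\<^sup>2 * (y * z) + n2\<^sup>2 * (x * z) + n3\<^sup>2 * (x * y)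
      + (n1 + n2 - d) * (n1 * (y * (1 - z)) + n2 * (x * (1 - z)))
      + (n1 + n3 - d) * (n1 * ((1 - y) * z) + n3 * (x * (1 - y)))
      + (n2 + n3 - d) * (n2 * ((1 - x) * z) + n3 * ((1 - x) * y))"
    unfolding energy_simps tripod_pat_def by (simp add: algebra_simps power2_eq_square)
  also have "n1 + n2 - d = (1 - a) * n2" using d by (simp add: algebra_simps)
  also have "n1 + n3 - d = (1 - c) * n1" using d by (simp add: algebra_simps)
  also have "n2 + n3 - d = (1 - b) * n3" using d by (simp add: algebra_simps)
  finally have E': "energy (\<lambda>i j k. \<not> tripod_pat i j k) x y z n1 n2 n3 d =
      n1\<^sup>2 * (y * z) + n2\<^sup>2 * (x * z) + n3\<^sup>2 * (x * y)
      + ((1 - a) * (n1 * n2) * (y * (1 - z)) + (1 - a) * n2\<^sup>2 * (x * (1 - z))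
      + (1 - c) * n1\<^sup>2 * ((1 - y) * z) + (1 - c) * (n1 * n3) * (x * (1 - y))
      + (1 - b) * (n2 * n3) * ((1 - x) * z) + (1 - b) * n3\<^sup>2 * ((1 - x) * y))"
    by (simp add: algebra_simps power2_eq_square)
  have "n1\<^sup>2 * (1 / 9) + n2\<^sup>2 * (1 / 9) + n3\<^sup>2 * (1 / 9) + (0 + 0 + 0 + 0 + 0 + 0)
      \<le> energy (\<lambda>i j k. \<not> tripod_pat i j k) x y z n1 n2 n3 d"
    unfolding E' by (intro add_mono mult_left_mono third nonneg) (use xyz a b c nn in auto)
  then have "1 / 30 \<le> energy (\<lambda>i j k. \<not> tripod_pat i j k) x y z n1 n2 n3 d" using unit by linarith
  with low show ?thesis
    using coercive_if_energy_ge[OF unit, of d 1 a 0 tripod_pat x y z]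
      coercive_if_energy_ge[OF unit, of d 1 a 0 "\<lambda>i j k. \<not> tripod_pat i j k" x y z] a d(1)
    unfolding bicoercive_def x_def y_def z_def by auto
qed

text \<open>The triangle has the vertices \<open>(0, a, 0)\<close>, \<open>(b, 1, 1)\<close>,
  \<open>(1, 0, c)\<close>, and the plane equations give
  \<open>(n1, n2, n3) = m * (A, B, - C)\<close>. In contrast to the tripod, each energy contains one
  negative product, \<open>B * C\<close> on the minus side and \<open>A * B\<close> on the plus
  side; both are absorbed by the squares.\<close>

lemma bicoercive_path:
  assumes unit: "n1\<^sup>2 + n2\<^sup>2 + n3\<^sup>2 = 1"
    and a: "0 < a" "a < 1" and b: "0 < b" "b < 1" and c: "0 < c" "c < 1"
    and d: "n2 * a = d" "n1 * b + n2 + n3 = d" "n1 + n3 * c = d"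
  shows "bicoercive path_pat ((1 + b) / 3) ((1 + a) / 3) ((1 + c) / 3) n1 n2 n3 d"
proof -
  define A B C where "A = a + (1 - a) * c" and "B = 1 - b * c" and "C = 1 - a + a * b"
  have ABC: "0 < A" "0 \<le> B" "0 \<le> C" "a \<le> A"
    using a b c by (auto simp: A_def B_def C_def mult_le_one add_pos_nonneg)
  define m where "m = n1 / A"
  have n1: "n1 = A * m" using ABC by (simp add: m_def)
  have n3': "n3 = n2 * a - n1 * b - n2" using d by simp
  have An2: "A * n2 = n1 * B"
  proof -
    have "A * n2 - n1 * B = n2 * a - (n1 + n3 * c)"
      unfolding A_def B_def n3' by (simp add: algebra_simps)
    then show ?thesis using d by simp
  qed
  moreover have "A * n3 = - n1 * C"
  proof -
    have "A * n3 = (A * n2) * (a - 1) - A * n1 * b" unfolding n3' by (simp add: algebra_simps)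
    then show ?thesis unfolding An2 unfolding A_def B_def C_def by (simp add: algebra_simps)
  qed
  ultimately have n2: "n2 = B * m" and n3: "n3 = - (C * m)"
    using ABC(1) unfolding m_def by (simp_all add: field_simps)
  have d': "d = a * B * m" using d(1) unfolding n2 by (simp add: mult_ac)
  have n_sq: "m\<^sup>2 * (A\<^sup>2 + B\<^sup>2 + C\<^sup>2) = 1"
    using unit unfolding n1 n2 n3 by (simp add: algebra_simps power2_eq_square)
  define x y z where "x = (1 + b) / 3" and "y = (1 + a) / 3" and "z = (1 + c) / 3"
  have AM: "2 * (B * C) \<le> B\<^sup>2 + C\<^sup>2" "2 * (A * B) \<le> A\<^sup>2 + B\<^sup>2"
    using sum_squares_bound[of B C] sum_squares_bound[of A B] by simp_all
  \<comment> \<open>The centroid has coordinates with denominator 3, so products of two of them are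
    compared after multiplication by 9. The factor \<open>3 / 4\<close> is the minimum of
    \<open>(a - 1/2)\<^sup>2 + 3/4\<close>, which appears below on both sides.\<close>
  have scale: "S / 12 \<le> X" if "(3 / 4) * S \<le> 9 * X" for S X :: real using that by simp
  have low: "1 / 30 \<le> energy path_pat x y z n1 n2 n3 d"
  proof -
    have "energy path_pat x y z n1 n2 n3 d =
      n1\<^sup>2 * ((1 - y) * (1 - z)) + n2\<^sup>2 * (x * (1 - z)) + n3\<^sup>2 * (x * y)
      - d * (- n2 * ((1 - x) * (1 - z)) - n3 * ((1 - x) * (1 - y)))
      + (n1 - d) * (- n3 * (x * (1 - y)))
      + (n1 + n2 - d) * (n1 * (y * (1 - z)))
      + (n1 + n2 + n3 - d) * (n1 * (y * z) + n2 * (x * z))"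
      unfolding energy_simps path_pat_def by (simp add: algebra_simps power2_eq_square)
    also have "n1 - d = c * C * m" using d n3 by (simp add: algebra_simps)
    also have "n1 + n2 - d = (c * C + B) * m" using d n3 n2 by (simp add: algebra_simps)
    also have "n1 + n2 + n3 - d = (1 - b) * A * m" using d n1 by (simp add: algebra_simps)
    finally have "energy path_pat x y z n1 n2 n3 d = m\<^sup>2 *
      (A\<^sup>2 * ((1 - y) * (1 - z)) + B\<^sup>2 * (x * (1 - z)) + C\<^sup>2 * (x * y)
      + a * B\<^sup>2 * ((1 - x) * (1 - z)) - a * (B * C) * ((1 - x) * (1 - y))
      + c * C\<^sup>2 * (x * (1 - y)) + A * (c * C + B) * (y * (1 - z))
      + (1 - b) * A\<^sup>2 * (y * z) + (1 - b) * (A * B) * (x * z))"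
      unfolding n1 n2 n3 d' by (simp add: algebra_simps power2_eq_square)
    also have "\<dots> \<ge> m\<^sup>2 * ((A\<^sup>2 + B\<^sup>2 + C\<^sup>2) / 12)"
    proof (intro mult_left_mono)
      have "A\<^sup>2 * 1 \<le> A\<^sup>2 * ((2 - a) * (2 - c))"
        using mult_mono[of 1 "2 - a" 1 "2 - c"] a c by (intro mult_left_mono) auto
      moreover have "B\<^sup>2 * (1 + a) \<le> B\<^sup>2 * (((1 + b) + a * (2 - b)) * (2 - c))"
      proof (intro mult_left_mono)
        have "a * b \<le> a * 1" using a b by (intro mult_left_mono) auto
        then have ge: "1 + a \<le> (1 + b) + a * (2 - b)" using b by (simp add: algebra_simps)
        have "(1 + a) * 1 \<le> ((1 + b) + a * (2 - b)) * (2 - c)"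
          by (rule mult_mono[OF ge]) (use ge a c in auto)
        then show "1 + a \<le> ((1 + b) + a * (2 - b)) * (2 - c)" by simp
      qed auto
      moreover have "C\<^sup>2 * (1 + a) \<le> C\<^sup>2 * ((1 + b) * (1 + a))"
        using mult_right_mono[of 1 "1 + b" "1 + a"] a b by (intro mult_left_mono) auto
      moreover have "a * (B * C) * ((2 - b) * (2 - a)) \<le> (B\<^sup>2 + C\<^sup>2) * (a * (2 - a))"
      proof -
        have "(a * (2 - a) * (B * C)) * (2 - b) \<le> (a * (2 - a) * (B * C)) * 2"
          using a b ABC by (intro mult_left_mono) auto
        also have "\<dots> = (2 * (B * C)) * (a * (2 - a))" by simp
        also have "\<dots> \<le> (B\<^sup>2 + C\<^sup>2) * (a * (2 - a))"
          using AM a by (intro mult_right_mono) auto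
        finally show ?thesis by (simp add: algebra_simps)
      qed
      moreover have "(3 / 4) * B\<^sup>2 + (3 / 4) * C\<^sup>2 \<le> B\<^sup>2 * (1 + a) + C\<^sup>2 * (1 + a) - (B\<^sup>2 + C\<^sup>2) * (a * (2 - a))"
      proof -
        have "(1 + a) - a * (2 - a) = (a - 1/2)\<^sup>2 + 3/4" by (simp add: field_simps power2_eq_square)
        then have "3 / 4 \<le> (1 + a) - a * (2 - a)" by simp
        from mult_left_mono[OF this, of "B\<^sup>2 + C\<^sup>2"] show ?thesis by (simp add: algebra_simps)
      qed
      moreover have "(3 / 4) * U + ((3 / 4) * V + (3 / 4) * W) \<le> T1 + T2 + T3 - T4 + T5 + T6 + T7 + T8"
        if "U * 1 \<le> T1" "P \<le> T2" "Q \<le> T3" "T4 \<le> R" "(3 / 4) * V + (3 / 4) * W \<le> P + Q - R" "0 \<le> U" "0 \<le> T5"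
          "0 \<le> T6" "0 \<le> T7" "0 \<le> T8" for U V W P Q R T1 T2 T3 T4 T5 T6 T7 T8 :: real
        using that by linarith
      moreover have "0 \<le> A\<^sup>2" "0 \<le> c * C\<^sup>2 * ((1 + b) * (2 - a))" "0 \<le> A * (c * C + B) * ((1 + a) * (2 - c))"
        "0 \<le> (1 - b) * A\<^sup>2 * ((1 + a) * (1 + c))" "0 \<le> (1 - b) * (A * B) * ((1 + b) * (1 + c))"
        using a b c ABC by (auto intro!: mult_nonneg_nonneg add_nonneg_nonneg)
      ultimately have "(3 / 4) * A\<^sup>2 + ((3 / 4) * B\<^sup>2 + (3 / 4) * C\<^sup>2) \<le> A\<^sup>2 * ((2 - a) * (2 - c)) + B\<^sup>2 * (((1 + b) + a * (2 - b)) * (2 - c))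
        + C\<^sup>2 * ((1 + b) * (1 + a)) - a * (B * C) * ((2 - b) * (2 - a))
        + c * C\<^sup>2 * ((1 + b) * (2 - a)) + A * (c * C + B) * ((1 + a) * (2 - c))
        + (1 - b) * A\<^sup>2 * ((1 + a) * (1 + c)) + (1 - b) * (A * B) * ((1 + b) * (1 + c))"
        by blast
      also have "\<dots> = 9 * (A\<^sup>2 * ((1 - y) * (1 - z)) + B\<^sup>2 * (x * (1 - z)) + C\<^sup>2 * (x * y)
      + a * B\<^sup>2 * ((1 - x) * (1 - z)) - a * (B * C) * ((1 - x) * (1 - y))
      + c * C\<^sup>2 * (x * (1 - y)) + A * (c * C + B) * (y * (1 - z))
      + (1 - b) * A\<^sup>2 * (y * z) + (1 - b) * (A * B) * (x * z))"
        unfolding x_def y_def z_def by (simp add: field_simps)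
      finally have "(3 / 4) * (A\<^sup>2 + B\<^sup>2 + C\<^sup>2) \<le> 9 * (A\<^sup>2 * ((1 - y) * (1 - z)) + B\<^sup>2 * (x * (1 - z)) + C\<^sup>2 * (x * y)
      + a * B\<^sup>2 * ((1 - x) * (1 - z)) - a * (B * C) * ((1 - x) * (1 - y))
      + c * C\<^sup>2 * (x * (1 - y)) + A * (c * C + B) * (y * (1 - z))
      + (1 - b) * A\<^sup>2 * (y * z) + (1 - b) * (A * B) * (x * z))" by (simp only: distrib_left add.assoc)
      then show "(A\<^sup>2 + B\<^sup>2 + C\<^sup>2) / 12 \<le> A\<^sup>2 * ((1 - y) * (1 - z)) + B\<^sup>2 * (x * (1 - z)) + C\<^sup>2 * (x * y)
      + a * B\<^sup>2 * ((1 - x) * (1 - z)) - a * (B * C) * ((1 - x) * (1 - y))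
      + c * C\<^sup>2 * (x * (1 - y)) + A * (c * C + B) * (y * (1 - z))
      + (1 - b) * A\<^sup>2 * (y * z) + (1 - b) * (A * B) * (x * z)" by (rule scale)
    qed auto
    finally show ?thesis unfolding times_divide_eq_right n_sq by simp
  qed
  have high: "1 / 30 \<le> energy (\<lambda>i j k. \<not> path_pat i j k) x y z n1 n2 n3 d"
  proof -
    have "energy (\<lambda>i j k. \<not> path_pat i j k) x y z n1 n2 n3 d =
      n3\<^sup>2 * ((1 - x) * y) + n2\<^sup>2 * ((1 - x) * z) + n1\<^sup>2 * ((1 - y) * z)
      + (n2 - d) * (n2 * ((1 - x) * (1 - z)) - n1 * (y * (1 - z)))
      + (n3 - d) * (n3 * ((1 - x) * (1 - y)))
      + (n1 + n3 - d) * (n3 * (x * (1 - y)) - n2 * (x * z))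
      + (n2 + n3 - d) * (- n1 * (y * z))"
      unfolding energy_simps path_pat_def by (simp add: algebra_simps power2_eq_square)
    also have "n2 - d = (1 - a) * B * m" using d n2 by (simp add: algebra_simps)
    also have "n3 - d = - (a * B + C) * m" using d' n3 by (simp add: algebra_simps)
    also have "n1 + n3 - d = - (1 - c) * C * m" using d n3 by (simp add: algebra_simps)
    also have "n2 + n3 - d = - (b * A * m)" using d n1 by (simp add: algebra_simps)
    finally have "energy (\<lambda>i j k. \<not> path_pat i j k) x y z n1 n2 n3 d = m\<^sup>2 *
      (C\<^sup>2 * ((1 - x) * y) + B\<^sup>2 * ((1 - x) * z) + A\<^sup>2 * ((1 - y) * z)
      + (1 - a) * B\<^sup>2 * ((1 - x) * (1 - z)) - (1 - a) * (A * B) * (y * (1 - z))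
      + (a * B + C) * C * ((1 - x) * (1 - y))
      + (1 - c) * C\<^sup>2 * (x * (1 - y)) + (1 - c) * (B * C) * (x * z)
      + b * A\<^sup>2 * (y * z))"
      unfolding n1 n2 n3 by (simp add: algebra_simps power2_eq_square)
    also have "\<dots> \<ge> m\<^sup>2 * ((A\<^sup>2 + B\<^sup>2 + C\<^sup>2) / 12)"
    proof (intro mult_left_mono)
      have "A\<^sup>2 * (2 - a) \<le> A\<^sup>2 * ((2 - a) * (1 + c))"
        using mult_left_mono[of 1 "1 + c" "2 - a"] a c by (intro mult_left_mono) auto
      moreover have "B\<^sup>2 * (1 + (1 - a) * (2 - c)) \<le> B\<^sup>2 * ((2 - b) * (1 + c) + (1 - a) * ((2 - b) * (2 - c)))"
      proof (intro mult_left_mono add_mono)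
        show "1 \<le> (2 - b) * (1 + c)" using mult_mono[of 1 "2 - b" 1 "1 + c"] b c by auto
        show "2 - c \<le> (2 - b) * (2 - c)" using mult_right_mono[of 1 "2 - b" "2 - c"] b c by auto
      qed (use a in auto)
      moreover have "C\<^sup>2 * 1 \<le> C\<^sup>2 * ((2 - b) * (1 + a))"
        using mult_mono[of 1 "2 - b" 1 "1 + a"] a b by (intro mult_left_mono) auto
      moreover have "(1 - a) * (A * B) * ((1 + a) * (2 - c)) \<le> A\<^sup>2 * (1 - a\<^sup>2) + B\<^sup>2 * ((1 - a) * (2 - c))"
      proof -
        have "a * a \<le> 1" using a by (simp add: mult_le_one)
        then have aa: "0 \<le> 1 - a\<^sup>2" "1 - a\<^sup>2 = (1 - a) * (1 + a)" by (simp_all add: algebra_simps power2_eq_square)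
        have "(1 - a) * (A * B) * ((1 + a) * (2 - c)) = ((1 - a\<^sup>2) * (2 - c) / 2) * (2 * (A * B))"
          unfolding aa(2) by simp
        also have "\<dots> \<le> ((1 - a\<^sup>2) * (2 - c) / 2) * (A\<^sup>2 + B\<^sup>2)"
          using AM aa c by (intro mult_left_mono) auto
        also have "\<dots> = A\<^sup>2 * ((1 - a\<^sup>2) * ((2 - c) / 2)) + B\<^sup>2 * ((1 - a) * (2 - c) * ((1 + a) / 2))"
          unfolding aa(2) by (simp add: field_simps)
        also have "\<dots> \<le> A\<^sup>2 * (1 - a\<^sup>2) + B\<^sup>2 * ((1 - a) * (2 - c))"
          using aa a c by (intro add_mono mult_left_mono mult_left_le) auto
        finally show ?thesis .
      qed
      moreover have "(3 / 4) * A\<^sup>2 \<le> A\<^sup>2 * (2 - a) - A\<^sup>2 * (1 - a\<^sup>2)"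
      proof -
        have "(2 - a) - (1 - a\<^sup>2) = (a - 1/2)\<^sup>2 + 3/4" by (simp add: field_simps power2_eq_square)
        then have "3 / 4 \<le> (2 - a) - (1 - a\<^sup>2)" by simp
        from mult_left_mono[OF this, of "A\<^sup>2"] show ?thesis by (simp add: algebra_simps)
      qed
      moreover have "B\<^sup>2 * (1 + (1 - a) * (2 - c)) = B\<^sup>2 + B\<^sup>2 * ((1 - a) * (2 - c))"
        by (simp add: algebra_simps)
      moreover have "(3 / 4) * U + (3 / 4) * V + (3 / 4) * W \<le> T1 + T2 + T3 - T4 + T5 + T6 + T7 + T8"
        if "P \<le> T3" "Q \<le> T2" "W * 1 \<le> T1" "T4 \<le> R + S" "(3 / 4) * U \<le> P - R" "Q = V + S" "0 \<le> T5"
          "0 \<le> T6" "0 \<le> T7" "0 \<le> T8" "0 \<le> U" "0 \<le> V" "0 \<le> W" for U V W P Q R S T1 T2 T3 T4 T5 T6 T7 T8 :: real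
        using that by linarith
      moreover have "0 \<le> (a * B + C) * C * ((2 - b) * (2 - a))" "0 \<le> (1 - c) * C\<^sup>2 * ((1 + b) * (2 - a))"
        "0 \<le> (1 - c) * (B * C) * ((1 + b) * (1 + c))" "0 \<le> b * A\<^sup>2 * ((1 + a) * (1 + c))"
        "0 \<le> A\<^sup>2" "0 \<le> B\<^sup>2" "0 \<le> C\<^sup>2"
        using a b c ABC by (auto intro!: mult_nonneg_nonneg add_nonneg_nonneg)
      ultimately have "(3 / 4) * A\<^sup>2 + (3 / 4) * B\<^sup>2 + (3 / 4) * C\<^sup>2 \<le> C\<^sup>2 * ((2 - b) * (1 + a)) + B\<^sup>2 * ((2 - b) * (1 + c) + (1 - a) * ((2 - b) * (2 - c)))
        + A\<^sup>2 * ((2 - a) * (1 + c)) - (1 - a) * (A * B) * ((1 + a) * (2 - c))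
        + (a * B + C) * C * ((2 - b) * (2 - a)) + (1 - c) * C\<^sup>2 * ((1 + b) * (2 - a))
        + (1 - c) * (B * C) * ((1 + b) * (1 + c)) + b * A\<^sup>2 * ((1 + a) * (1 + c))"
        by blast
      also have "\<dots> = 9 * (C\<^sup>2 * ((1 - x) * y) + B\<^sup>2 * ((1 - x) * z) + A\<^sup>2 * ((1 - y) * z)
      + (1 - a) * B\<^sup>2 * ((1 - x) * (1 - z)) - (1 - a) * (A * B) * (y * (1 - z))
      + (a * B + C) * C * ((1 - x) * (1 - y))
      + (1 - c) * C\<^sup>2 * (x * (1 - y)) + (1 - c) * (B * C) * (x * z)
      + b * A\<^sup>2 * (y * z))"
        unfolding x_def y_def z_def by (simp add: field_simps)
      finally have "(3 / 4) * (A\<^sup>2 + B\<^sup>2 + C\<^sup>2) \<le> 9 * (C\<^sup>2 * ((1 - x) * y) + B\<^sup>2 * ((1 - x) * z) + A\<^sup>2 * ((1 - y) * z)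
      + (1 - a) * B\<^sup>2 * ((1 - x) * (1 - z)) - (1 - a) * (A * B) * (y * (1 - z))
      + (a * B + C) * C * ((1 - x) * (1 - y))
      + (1 - c) * C\<^sup>2 * (x * (1 - y)) + (1 - c) * (B * C) * (x * z)
      + b * A\<^sup>2 * (y * z))" by (simp only: distrib_left add.assoc)
      then show "(A\<^sup>2 + B\<^sup>2 + C\<^sup>2) / 12 \<le> C\<^sup>2 * ((1 - x) * y) + B\<^sup>2 * ((1 - x) * z) + A\<^sup>2 * ((1 - y) * z)
      + (1 - a) * B\<^sup>2 * ((1 - x) * (1 - z)) - (1 - a) * (A * B) * (y * (1 - z))
      + (a * B + C) * C * ((1 - x) * (1 - y))
      + (1 - c) * C\<^sup>2 * (x * (1 - y)) + (1 - c) * (B * C) * (x * z)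
      + b * A\<^sup>2 * (y * z)" by (rule scale)
    qed auto
    finally show ?thesis unfolding times_divide_eq_right n_sq by simp
  qed
  from low high show ?thesis
    using coercive_if_energy_ge[OF unit, of d 0 a 0 path_pat x y z]
      coercive_if_energy_ge[OF unit, of d 0 a 0 "\<lambda>i j k. \<not> path_pat i j k" x y z] a d(1)
    unfolding bicoercive_def x_def y_def z_def by auto
qed

section \<open>Symmetries and classification of the cut patterns\<close>

definition bin :: "real \<Rightarrow> bool" where
  "bin x \<longleftrightarrow> x = 0 \<or> x = 1"

type_synonym triple = "real \<times> real \<times> real"

definition edge_points :: "triple set" where
  "edge_points = {(x, y, z). (0 < x \<and> x < 1 \<and> bin y \<and> bin z) \<or> (bin x \<and> 0 < y \<and> y < 1 \<and> bin z) \<or>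
     (bin x \<and> bin y \<and> 0 < z \<and> z < 1)}"

definition coface :: "triple set \<Rightarrow> bool" where
  "coface S \<longleftrightarrow> (\<exists>c. bin c \<and> ((\<forall>(x, y, z)\<in>S. x = c) \<or> (\<forall>(x, y, z)\<in>S. y = c) \<or> (\<forall>(x, y, z)\<in>S. z = c)))"

text \<open>Full lines through the edges of one direction. For cut points, which lie in the cube,
  membership agrees with lying on such an edge (\<open>edges_dir_triples\<close>).\<close>

definition edges1 :: "triple set" where "edges1 = {(x, y, z). bin y \<and> bin z}"
definition edges2 :: "triple set" where "edges2 = {(x, y, z). bin x \<and> bin z}"
definition edges3 :: "triple set" where "edges3 = {(x, y, z). bin x \<and> bin y}"

text \<open>For a unit normal this says that \<open>(u, v, w)\<close> lies outside the open ball of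
  radius 5 around \<open>5 * (n1, n2, n3)\<close>: expanding the squared distance to the centre
  gives exactly this inequality.\<close>

definition near :: "real \<Rightarrow> real \<Rightarrow> real \<Rightarrow> real \<Rightarrow> real \<Rightarrow> real \<Rightarrow> bool" where
  "near n1 n2 n3 u v w \<longleftrightarrow> n1 * u + n2 * v + n3 * w \<le> (u\<^sup>2 + v\<^sup>2 + w\<^sup>2) / 10"

text \<open>What the two tangent balls at a surface point imply for the cube, with the normal
  pointing to the minus side: each ball avoids the vertices of the opposite side and all cut
  points.\<close>

definition supported :: "triple set \<Rightarrow> (bool \<Rightarrow> bool \<Rightarrow> bool \<Rightarrow> bool) \<Rightarrow> triple \<Rightarrow> bool" where
  "supported P s = (\<lambda>(x, y, z). \<exists>n1 n2 n3. n1\<^sup>2 + n2\<^sup>2 + n3\<^sup>2 = 1 \<and>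
     (\<forall>i j k. s i j k \<longrightarrow> near (- n1) (- n2) (- n3) (of_bool i - x) (of_bool j - y) (of_bool k - z)) \<and>
     (\<forall>i j k. \<not> s i j k \<longrightarrow> near n1 n2 n3 (of_bool i - x) (of_bool j - y) (of_bool k - z)) \<and>
     (\<forall>(x', y', z')\<in>P. near n1 n2 n3 (x' - x) (y' - y) (z' - z) \<and>
       near (- n1) (- n2) (- n3) (x' - x) (y' - y) (z' - z)))"

text \<open>A purely combinatorial record of the surface in one cube, on which the symmetries of the
  cube can act. Cut points on edges with both ends on the same side are still allowed; excluding
  them is left to the condition \<open>supported\<close> and to the counting on faces.\<close>

definition cut_config :: "triple set \<Rightarrow> (bool \<Rightarrow> bool \<Rightarrow> bool \<Rightarrow> bool) \<Rightarrow> bool" where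
  "cut_config P s \<longleftrightarrow> P \<subseteq> edge_points \<and>
     (\<forall>x x' y z. (x, y, z) \<in> P \<longrightarrow> (x', y, z) \<in> P \<longrightarrow> bin y \<longrightarrow> bin z \<longrightarrow> x = x') \<and>
     (\<forall>x y y' z. (x, y, z) \<in> P \<longrightarrow> (x, y', z) \<in> P \<longrightarrow> bin x \<longrightarrow> bin z \<longrightarrow> y = y') \<and>
     (\<forall>x y z z'. (x, y, z) \<in> P \<longrightarrow> (x, y, z') \<in> P \<longrightarrow> bin x \<longrightarrow> bin y \<longrightarrow> z = z') \<and>
     (\<forall>j k. s False j k \<noteq> s True j k \<longrightarrow> (\<exists>x. (x, of_bool j, of_bool k) \<in> P)) \<and>
     (\<forall>i k. s i False k \<noteq> s i True k \<longrightarrow> (\<exists>y. (of_bool i, y, of_bool k) \<in> P)) \<and>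
     (\<forall>i j. s i j False \<noteq> s i j True \<longrightarrow> (\<exists>z. (of_bool i, of_bool j, z) \<in> P)) \<and>
     (\<forall>p\<in>P. \<forall>q\<in>P. \<forall>r\<in>P. p \<noteq> q \<longrightarrow> p \<noteq> r \<longrightarrow> q \<noteq> r \<longrightarrow> \<not> coface {p, q, r}) \<and>
     (\<forall>p\<in>P. supported P s p)"

text \<open>The selection rule with the counts of cut faces dropped. It keeps conditions that the
  symmetries of the cube respect, and accepts any three of at most four cut points.\<close>

definition admissible_triple :: "triple set \<Rightarrow> triple set \<Rightarrow> bool" where
  "admissible_triple P K \<longleftrightarrow> K \<subseteq> P \<and> card K = 3 \<and>
     (card P \<le> 4 \<or> (\<exists>E\<in>{edges1, edges2, edges3}. P \<subseteq> E \<or> K = P \<inter> E) \<or>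
      (\<forall>p\<in>K. \<forall>q\<in>K. p \<noteq> q \<longrightarrow> \<not> coface {p, q}))"

section \<open>Symmetries acting on cut configurations\<close>

lemma bin_flip: "bin (1 - x) \<longleftrightarrow> bin x"
  unfolding bin_def by auto

text \<open>Two transpositions of axes and one reflection generate all 48 symmetries of the
  cube.\<close>

definition swap12 :: "triple \<Rightarrow> triple" where "swap12 = (\<lambda>(x, y, z). (y, x, z))"
definition swap23 :: "triple \<Rightarrow> triple" where "swap23 = (\<lambda>(x, y, z). (x, z, y))"
definition flip1 :: "triple \<Rightarrow> triple" where "flip1 = (\<lambda>(x, y, z). (1 - x, y, z))"

lemma swap12_mem: "(x, y, z) \<in> swap12 ` P \<longleftrightarrow> (y, x, z) \<in> P"
  unfolding swap12_def by force

lemma swap23_mem: "(x, y, z) \<in> swap23 ` P \<longleftrightarrow> (x, z, y) \<in> P"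
  unfolding swap23_def by force

lemma flip1_mem: "(x, y, z) \<in> flip1 ` P \<longleftrightarrow> (1 - x, y, z) \<in> P"
  unfolding flip1_def by force

lemma inj_symmetries: "inj swap12" "inj swap23" "inj flip1"
  unfolding swap12_def swap23_def flip1_def inj_def by auto

lemma involutions: "swap12 ` swap12 ` P = P" "swap23 ` swap23 ` P = P" "flip1 ` flip1 ` P = P"
  unfolding swap12_def swap23_def flip1_def by force+

lemma coface_symmetries:
  "coface (swap12 ` S) \<longleftrightarrow> coface S" "coface (swap23 ` S) \<longleftrightarrow> coface S" "coface (flip1 ` S) \<longleftrightarrow> coface S"
proof -
  show "coface (swap12 ` S) \<longleftrightarrow> coface S" "coface (swap23 ` S) \<longleftrightarrow> coface S"
    unfolding coface_def swap12_def swap23_def by (auto simp: case_prod_beta)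
  have "coface (flip1 ` S)" if "coface S" for S
  proof -
    from that obtain c where c: "bin c" "(\<forall>(x, y, z)\<in>S. x = c) \<or> (\<forall>(x, y, z)\<in>S. y = c) \<or> (\<forall>(x, y, z)\<in>S. z = c)"
      unfolding coface_def by auto
    then show ?thesis
    proof (elim disjE)
      assume "\<forall>(x, y, z)\<in>S. x = c"
      then show ?thesis using c(1) unfolding coface_def flip1_def
        by (intro exI[of _ "1 - c"]) (auto simp: bin_flip)
    qed (use c(1) in \<open>auto simp: coface_def flip1_def intro!: exI[of _ c]\<close>)
  qed
  from this[of S] this[of "flip1 ` S"] show "coface (flip1 ` S) \<longleftrightarrow> coface S"
    unfolding involutions by blast
qed

lemma supportedI:
  assumes "n1\<^sup>2 + n2\<^sup>2 + n3\<^sup>2 = 1"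
    and "\<And>i j k. s i j k \<Longrightarrow> near (- n1) (- n2) (- n3) (of_bool i - x) (of_bool j - y) (of_bool k - z)"
    and "\<And>i j k. \<not> s i j k \<Longrightarrow> near n1 n2 n3 (of_bool i - x) (of_bool j - y) (of_bool k - z)"
    and "\<And>x' y' z'. (x', y', z') \<in> P \<Longrightarrow> near n1 n2 n3 (x' - x) (y' - y) (z' - z)"
    and "\<And>x' y' z'. (x', y', z') \<in> P \<Longrightarrow> near (- n1) (- n2) (- n3) (x' - x) (y' - y) (z' - z)"
  shows "supported P s (x, y, z)"
  unfolding supported_def prod.case using assms by (intro exI[of _ n1] exI[of _ n2] exI[of _ n3]) auto

lemma supportedE:
  assumes "supported P s (x, y, z)"
  obtains n1 n2 n3 where "n1\<^sup>2 + n2\<^sup>2 + n3\<^sup>2 = 1"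
    and "\<And>i j k. s i j k \<Longrightarrow> near (- n1) (- n2) (- n3) (of_bool i - x) (of_bool j - y) (of_bool k - z)"
    and "\<And>i j k. \<not> s i j k \<Longrightarrow> near n1 n2 n3 (of_bool i - x) (of_bool j - y) (of_bool k - z)"
    and "\<And>x' y' z'. (x', y', z') \<in> P \<Longrightarrow> near n1 n2 n3 (x' - x) (y' - y) (z' - z)"
    and "\<And>x' y' z'. (x', y', z') \<in> P \<Longrightarrow> near (- n1) (- n2) (- n3) (x' - x) (y' - y) (z' - z)"
  using assms unfolding supported_def prod.case by blast

lemma near_swap12: "near n2 n1 n3 v u w \<longleftrightarrow> near n1 n2 n3 u v w"
  and near_swap23: "near n1 n3 n2 u w v \<longleftrightarrow> near n1 n2 n3 u v w"
  and near_flip1: "near (- n1) n2 n3 u v w \<longleftrightarrow> near n1 n2 n3 (- u) v w"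
  unfolding near_def by (simp_all add: algebra_simps)

text \<open>Exchanging the sides reverses the normal.\<close>

lemma supported_compl: "supported P s p \<Longrightarrow> supported P (\<lambda>i j k. \<not> s i j k) p"
proof -
  obtain x y z where p: "p = (x, y, z)" by (cases p)
  assume "supported P s p"
  then show ?thesis unfolding p
  proof (rule supportedE)
    fix n1 n2 n3
    assume n: "n1\<^sup>2 + n2\<^sup>2 + n3\<^sup>2 = 1"
      "\<And>i j k. s i j k \<Longrightarrow> near (- n1) (- n2) (- n3) (of_bool i - x) (of_bool j - y) (of_bool k - z)"
      "\<And>i j k. \<not> s i j k \<Longrightarrow> near n1 n2 n3 (of_bool i - x) (of_bool j - y) (of_bool k - z)"
      "\<And>x' y' z'. (x', y', z') \<in> P \<Longrightarrow> near n1 n2 n3 (x' - x) (y' - y) (z' - z)"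
      "\<And>x' y' z'. (x', y', z') \<in> P \<Longrightarrow> near (- n1) (- n2) (- n3) (x' - x) (y' - y) (z' - z)"
    show "supported P (\<lambda>i j k. \<not> s i j k) (x, y, z)"
      by (rule supportedI[of "- n1" "- n2" "- n3"]) (use n in auto)
  qed
qed

lemma supported_swap12: "supported P s p \<Longrightarrow> supported (swap12 ` P) (\<lambda>i j k. s j i k) (swap12 p)"
proof -
  obtain x y z where p: "p = (x, y, z)" by (cases p)
  assume "supported P s p"
  then show ?thesis unfolding p
  proof (rule supportedE)
    fix n1 n2 n3
    assume n: "n1\<^sup>2 + n2\<^sup>2 + n3\<^sup>2 = 1"
      "\<And>i j k. s i j k \<Longrightarrow> near (- n1) (- n2) (- n3) (of_bool i - x) (of_bool j - y) (of_bool k - z)"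
      "\<And>i j k. \<not> s i j k \<Longrightarrow> near n1 n2 n3 (of_bool i - x) (of_bool j - y) (of_bool k - z)"
      "\<And>x' y' z'. (x', y', z') \<in> P \<Longrightarrow> near n1 n2 n3 (x' - x) (y' - y) (z' - z)"
      "\<And>x' y' z'. (x', y', z') \<in> P \<Longrightarrow> near (- n1) (- n2) (- n3) (x' - x) (y' - y) (z' - z)"
    have "supported (swap12 ` P) (\<lambda>i j k. s j i k) (y, x, z)"
      by (rule supportedI[of n2 n1 n3]) (use n in \<open>auto simp: swap12_mem near_swap12\<close>)
    then show "supported (swap12 ` P) (\<lambda>i j k. s j i k) (swap12 (x, y, z))" by (simp add: swap12_def)
  qed
qed

lemma supported_swap23: "supported P s p \<Longrightarrow> supported (swap23 ` P) (\<lambda>i j k. s i k j) (swap23 p)"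
proof -
  obtain x y z where p: "p = (x, y, z)" by (cases p)
  assume "supported P s p"
  then show ?thesis unfolding p
  proof (rule supportedE)
    fix n1 n2 n3
    assume n: "n1\<^sup>2 + n2\<^sup>2 + n3\<^sup>2 = 1"
      "\<And>i j k. s i j k \<Longrightarrow> near (- n1) (- n2) (- n3) (of_bool i - x) (of_bool j - y) (of_bool k - z)"
      "\<And>i j k. \<not> s i j k \<Longrightarrow> near n1 n2 n3 (of_bool i - x) (of_bool j - y) (of_bool k - z)"
      "\<And>x' y' z'. (x', y', z') \<in> P \<Longrightarrow> near n1 n2 n3 (x' - x) (y' - y) (z' - z)"
      "\<And>x' y' z'. (x', y', z') \<in> P \<Longrightarrow> near (- n1) (- n2) (- n3) (x' - x) (y' - y) (z' - z)"
    have "supported (swap23 ` P) (\<lambda>i j k. s i k j) (x, z, y)"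
      by (rule supportedI[of n1 n3 n2]) (use n in \<open>auto simp: swap23_mem near_swap23\<close>)
    then show "supported (swap23 ` P) (\<lambda>i j k. s i k j) (swap23 (x, y, z))" by (simp add: swap23_def)
  qed
qed

lemma supported_flip1: "supported P s p \<Longrightarrow> supported (flip1 ` P) (\<lambda>i j k. s (\<not> i) j k) (flip1 p)"
proof -
  obtain x y z where p: "p = (x, y, z)" by (cases p)
  assume "supported P s p"
  then show ?thesis unfolding p
  proof (rule supportedE)
    fix n1 n2 n3
    assume n: "n1\<^sup>2 + n2\<^sup>2 + n3\<^sup>2 = 1"
      "\<And>i j k. s i j k \<Longrightarrow> near (- n1) (- n2) (- n3) (of_bool i - x) (of_bool j - y) (of_bool k - z)"
      "\<And>i j k. \<not> s i j k \<Longrightarrow> near n1 n2 n3 (of_bool i - x) (of_bool j - y) (of_bool k - z)"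
      "\<And>x' y' z'. (x', y', z') \<in> P \<Longrightarrow> near n1 n2 n3 (x' - x) (y' - y) (z' - z)"
      "\<And>x' y' z'. (x', y', z') \<in> P \<Longrightarrow> near (- n1) (- n2) (- n3) (x' - x) (y' - y) (z' - z)"
    have [simp]: "- (of_bool i - (1 - x)) = of_bool (\<not> i) - x" for i
      by (simp add: of_bool_def)
    have [simp]: "- (x' - (1 - x)) = (1 - x') - x" for x'
      by simp
    have "supported (flip1 ` P) (\<lambda>i j k. s (\<not> i) j k) (1 - x, y, z)"
    proof (rule supportedI[of "- n1" n2 n3])
      show "(- n1)\<^sup>2 + n2\<^sup>2 + n3\<^sup>2 = 1" using n(1) by simp
    next
      fix i j k assume "s (\<not> i) j k"
      from n(2)[OF this] show "near (- (- n1)) (- n2) (- n3) (of_bool i - (1 - x)) (of_bool j - y) (of_bool k - z)"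
        unfolding near_flip1[of "- n1"] near_flip1[of n1] by (simp only: \<open>\<And>i. - (of_bool i - (1 - x)) = of_bool (\<not> i) - x\<close>)
    next
      fix i j k assume "\<not> s (\<not> i) j k"
      from n(3)[OF this] show "near (- n1) n2 n3 (of_bool i - (1 - x)) (of_bool j - y) (of_bool k - z)"
        unfolding near_flip1 by (simp only: \<open>\<And>i. - (of_bool i - (1 - x)) = of_bool (\<not> i) - x\<close>)
    next
      fix x' y' z' assume "(x', y', z') \<in> flip1 ` P"
      then have "(1 - x', y', z') \<in> P" by (simp add: flip1_mem)
      from n(4)[OF this] n(5)[OF this]
      show "near (- n1) n2 n3 (x' - (1 - x)) (y' - y) (z' - z)" "near (- (- n1)) (- n2) (- n3) (x' - (1 - x)) (y' - y) (z' - z)"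
        unfolding near_flip1[of "- n1"] near_flip1[of n1] by (simp_all only: \<open>\<And>x'. - (x' - (1 - x)) = (1 - x') - x\<close>)
    qed
    then show "supported (flip1 ` P) (\<lambda>i j k. s (\<not> i) j k) (flip1 (x, y, z))" by (simp add: flip1_def)
  qed
qed

lemma cut_configI:
  assumes "P \<subseteq> edge_points"
    and "\<And>x x' y z. (x, y, z) \<in> P \<Longrightarrow> (x', y, z) \<in> P \<Longrightarrow> bin y \<Longrightarrow> bin z \<Longrightarrow> x = x'"
    and "\<And>x y y' z. (x, y, z) \<in> P \<Longrightarrow> (x, y', z) \<in> P \<Longrightarrow> bin x \<Longrightarrow> bin z \<Longrightarrow> y = y'"
    and "\<And>x y z z'. (x, y, z) \<in> P \<Longrightarrow> (x, y, z') \<in> P \<Longrightarrow> bin x \<Longrightarrow> bin y \<Longrightarrow> z = z'"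
    and "\<And>j k. s False j k \<noteq> s True j k \<Longrightarrow> \<exists>x. (x, of_bool j, of_bool k) \<in> P"
    and "\<And>i k. s i False k \<noteq> s i True k \<Longrightarrow> \<exists>y. (of_bool i, y, of_bool k) \<in> P"
    and "\<And>i j. s i j False \<noteq> s i j True \<Longrightarrow> \<exists>z. (of_bool i, of_bool j, z) \<in> P"
    and "\<And>p q r. p \<in> P \<Longrightarrow> q \<in> P \<Longrightarrow> r \<in> P \<Longrightarrow> p \<noteq> q \<Longrightarrow> p \<noteq> r \<Longrightarrow> q \<noteq> r \<Longrightarrow> \<not> coface {p, q, r}"
    and "\<And>p. p \<in> P \<Longrightarrow> supported P s p"
  shows "cut_config P s"
  unfolding cut_config_def by (intro conjI allI ballI impI; (rule assms; assumption)?)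

lemma cut_configD:
  assumes "cut_config P s"
  shows "P \<subseteq> edge_points"
    and "(x, y, z) \<in> P \<Longrightarrow> (x', y, z) \<in> P \<Longrightarrow> bin y \<Longrightarrow> bin z \<Longrightarrow> x = x'"
    and "(x, y, z) \<in> P \<Longrightarrow> (x, y', z) \<in> P \<Longrightarrow> bin x \<Longrightarrow> bin z \<Longrightarrow> y = y'"
    and "(x, y, z) \<in> P \<Longrightarrow> (x, y, z') \<in> P \<Longrightarrow> bin x \<Longrightarrow> bin y \<Longrightarrow> z = z'"
    and "s False j k \<noteq> s True j k \<Longrightarrow> \<exists>x. (x, of_bool j, of_bool k) \<in> P"
    and "s i False k \<noteq> s i True k \<Longrightarrow> \<exists>y. (of_bool i, y, of_bool k) \<in> P"
    and "s i j False \<noteq> s i j True \<Longrightarrow> \<exists>z. (of_bool i, of_bool j, z) \<in> P"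
    and "p \<in> P \<Longrightarrow> q \<in> P \<Longrightarrow> r \<in> P \<Longrightarrow> p \<noteq> q \<Longrightarrow> p \<noteq> r \<Longrightarrow> q \<noteq> r \<Longrightarrow> \<not> coface {p, q, r}"
    and "p \<in> P \<Longrightarrow> supported P s p"
  using assms unfolding cut_config_def by (elim conjE, simp)+

lemma cut_config_compl:
  assumes "cut_config P s" shows "cut_config P (\<lambda>i j k. \<not> s i j k)"
proof -
  note D = cut_configD[OF assms]
  show ?thesis
  proof (rule cut_configI)
    show "\<exists>x. (x, of_bool j, of_bool k) \<in> P" if "(\<not> s False j k) \<noteq> (\<not> s True j k)" for j k
      by (rule D(5)) (use that in blast)
    show "\<exists>y. (of_bool i, y, of_bool k) \<in> P" if "(\<not> s i False k) \<noteq> (\<not> s i True k)" for i k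
      by (rule D(6)) (use that in blast)
    show "\<exists>z. (of_bool i, of_bool j, z) \<in> P" if "(\<not> s i j False) \<noteq> (\<not> s i j True)" for i j
      by (rule D(7)) (use that in blast)
    show "supported P (\<lambda>i j k. \<not> s i j k) p" if "p \<in> P" for p
      by (rule supported_compl[OF D(9)[OF that]])
  qed (fact D)+
qed

lemma triple_coface_image:
  assumes "cut_config P s" and coface: "\<And>S. coface (g ` S) \<longleftrightarrow> coface S"
    and "p \<in> g ` P" "q \<in> g ` P" "r \<in> g ` P" "p \<noteq> q" "p \<noteq> r" "q \<noteq> r"
  shows "\<not> coface {p, q, r}"
proof -
  from assms(3-) obtain p' q' r' where p: "p' \<in> P" "q' \<in> P" "r' \<in> P" "p = g p'" "q = g q'" "r = g r'" "p' \<noteq> q'" "p' \<noteq> r'" "q' \<noteq> r'"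
    by blast
  have "\<not> coface {p', q', r'}" by (rule cut_configD(8)[OF assms(1)]) (fact p)+
  then show ?thesis using coface[of "{p', q', r'}"] p(4-6) by simp
qed

lemma cut_config_swap12:
  assumes "cut_config P s" shows "cut_config (swap12 ` P) (\<lambda>i j k. s j i k)"
proof -
  note D = cut_configD[OF assms]
  show ?thesis
  proof (rule cut_configI, unfold swap12_mem)
    show "swap12 ` P \<subseteq> edge_points" using D(1) by (auto simp: swap12_def edge_points_def)
    show "\<not> coface {p, q, r}" if "p \<in> swap12 ` P" "q \<in> swap12 ` P" "r \<in> swap12 ` P" "p \<noteq> q" "p \<noteq> r" "q \<noteq> r" for p q r
      by (rule triple_coface_image[OF assms coface_symmetries(1)]) (fact that)+
    show "supported (swap12 ` P) (\<lambda>i j k. s j i k) p" if "p \<in> swap12 ` P" for p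
      using that D(9) supported_swap12 by blast
  qed (erule D; assumption)+
qed

lemma cut_config_swap23:
  assumes "cut_config P s" shows "cut_config (swap23 ` P) (\<lambda>i j k. s i k j)"
proof -
  note D = cut_configD[OF assms]
  show ?thesis
  proof (rule cut_configI, unfold swap23_mem)
    show "swap23 ` P \<subseteq> edge_points" using D(1) by (auto simp: swap23_def edge_points_def)
    show "\<not> coface {p, q, r}" if "p \<in> swap23 ` P" "q \<in> swap23 ` P" "r \<in> swap23 ` P" "p \<noteq> q" "p \<noteq> r" "q \<noteq> r" for p q r
      by (rule triple_coface_image[OF assms coface_symmetries(2)]) (fact that)+
    show "supported (swap23 ` P) (\<lambda>i j k. s i k j) p" if "p \<in> swap23 ` P" for p
      using that D(9) supported_swap23 by blast
  qed (erule D; assumption)+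
qed

lemma cut_config_flip1:
  assumes "cut_config P s" shows "cut_config (flip1 ` P) (\<lambda>i j k. s (\<not> i) j k)"
proof -
  note D = cut_configD[OF assms]
  show ?thesis
  proof (rule cut_configI, unfold flip1_mem)
    show "flip1 ` P \<subseteq> edge_points" using D(1) by (auto simp: flip1_def edge_points_def bin_flip)
    show "x = x'" if "(1 - x, y, z) \<in> P" "(1 - x', y, z) \<in> P" "bin y" "bin z" for x x' y z
      using D(2)[OF that] by simp
    show "y = y'" if "(1 - x, y, z) \<in> P" "(1 - x, y', z) \<in> P" "bin x" "bin z" for x y y' z
      by (rule D(3)[OF that(1,2)]) (use that in \<open>simp_all add: bin_flip\<close>)
    show "z = z'" if "(1 - x, y, z) \<in> P" "(1 - x, y, z') \<in> P" "bin x" "bin y" for x y z z'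
      by (rule D(4)[OF that(1,2)]) (use that in \<open>simp_all add: bin_flip\<close>)
    show "\<exists>x. (1 - x, of_bool j, of_bool k) \<in> P" if ne: "s (\<not> False) j k \<noteq> s (\<not> True) j k" for j k
    proof -
      obtain x where "(x, of_bool j, of_bool k) \<in> P" using D(5)[of j k] ne by auto
      then show ?thesis by (intro exI[of _ "1 - x"]) simp
    qed
    show "\<exists>y. (1 - of_bool i, y, of_bool k) \<in> P" if "s (\<not> i) False k \<noteq> s (\<not> i) True k" for i k
      using D(6)[OF that] by (simp only: of_bool_not_iff)
    show "\<exists>z. (1 - of_bool i, of_bool j, z) \<in> P" if "s (\<not> i) j False \<noteq> s (\<not> i) j True" for i j
      using D(7)[OF that] by (simp only: of_bool_not_iff)
    show "\<not> coface {p, q, r}" if "p \<in> flip1 ` P" "q \<in> flip1 ` P" "r \<in> flip1 ` P" "p \<noteq> q" "p \<noteq> r" "q \<noteq> r" for p q r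
      by (rule triple_coface_image[OF assms coface_symmetries(3)]) (fact that)+
    show "supported (flip1 ` P) (\<lambda>i j k. s (\<not> i) j k) p" if "p \<in> flip1 ` P" for p
      using that D(9) supported_flip1 by blast
  qed
qed

lemma admissible_image:
  assumes inj: "inj g" and coface: "\<And>S. coface (g ` S) \<longleftrightarrow> coface S"
    and edges: "g ` edges1 \<in> {edges1, edges2, edges3}" "g ` edges2 \<in> {edges1, edges2, edges3}"
      "g ` edges3 \<in> {edges1, edges2, edges3}"
    and a: "admissible_triple P K"
  shows "admissible_triple (g ` P) (g ` K)"
proof -
  have inj': "inj_on g S" for S using inj by (rule inj_on_subset) simp
  have card: "card (g ` S) = card S" for S by (rule card_image[OF inj'])
  from a consider "card P \<le> 4" | E where "E \<in> {edges1, edges2, edges3}" "P \<subseteq> E \<or> K = P \<inter> E"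
    | "\<forall>p\<in>K. \<forall>q\<in>K. p \<noteq> q \<longrightarrow> \<not> coface {p, q}"
    unfolding admissible_triple_def by blast
  then have "card (g ` P) \<le> 4 \<or> (\<exists>E\<in>{edges1, edges2, edges3}. g ` P \<subseteq> E \<or> g ` K = g ` P \<inter> E) \<or>
     (\<forall>p\<in>g ` K. \<forall>q\<in>g ` K. p \<noteq> q \<longrightarrow> \<not> coface {p, q})"
  proof cases
    case 2
    then have "g ` P \<subseteq> g ` E \<or> g ` K = g ` P \<inter> g ` E" by (metis image_Int[OF inj] image_mono)
    moreover have "g ` E \<in> {edges1, edges2, edges3}" using 2(1) edges by (elim insertE emptyE) simp_all
    ultimately show ?thesis by blast
  next
    case 3
    have "\<not> coface {g p, g q}" if "p \<in> K" "q \<in> K" "g p \<noteq> g q" for p q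
      using 3 that coface[of "{p, q}"] by auto
    then show ?thesis by blast
  qed (simp add: card)
  moreover have "g ` K \<subseteq> g ` P" "card (g ` K) = 3" using a card unfolding admissible_triple_def by auto
  ultimately show ?thesis unfolding admissible_triple_def by simp
qed

lemma edges_symmetries:
  "swap12 ` edges1 = edges2" "swap12 ` edges2 = edges1" "swap12 ` edges3 = edges3"
  "swap23 ` edges1 = edges1" "swap23 ` edges2 = edges3" "swap23 ` edges3 = edges2"
  "flip1 ` edges1 = edges1" "flip1 ` edges2 = edges2" "flip1 ` edges3 = edges3"
  unfolding set_eq_iff split_paired_All swap12_mem swap23_mem flip1_mem
  by (auto simp: edges1_def edges2_def edges3_def bin_flip)

lemma admissible_swap12: "admissible_triple P K \<Longrightarrow> admissible_triple (swap12 ` P) (swap12 ` K)"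
  by (rule admissible_image[OF inj_symmetries(1) coface_symmetries(1)]) (simp_all add: edges_symmetries)

lemma admissible_swap23: "admissible_triple P K \<Longrightarrow> admissible_triple (swap23 ` P) (swap23 ` K)"
  by (rule admissible_image[OF inj_symmetries(2) coface_symmetries(2)]) (simp_all add: edges_symmetries)

lemma admissible_flip1: "admissible_triple P K \<Longrightarrow> admissible_triple (flip1 ` P) (flip1 ` K)"
  by (rule admissible_image[OF inj_symmetries(3) coface_symmetries(3)]) (simp_all add: edges_symmetries)

section \<open>Stability of a sign pattern and its invariance\<close>

text \<open>The energies are evaluated at the centroid of the triangle, for every plane through its
  three vertices; both orientations of the unit normal are covered.\<close>

definition centroid_bicoercive :: "(bool \<Rightarrow> bool \<Rightarrow> bool \<Rightarrow> bool) \<Rightarrow> triple set \<Rightarrow> bool" where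
  "centroid_bicoercive s K \<longleftrightarrow> (\<forall>n1 n2 n3 d. n1\<^sup>2 + n2\<^sup>2 + n3\<^sup>2 = 1 \<longrightarrow>
     (\<forall>(x, y, z)\<in>K. n1 * x + n2 * y + n3 * z = d) \<longrightarrow>
     bicoercive s ((\<Sum>(x, y, z)\<in>K. x) / 3) ((\<Sum>(x, y, z)\<in>K. y) / 3) ((\<Sum>(x, y, z)\<in>K. z) / 3) n1 n2 n3 d)"

lemma sum_symmetries:
  fixes f :: "real \<Rightarrow> real \<Rightarrow> real \<Rightarrow> real"
  shows "(\<Sum>(x, y, z)\<in>swap12 ` K. f x y z) = (\<Sum>(x, y, z)\<in>K. f y x z)"
    and "(\<Sum>(x, y, z)\<in>swap23 ` K. f x y z) = (\<Sum>(x, y, z)\<in>K. f x z y)"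
    and "(\<Sum>(x, y, z)\<in>flip1 ` K. f x y z) = (\<Sum>(x, y, z)\<in>K. f (1 - x) y z)"
proof -
  have inj: "inj_on swap12 K" "inj_on swap23 K" "inj_on flip1 K"
    using inj_symmetries by (auto intro: inj_on_subset)
  show "(\<Sum>(x, y, z)\<in>swap12 ` K. f x y z) = (\<Sum>(x, y, z)\<in>K. f y x z)"
    by (subst sum.reindex[OF inj(1)]) (auto simp: swap12_def intro!: sum.cong)
  show "(\<Sum>(x, y, z)\<in>swap23 ` K. f x y z) = (\<Sum>(x, y, z)\<in>K. f x z y)"
    by (subst sum.reindex[OF inj(2)]) (auto simp: swap23_def intro!: sum.cong)
  show "(\<Sum>(x, y, z)\<in>flip1 ` K. f x y z) = (\<Sum>(x, y, z)\<in>K. f (1 - x) y z)"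
    by (subst sum.reindex[OF inj(3)]) (auto simp: flip1_def intro!: sum.cong)
qed

lemma centroid_bicoercive_compl:
  "centroid_bicoercive (\<lambda>i j k. \<not> s i j k) K \<longleftrightarrow> centroid_bicoercive s K"
  unfolding centroid_bicoercive_def bicoercive_compl ..

lemma centroid_bicoercive_swap12:
  assumes "centroid_bicoercive (\<lambda>i j k. s j i k) (swap12 ` K)"
  shows "centroid_bicoercive s K"
  unfolding centroid_bicoercive_def
proof (intro allI impI)
  fix n1 n2 n3 d
  assume a: "n1\<^sup>2 + n2\<^sup>2 + n3\<^sup>2 = 1" "\<forall>(x, y, z)\<in>K. n1 * x + n2 * y + n3 * z = d"
  have "n2\<^sup>2 + n1\<^sup>2 + n3\<^sup>2 = 1" using a(1) by simp
  moreover have "\<forall>(x, y, z)\<in>swap12 ` K. n2 * x + n1 * y + n3 * z = d"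
    using a(2) unfolding swap12_def by (auto simp: add_ac)
  ultimately have "bicoercive (\<lambda>i j k. s j i k) ((\<Sum>(x, y, z)\<in>swap12 ` K. x) / 3) ((\<Sum>(x, y, z)\<in>swap12 ` K. y) / 3)
     ((\<Sum>(x, y, z)\<in>swap12 ` K. z) / 3) n2 n1 n3 d"
    using assms unfolding centroid_bicoercive_def by blast
  then show "bicoercive s ((\<Sum>(x, y, z)\<in>K. x) / 3) ((\<Sum>(x, y, z)\<in>K. y) / 3) ((\<Sum>(x, y, z)\<in>K. z) / 3) n1 n2 n3 d"
    unfolding sum_symmetries by (rule bicoercive_swap12[THEN iffD1])
qed

lemma centroid_bicoercive_swap23:
  assumes "centroid_bicoercive (\<lambda>i j k. s i k j) (swap23 ` K)"
  shows "centroid_bicoercive s K"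
  unfolding centroid_bicoercive_def
proof (intro allI impI)
  fix n1 n2 n3 d
  assume a: "n1\<^sup>2 + n2\<^sup>2 + n3\<^sup>2 = 1" "\<forall>(x, y, z)\<in>K. n1 * x + n2 * y + n3 * z = d"
  have "n1\<^sup>2 + n3\<^sup>2 + n2\<^sup>2 = 1" using a(1) by simp
  moreover have "\<forall>(x, y, z)\<in>swap23 ` K. n1 * x + n3 * y + n2 * z = d"
    using a(2) unfolding swap23_def by (auto simp: add_ac)
  ultimately have "bicoercive (\<lambda>i j k. s i k j) ((\<Sum>(x, y, z)\<in>swap23 ` K. x) / 3) ((\<Sum>(x, y, z)\<in>swap23 ` K. y) / 3)
     ((\<Sum>(x, y, z)\<in>swap23 ` K. z) / 3) n1 n3 n2 d"
    using assms unfolding centroid_bicoercive_def by blast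
  then show "bicoercive s ((\<Sum>(x, y, z)\<in>K. x) / 3) ((\<Sum>(x, y, z)\<in>K. y) / 3) ((\<Sum>(x, y, z)\<in>K. z) / 3) n1 n2 n3 d"
    unfolding sum_symmetries by (rule bicoercive_swap23[THEN iffD1])
qed

lemma centroid_bicoercive_flip1:
  assumes "centroid_bicoercive (\<lambda>i j k. s (\<not> i) j k) (flip1 ` K)" and K: "card K = 3"
  shows "centroid_bicoercive s K"
  unfolding centroid_bicoercive_def
proof (intro allI impI)
  fix n1 n2 n3 d
  assume a: "n1\<^sup>2 + n2\<^sup>2 + n3\<^sup>2 = 1" "\<forall>(x, y, z)\<in>K. n1 * x + n2 * y + n3 * z = d"
  have "(- n1)\<^sup>2 + n2\<^sup>2 + n3\<^sup>2 = 1" using a(1) by simp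
  moreover have "- n1 * x + n2 * y + n3 * z = d - n1" if "(x, y, z) \<in> flip1 ` K" for x y z
  proof -
    have "(1 - x, y, z) \<in> K" using that by (simp add: flip1_mem)
    with a(2) have "n1 * (1 - x) + n2 * y + n3 * z = d" by auto
    then show ?thesis by (simp add: algebra_simps)
  qed
  then have "\<forall>(x, y, z)\<in>flip1 ` K. - n1 * x + n2 * y + n3 * z = d - n1"
    unfolding Ball_def split_paired_All prod.case by blast
  ultimately have "bicoercive (\<lambda>i j k. s (\<not> i) j k) ((\<Sum>(x, y, z)\<in>flip1 ` K. x) / 3) ((\<Sum>(x, y, z)\<in>flip1 ` K. y) / 3)
     ((\<Sum>(x, y, z)\<in>flip1 ` K. z) / 3) (- n1) n2 n3 (d - n1)"
    using assms(1) unfolding centroid_bicoercive_def by blast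
  moreover have "(\<Sum>(x, y, z)\<in>K. 1 - x) / 3 = 1 - (\<Sum>(x, y, z)\<in>K. x) / 3"
    using K by (simp add: case_prod_beta sum_subtractf diff_divide_distrib)
  ultimately have "bicoercive (\<lambda>i j k. s (\<not> i) j k) (1 - (\<Sum>(x, y, z)\<in>K. x) / 3) ((\<Sum>(x, y, z)\<in>K. y) / 3)
     ((\<Sum>(x, y, z)\<in>K. z) / 3) (- n1) n2 n3 (d - n1)"
    unfolding sum_symmetries by (simp only:)
  then show "bicoercive s ((\<Sum>(x, y, z)\<in>K. x) / 3) ((\<Sum>(x, y, z)\<in>K. y) / 3) ((\<Sum>(x, y, z)\<in>K. z) / 3) n1 n2 n3 d"
    by (rule bicoercive_flip1[THEN iffD1])
qed

lemma admissible_card: "admissible_triple P K \<Longrightarrow> card K = 3"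
  by (simp add: admissible_triple_def)

text \<open>Holds vacuously for a pattern that no configuration with an admissible triangle
  realises, so impossible patterns fit into the same classification.\<close>

definition stable :: "(bool \<Rightarrow> bool \<Rightarrow> bool \<Rightarrow> bool) \<Rightarrow> bool" where
  "stable s \<longleftrightarrow> (\<forall>P K. cut_config P s \<longrightarrow> admissible_triple P K \<longrightarrow> centroid_bicoercive s K)"

lemma cut_config_compl_iff: "cut_config P (\<lambda>i j k. \<not> s i j k) \<longleftrightarrow> cut_config P s"
  using cut_config_compl[of P s] cut_config_compl[of P "\<lambda>i j k. \<not> s i j k"] by auto

text \<open>The symmetry is an involution, so one implication, applied to \<open>s\<close> and to
  its image, gives both. The same holds for the three lemmas that follow.\<close>

lemma stable_compl: "stable (\<lambda>i j k. \<not> s i j k) \<longleftrightarrow> stable s"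
proof -
  have "stable (\<lambda>i j k. \<not> s i j k)" if "stable s" for s
    using that unfolding stable_def centroid_bicoercive_compl cut_config_compl_iff .
  from this[of s] this[of "\<lambda>i j k. \<not> s i j k"] show ?thesis by auto
qed

lemma stable_swap12: "stable (\<lambda>i j k. s j i k) \<longleftrightarrow> stable s"
proof -
  have "stable s" if "stable (\<lambda>i j k. s j i k)" for s
    using that cut_config_swap12 admissible_swap12 centroid_bicoercive_swap12 unfolding stable_def by blast
  from this[of s] this[of "\<lambda>i j k. s j i k"] show ?thesis by auto
qed

lemma stable_swap23: "stable (\<lambda>i j k. s i k j) \<longleftrightarrow> stable s"
proof -
  have "stable s" if "stable (\<lambda>i j k. s i k j)" for s
    using that cut_config_swap23 admissible_swap23 centroid_bicoercive_swap23 unfolding stable_def by blast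
  from this[of s] this[of "\<lambda>i j k. s i k j"] show ?thesis by auto
qed

lemma stable_flip1: "stable (\<lambda>i j k. s (\<not> i) j k) \<longleftrightarrow> stable s"
proof -
  have "stable s" if "stable (\<lambda>i j k. s (\<not> i) j k)" for s
    using that cut_config_flip1 admissible_flip1 centroid_bicoercive_flip1 admissible_card unfolding stable_def by blast
  from this[of s] this[of "\<lambda>i j k. s (\<not> i) j k"] show ?thesis by auto
qed

section \<open>Checkerboard faces and reduction to representatives\<close>

lemma face_three:
  assumes "cut_config P s"
  shows "(c, y1, z1) \<in> P \<Longrightarrow> (c, y2, z2) \<in> P \<Longrightarrow> (c, y3, z3) \<in> P \<Longrightarrow> bin c \<Longrightarrow>
      (y1, z1) \<noteq> (y2, z2) \<Longrightarrow> (y1, z1) \<noteq> (y3, z3) \<Longrightarrow> (y2, z2) \<noteq> (y3, z3) \<Longrightarrow> False"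
    and "(x1, c, z1) \<in> P \<Longrightarrow> (x2, c, z2) \<in> P \<Longrightarrow> (x3, c, z3) \<in> P \<Longrightarrow> bin c \<Longrightarrow>
      (x1, z1) \<noteq> (x2, z2) \<Longrightarrow> (x1, z1) \<noteq> (x3, z3) \<Longrightarrow> (x2, z2) \<noteq> (x3, z3) \<Longrightarrow> False"
    and "(x1, y1, c) \<in> P \<Longrightarrow> (x2, y2, c) \<in> P \<Longrightarrow> (x3, y3, c) \<in> P \<Longrightarrow> bin c \<Longrightarrow>
      (x1, y1) \<noteq> (x2, y2) \<Longrightarrow> (x1, y1) \<noteq> (x3, y3) \<Longrightarrow> (x2, y2) \<noteq> (x3, y3) \<Longrightarrow> False"
proof -
  note D = cut_configD(8)[OF assms]
  show "(c, y1, z1) \<in> P \<Longrightarrow> (c, y2, z2) \<in> P \<Longrightarrow> (c, y3, z3) \<in> P \<Longrightarrow> bin c \<Longrightarrow>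
      (y1, z1) \<noteq> (y2, z2) \<Longrightarrow> (y1, z1) \<noteq> (y3, z3) \<Longrightarrow> (y2, z2) \<noteq> (y3, z3) \<Longrightarrow> False"
    using D[of "(c, y1, z1)" "(c, y2, z2)" "(c, y3, z3)"] by (simp add: coface_def) blast
  show "(x1, c, z1) \<in> P \<Longrightarrow> (x2, c, z2) \<in> P \<Longrightarrow> (x3, c, z3) \<in> P \<Longrightarrow> bin c \<Longrightarrow>
      (x1, z1) \<noteq> (x2, z2) \<Longrightarrow> (x1, z1) \<noteq> (x3, z3) \<Longrightarrow> (x2, z2) \<noteq> (x3, z3) \<Longrightarrow> False"
    using D[of "(x1, c, z1)" "(x2, c, z2)" "(x3, c, z3)"] by (simp add: coface_def) blast
  show "(x1, y1, c) \<in> P \<Longrightarrow> (x2, y2, c) \<in> P \<Longrightarrow> (x3, y3, c) \<in> P \<Longrightarrow> bin c \<Longrightarrow>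
      (x1, y1) \<noteq> (x2, y2) \<Longrightarrow> (x1, y1) \<noteq> (x3, y3) \<Longrightarrow> (x2, y2) \<noteq> (x3, y3) \<Longrightarrow> False"
    using D[of "(x1, y1, c)" "(x2, y2, c)" "(x3, y3, c)"] by (simp add: coface_def) blast
qed

lemma bin_simps [simp]: "bin 0" "bin 1" "bin (of_bool b)" "0 < x \<Longrightarrow> x < 1 \<Longrightarrow> \<not> bin x"
  unfolding bin_def by auto

lemma cut_crossing:
  assumes "cut_config P s"
  shows "s False j k \<noteq> s True j k \<Longrightarrow> \<exists>x. 0 < x \<and> x < 1 \<and> (x, of_bool j, of_bool k) \<in> P"
    and "s i False k \<noteq> s i True k \<Longrightarrow> \<exists>y. 0 < y \<and> y < 1 \<and> (of_bool i, y, of_bool k) \<in> P"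
    and "s i j False \<noteq> s i j True \<Longrightarrow> \<exists>z. 0 < z \<and> z < 1 \<and> (of_bool i, of_bool j, z) \<in> P"
proof -
  note D = cut_configD[OF assms]
  have "0 < x \<and> x < 1" if "(x, of_bool j, of_bool k) \<in> P" for x j k
    using that D(1) by (auto simp: edge_points_def bin_def)
  then show "s False j k \<noteq> s True j k \<Longrightarrow> \<exists>x. 0 < x \<and> x < 1 \<and> (x, of_bool j, of_bool k) \<in> P"
    using D(5)[of j k] by blast
  have "0 < y \<and> y < 1" if "(of_bool i, y, of_bool k) \<in> P" for y i k
    using that D(1) by (auto simp: edge_points_def bin_def)
  then show "s i False k \<noteq> s i True k \<Longrightarrow> \<exists>y. 0 < y \<and> y < 1 \<and> (of_bool i, y, of_bool k) \<in> P"
    using D(6)[of i k] by blast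
  have "0 < z \<and> z < 1" if "(of_bool i, of_bool j, z) \<in> P" for z i j
    using that D(1) by (auto simp: edge_points_def bin_def)
  then show "s i j False \<noteq> s i j True \<Longrightarrow> \<exists>z. 0 < z \<and> z < 1 \<and> (of_bool i, of_bool j, z) \<in> P"
    using D(7)[of i j] by blast
qed

text \<open>Three sign changes around a face force three cut points on its boundary, so no
  configuration has this pattern.\<close>

lemma stable_checkerboard3:
  assumes "s False False k \<noteq> s True False k" "s True False k \<noteq> s True True k" "s True True k \<noteq> s False True k"
  shows "stable s"
proof -
  have "\<not> cut_config P s" for P
  proof
    assume a: "cut_config P s"
    obtain x where x: "0 < x" "x < 1" "(x, of_bool False, of_bool k) \<in> P" using cut_crossing(1)[OF a assms(1)] by blast
    obtain y where y: "0 < y" "y < 1" "(of_bool True, y, of_bool k) \<in> P" using cut_crossing(2)[OF a assms(2)] by blast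
    obtain x' where x': "0 < x'" "x' < 1" "(x', of_bool True, of_bool k) \<in> P"
      using cut_crossing(1)[OF a, of True k] assms(3) by blast
    show False using face_three(3)[OF a x(3) y(3) x'(3)] x y x' by simp
  qed
  then show ?thesis unfolding stable_def by blast
qed

lemma stable_checkerboard2:
  assumes "s False j False \<noteq> s True j False" "s True j False \<noteq> s True j True" "s True j True \<noteq> s False j True"
  shows "stable s"
  using stable_checkerboard3[of "\<lambda>i j k. s i k j" j] assms stable_swap23[of s] by blast

lemma stable_checkerboard1:
  assumes "s i False False \<noteq> s i True False" "s i True False \<noteq> s i True True" "s i True True \<noteq> s i False True"
  shows "stable s"
  using stable_checkerboard2[of "\<lambda>i j k. s j i k" i] assms stable_swap12[of s] by blast

text \<open>A pattern as a tuple of eight booleans, the vertices listed with the third coordinate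
  varying fastest. On literal booleans the symmetries become rewriting of the tuple.\<close>

definition pat8 :: "bool \<Rightarrow> bool \<Rightarrow> bool \<Rightarrow> bool \<Rightarrow> bool \<Rightarrow> bool \<Rightarrow> bool \<Rightarrow> bool \<Rightarrow> bool \<Rightarrow> bool \<Rightarrow> bool \<Rightarrow> bool" where
  "pat8 a b c d e f g h i j k =
     (if i then (if j then (if k then h else g) else (if k then f else e))
      else (if j then (if k then d else c) else (if k then b else a)))"

abbreviation stable8 :: "bool \<Rightarrow> bool \<Rightarrow> bool \<Rightarrow> bool \<Rightarrow> bool \<Rightarrow> bool \<Rightarrow> bool \<Rightarrow> bool \<Rightarrow> bool" where
  "stable8 a b c d e f g h \<equiv> stable (pat8 a b c d e f g h)"

lemma pat8_eq: "s = pat8 (s False False False) (s False False True) (s False True False) (s False True True)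
    (s True False False) (s True False True) (s True True False) (s True True True)"
  by (intro ext) (auto simp: pat8_def)

lemma stable8_swap12: "stable8 a b c d e f g h \<longleftrightarrow> stable8 a b e f c d g h"
proof -
  have "(\<lambda>i j k. pat8 a b e f c d g h j i k) = pat8 a b c d e f g h"
    by (intro ext) (simp add: pat8_def)
  with stable_swap12[of "pat8 a b e f c d g h"] show ?thesis by simp
qed

lemma stable8_swap23: "stable8 a b c d e f g h \<longleftrightarrow> stable8 a c b d e g f h"
proof -
  have "(\<lambda>i j k. pat8 a c b d e g f h i k j) = pat8 a b c d e f g h"
    by (intro ext) (simp add: pat8_def)
  with stable_swap23[of "pat8 a c b d e g f h"] show ?thesis by simp
qed

lemma stable8_flip1: "stable8 a b c d e f g h \<longleftrightarrow> stable8 e f g h a b c d"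
proof -
  have "(\<lambda>i j k. pat8 e f g h a b c d (\<not> i) j k) = pat8 a b c d e f g h"
    by (intro ext) (simp add: pat8_def)
  with stable_flip1[of "pat8 e f g h a b c d"] show ?thesis by simp
qed

lemma stable8_compl: "stable8 a b c d e f g h \<longleftrightarrow> stable8 (\<not> a) (\<not> b) (\<not> c) (\<not> d) (\<not> e) (\<not> f) (\<not> g) (\<not> h)"
proof -
  have "(\<lambda>i j k. \<not> pat8 (\<not> a) (\<not> b) (\<not> c) (\<not> d) (\<not> e) (\<not> f) (\<not> g) (\<not> h) i j k) = pat8 a b c d e f g h"
    by (intro ext) (simp add: pat8_def)
  with stable_compl[of "pat8 (\<not> a) (\<not> b) (\<not> c) (\<not> d) (\<not> e) (\<not> f) (\<not> g) (\<not> h)"] show ?thesis by simp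
qed

lemma stable8_swap13: "stable8 a b c d e f g h \<longleftrightarrow> stable8 a e c g b f d h"
  by (subst stable8_swap12, subst stable8_swap23, subst stable8_swap12) (rule refl)

lemma stable8_flip2: "stable8 a b c d e f g h \<longleftrightarrow> stable8 c d a b g h e f"
  by (subst stable8_swap12, subst stable8_flip1, subst stable8_swap12) (rule refl)

lemma stable8_flip3: "stable8 a b c d e f g h \<longleftrightarrow> stable8 b a d c f e h g"
  by (subst stable8_swap13, subst stable8_flip1, subst stable8_swap13) (rule refl)

lemmas stable8_symmetries = stable8_swap12 stable8_swap23 stable8_swap13 stable8_flip1 stable8_flip2 stable8_flip3

text \<open>All 256 patterns are enumerated. The symmetries are permutative equations, so the
  simplifier uses them as ordered rewrite rules and brings a pattern and the representative of its
  class to the same form; a checkerboard face contradicts \<open>checkers\<close>.\<close>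

lemma stable8_if_representatives:
  assumes checkers: "a \<noteq> e \<Longrightarrow> e \<noteq> g \<Longrightarrow> g \<noteq> c \<Longrightarrow> False" "b \<noteq> f \<Longrightarrow> f \<noteq> h \<Longrightarrow> h \<noteq> d \<Longrightarrow> False"
      "a \<noteq> e \<Longrightarrow> e \<noteq> f \<Longrightarrow> f \<noteq> b \<Longrightarrow> False" "c \<noteq> g \<Longrightarrow> g \<noteq> h \<Longrightarrow> h \<noteq> d \<Longrightarrow> False"
      "a \<noteq> c \<Longrightarrow> c \<noteq> d \<Longrightarrow> d \<noteq> b \<Longrightarrow> False" "e \<noteq> g \<Longrightarrow> g \<noteq> h \<Longrightarrow> h \<noteq> f \<Longrightarrow> False"
    and const: "stable8 False False False False False False False False"
    and corner: "stable8 True False False False False False False False"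
    and edge: "stable8 True True False False False False False False"
    and ell: "stable8 True False True False True False False False"
    and face: "stable8 True False True False True False True False"
    and tripod: "stable8 True True True False True False False False"
    and path: "stable8 True False False False True False True True"
    and antipodal: "stable8 True False False False False False False True"
  shows "stable8 a b c d e f g h"
proof -
  note reps = const corner edge ell face tripod path antipodal
  \<comment> \<open>Fixing the first argument to a literal keeps the complement rule from rewriting
    its own result, whose first argument is a negation.\<close>
  note reps' = reps[unfolded stable8_compl[of False] stable8_compl[of True], simplified]
  note normal = reps[simplified stable8_symmetries] reps'[simplified stable8_symmetries]
  show ?thesis
    using checkers
    by (cases a; cases b; cases c; cases d; cases e; cases f; cases g; cases h; simp add: stable8_symmetries normal)
qed

section \<open>Touching points, and the cut points of each pattern\<close>

definition antipodal_pat :: "bool \<Rightarrow> bool \<Rightarrow> bool \<Rightarrow> bool" where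
  "antipodal_pat i j k \<longleftrightarrow> (i \<longleftrightarrow> j) \<and> (j \<longleftrightarrow> k)"

text \<open>The surface point \<open>(1, 1, t)\<close> lies on an edge with both ends on one side.
  The two ends bound the size of \<open>n3\<close> by \<open>1 / 10\<close>, the other two vertices
  bound \<open>n1\<close> and \<open>n2\<close> below by \<open>- 3 / 10\<close>, and the two cut
  points bound them above by \<open>7 / 10\<close>. The squared length of the normal is then at most
  \<open>99 / 100\<close>. The margin is narrow: this is the estimate that asks for tangent balls of
  radius \<open>5 * h\<close>.\<close>

lemma no_touching_aux:
  assumes unit: "n1\<^sup>2 + n2\<^sup>2 + n3\<^sup>2 = 1"
    and t: "0 < t" "t < 1" and a: "0 < a" "a < 1" and b: "0 < b" "b < 1"
    and v: "near n1 n2 n3 0 0 (- t)" "near n1 n2 n3 0 0 (1 - t)" "near n1 n2 n3 (- 1) 0 (- t)" "near n1 n2 n3 0 (- 1) (- t)"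
    and p: "near (- n1) (- n2) (- n3) (a - 1) (- 1) (- t)" "near (- n1) (- n2) (- n3) (- 1) (b - 1) (- t)"
  shows False
proof -
  have sq: "t\<^sup>2 \<le> 1" "(a - 1)\<^sup>2 \<le> 1" "(b - 1)\<^sup>2 \<le> 1" using t a b by (simp_all add: abs_square_le_1)
  have "t * (- n3) \<le> t * (t / 10)" using v(1) unfolding near_def by (simp add: power2_eq_square mult_ac)
  then have "- n3 \<le> t / 10" using t by (simp only: mult_le_cancel_left_pos)
  moreover have "(1 - t) * n3 \<le> (1 - t) * ((1 - t) / 10)" using v(2) unfolding near_def by (simp add: power2_eq_square mult_ac)
  then have "n3 \<le> (1 - t) / 10" using t by (simp only: mult_le_cancel_left_pos)
  ultimately have n3: "\<bar>n3\<bar> \<le> 1 / 10" using t by (simp add: abs_le_iff)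
  have "\<bar>n3 * t\<bar> \<le> 1 / 10 * 1" unfolding abs_mult using n3 t by (intro mult_mono) auto
  then have n3t: "n3 * t \<le> 1 / 10" "- (1 / 10) \<le> n3 * t" by auto
  have lo: "- (3 / 10) \<le> n1" "- (3 / 10) \<le> n2" using v(3,4) sq n3t unfolding near_def by simp_all
  have "(1 - a) * n1 + n2 + n3 * t \<le> 3 / 10" "n1 + (1 - b) * n2 + n3 * t \<le> 3 / 10"
    using p sq unfolding near_def by (simp_all add: algebra_simps)
  moreover have "- (3 / 10) \<le> (1 - a) * n1"
    using mult_left_mono[OF lo(1), of "1 - a"] a by (simp add: diff_divide_distrib)
  moreover have "- (3 / 10) \<le> (1 - b) * n2"
    using mult_left_mono[OF lo(2), of "1 - b"] b by (simp add: diff_divide_distrib)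
  ultimately have "n1 \<le> 7 / 10" "n2 \<le> 7 / 10" using n3t by linarith+
  with lo have "\<bar>n1\<bar> \<le> \<bar>7 / 10\<bar>" "\<bar>n2\<bar> \<le> \<bar>7 / 10\<bar>" by auto
  then have "n1\<^sup>2 \<le> (7 / 10)\<^sup>2" "n2\<^sup>2 \<le> (7 / 10)\<^sup>2" unfolding abs_le_square_iff .
  moreover have "n3\<^sup>2 \<le> (1 / 10)\<^sup>2" using n3 by (subst abs_le_square_iff[symmetric]) simp
  ultimately show False using unit by (simp add: power2_eq_square)
qed

text \<open>The common side of the four vertices may be either one; in the second case the reversed
  normal is used.\<close>

lemma no_touching:
  assumes cfg: "cut_config P s" and X: "(1, 1, t) \<in> P" "0 < t" "t < 1"
    and A: "(a, 0, 0) \<in> P" and B: "(0, b, 0) \<in> P" and ab: "0 < a" "a < 1" "0 < b" "b < 1"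
    and s: "s True True True = s True True False" "s True False False = s True True False" "s False True False = s True True False"
  shows False
proof -
  from cut_configD(9)[OF cfg X(1)] show False
  proof (rule supportedE)
    fix n1 n2 n3
    assume n: "n1\<^sup>2 + n2\<^sup>2 + n3\<^sup>2 = 1"
      "\<And>i j k. s i j k \<Longrightarrow> near (- n1) (- n2) (- n3) (of_bool i - 1) (of_bool j - 1) (of_bool k - t)"
      "\<And>i j k. \<not> s i j k \<Longrightarrow> near n1 n2 n3 (of_bool i - 1) (of_bool j - 1) (of_bool k - t)"
      "\<And>x' y' z'. (x', y', z') \<in> P \<Longrightarrow> near n1 n2 n3 (x' - 1) (y' - 1) (z' - t)"
      "\<And>x' y' z'. (x', y', z') \<in> P \<Longrightarrow> near (- n1) (- n2) (- n3) (x' - 1) (y' - 1) (z' - t)"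
    show False
    proof (cases "s True True False")
      case False
      then have f: "\<not> s True True False" "\<not> s True True True" "\<not> s False True False" "\<not> s True False False"
        using s by simp_all
      show ?thesis
        by (rule no_touching_aux[OF n(1) X(2,3) ab])
          (use n(3)[OF f(1)] n(3)[OF f(2)] n(3)[OF f(3)] n(3)[OF f(4)] n(5)[OF A] n(5)[OF B] in simp_all)
    next
      case True
      then have f: "s True True False" "s True True True" "s False True False" "s True False False"
        using s by simp_all
      have "(- n1)\<^sup>2 + (- n2)\<^sup>2 + (- n3)\<^sup>2 = 1" using n(1) by simp
      then show ?thesis
        by (rule no_touching_aux[OF _ X(2,3) ab])
          (use n(2)[OF f(1)] n(2)[OF f(2)] n(2)[OF f(3)] n(2)[OF f(4)] n(4)[OF A] n(4)[OF B] in simp_all)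
    qed
  qed
qed

text \<open>The twelve edges of the cube, in the order of the facts \<open>e0\<close> to
  \<open>e11\<close> in the lemmas that follow.\<close>

lemma edge_points_subset:
  assumes "P \<subseteq> edge_points"
    and "\<And>t. 0 < t \<Longrightarrow> t < 1 \<Longrightarrow> (t, 0, 0) \<in> P \<Longrightarrow> (t, 0, 0) \<in> Q"
    and "\<And>t. 0 < t \<Longrightarrow> t < 1 \<Longrightarrow> (t, 0, 1) \<in> P \<Longrightarrow> (t, 0, 1) \<in> Q"
    and "\<And>t. 0 < t \<Longrightarrow> t < 1 \<Longrightarrow> (t, 1, 0) \<in> P \<Longrightarrow> (t, 1, 0) \<in> Q"
    and "\<And>t. 0 < t \<Longrightarrow> t < 1 \<Longrightarrow> (t, 1, 1) \<in> P \<Longrightarrow> (t, 1, 1) \<in> Q"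
    and "\<And>t. 0 < t \<Longrightarrow> t < 1 \<Longrightarrow> (0, t, 0) \<in> P \<Longrightarrow> (0, t, 0) \<in> Q"
    and "\<And>t. 0 < t \<Longrightarrow> t < 1 \<Longrightarrow> (0, t, 1) \<in> P \<Longrightarrow> (0, t, 1) \<in> Q"
    and "\<And>t. 0 < t \<Longrightarrow> t < 1 \<Longrightarrow> (1, t, 0) \<in> P \<Longrightarrow> (1, t, 0) \<in> Q"
    and "\<And>t. 0 < t \<Longrightarrow> t < 1 \<Longrightarrow> (1, t, 1) \<in> P \<Longrightarrow> (1, t, 1) \<in> Q"
    and "\<And>t. 0 < t \<Longrightarrow> t < 1 \<Longrightarrow> (0, 0, t) \<in> P \<Longrightarrow> (0, 0, t) \<in> Q"
    and "\<And>t. 0 < t \<Longrightarrow> t < 1 \<Longrightarrow> (0, 1, t) \<in> P \<Longrightarrow> (0, 1, t) \<in> Q"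
    and "\<And>t. 0 < t \<Longrightarrow> t < 1 \<Longrightarrow> (1, 0, t) \<in> P \<Longrightarrow> (1, 0, t) \<in> Q"
    and "\<And>t. 0 < t \<Longrightarrow> t < 1 \<Longrightarrow> (1, 1, t) \<in> P \<Longrightarrow> (1, 1, t) \<in> Q"
  shows "P \<subseteq> Q"
proof
  fix w assume w: "w \<in> P"
  obtain x y z where xyz: "w = (x, y, z)" by (cases w)
  with w assms(1) have "(x, y, z) \<in> edge_points" by blast
  then have "(0 < x \<and> x < 1 \<and> bin y \<and> bin z) \<or> (bin x \<and> 0 < y \<and> y < 1 \<and> bin z) \<or> (bin x \<and> bin y \<and> 0 < z \<and> z < 1)"
    unfolding edge_points_def by simp
  then show "w \<in> Q"
    unfolding bin_def using w unfolding xyz by (elim disjE conjE) (simp_all only: assms(2-))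
qed

text \<open>An edge carries no further cut point if it lies in a face that has two already. Only the
  edge \<open>(1, 1, z)\<close>, opposite the minus edge, lies in no such face, and there the
  tangent balls decide.\<close>

lemma cut_points_edge:
  assumes cfg: "cut_config P edge_pat"
  obtains a b c e where "0 < a" "a < 1" "0 < b" "b < 1" "0 < c" "c < 1" "0 < e" "e < 1"
    "P = {(a, 0, 0), (0, b, 0), (c, 0, 1), (0, e, 1)}"
proof -
  obtain a where a: "0 < a" "a < 1" "(a, 0, 0) \<in> P"
    using cut_crossing(1)[OF cfg, of False False] by (auto simp: edge_pat_def)
  obtain b where b: "0 < b" "b < 1" "(0, b, 0) \<in> P"
    using cut_crossing(2)[OF cfg, of False False] by (auto simp: edge_pat_def)
  obtain c where c: "0 < c" "c < 1" "(c, 0, 1) \<in> P"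
    using cut_crossing(1)[OF cfg, of False True] by (auto simp: edge_pat_def)
  obtain e where e: "0 < e" "e < 1" "(0, e, 1) \<in> P"
    using cut_crossing(2)[OF cfg, of False True] by (auto simp: edge_pat_def)
  note pos = a(1,2) b(1,2) c(1,2) e(1,2)
  have e0: "(x, 0, 0) \<in> P \<Longrightarrow> x = a" for x using cut_configD(2)[OF cfg a(3)] by simp
  have e1: "(x, 0, 1) \<in> P \<Longrightarrow> x = c" for x using cut_configD(2)[OF cfg c(3)] by simp
  have e2: "(x, 1, 0) \<in> P \<Longrightarrow> False" for x using face_three(3)[OF cfg a(3) b(3)] pos by force
  have e3: "(x, 1, 1) \<in> P \<Longrightarrow> False" for x using face_three(3)[OF cfg c(3) e(3)] pos by force
  have e4: "(0, y, 0) \<in> P \<Longrightarrow> y = b" for y using cut_configD(3)[OF cfg b(3)] by simp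
  have e5: "(0, y, 1) \<in> P \<Longrightarrow> y = e" for y using cut_configD(3)[OF cfg e(3)] by simp
  have e6: "(1, y, 0) \<in> P \<Longrightarrow> False" for y using face_three(3)[OF cfg a(3) b(3)] pos by force
  have e7: "(1, y, 1) \<in> P \<Longrightarrow> False" for y using face_three(3)[OF cfg c(3) e(3)] pos by force
  have e8: "(0, 0, z) \<in> P \<Longrightarrow> False" for z using face_three(1)[OF cfg b(3) e(3)] pos by force
  have e9: "(0, 1, z) \<in> P \<Longrightarrow> False" for z using face_three(1)[OF cfg b(3) e(3)] pos by force
  have e10: "(1, 0, z) \<in> P \<Longrightarrow> False" for z using face_three(2)[OF cfg a(3) c(3)] pos by force
  have e11: "(1, 1, z) \<in> P \<Longrightarrow> \<not> (0 < z \<and> z < 1)" for z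
    using no_touching[OF cfg _ _ _ a(3) b(3)] pos by (auto simp: edge_pat_def)
  have "P \<subseteq> {(a, 0, 0), (0, b, 0), (c, 0, 1), (0, e, 1)}"
    by (rule edge_points_subset[OF cut_configD(1)[OF cfg]]; (frule e0 | frule e1 | frule e2 | frule e3 | frule e4 | frule e5 | frule e6 | frule e7 | frule e8 | frule e9 | frule e10 | frule e11); simp)
  then have "P = {(a, 0, 0), (0, b, 0), (c, 0, 1), (0, e, 1)}" using a(3) b(3) c(3) e(3) by blast
  then show thesis by (rule that[OF pos])
qed

text \<open>The three edges at the vertex opposite the minus one lie in no face with two cut points.
  They are excluded by \<open>no_touching\<close>, for two of them after a permutation of the
  axes.\<close>

lemma cut_points_corner:
  assumes cfg: "cut_config P corner_pat"
  obtains a b c where "0 < a" "a < 1" "0 < b" "b < 1" "0 < c" "c < 1"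
    "P = {(a, 0, 0), (0, b, 0), (0, 0, c)}"
proof -
  obtain a where a: "0 < a" "a < 1" "(a, 0, 0) \<in> P"
    using cut_crossing(1)[OF cfg, of False False] by (auto simp: corner_pat_def)
  obtain b where b: "0 < b" "b < 1" "(0, b, 0) \<in> P"
    using cut_crossing(2)[OF cfg, of False False] by (auto simp: corner_pat_def)
  obtain c where c: "0 < c" "c < 1" "(0, 0, c) \<in> P"
    using cut_crossing(3)[OF cfg, of False False] by (auto simp: corner_pat_def)
  note pos = a(1,2) b(1,2) c(1,2)
  have e0: "(x, 0, 0) \<in> P \<Longrightarrow> x = a" for x using cut_configD(2)[OF cfg a(3)] by simp
  have e1: "(x, 0, 1) \<in> P \<Longrightarrow> False" for x using face_three(2)[OF cfg a(3) c(3)] pos by force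
  have e2: "(x, 1, 0) \<in> P \<Longrightarrow> False" for x using face_three(3)[OF cfg a(3) b(3)] pos by force
  have e3: "(x, 1, 1) \<in> P \<Longrightarrow> \<not> (0 < x \<and> x < 1)" for x
    using no_touching[OF cut_config_swap23[OF cut_config_swap12[OF cfg]], of x b c] pos b(3) c(3)
    by (auto simp: corner_pat_def swap12_mem swap23_mem)
  have e4: "(0, y, 0) \<in> P \<Longrightarrow> y = b" for y using cut_configD(3)[OF cfg b(3)] by simp
  have e5: "(0, y, 1) \<in> P \<Longrightarrow> False" for y using face_three(1)[OF cfg b(3) c(3)] pos by force
  have e6: "(1, y, 0) \<in> P \<Longrightarrow> False" for y using face_three(3)[OF cfg a(3) b(3)] pos by force
  have e7: "(1, y, 1) \<in> P \<Longrightarrow> \<not> (0 < y \<and> y < 1)" for y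
    using no_touching[OF cut_config_swap23[OF cfg], of y a c] pos a(3) c(3) by (auto simp: corner_pat_def swap23_mem)
  have e8: "(0, 0, z) \<in> P \<Longrightarrow> z = c" for z using cut_configD(4)[OF cfg c(3)] by simp
  have e9: "(0, 1, z) \<in> P \<Longrightarrow> False" for z using face_three(1)[OF cfg b(3) c(3)] pos by force
  have e10: "(1, 0, z) \<in> P \<Longrightarrow> False" for z using face_three(2)[OF cfg a(3) c(3)] pos by force
  have e11: "(1, 1, z) \<in> P \<Longrightarrow> \<not> (0 < z \<and> z < 1)" for z
    using no_touching[OF cfg _ _ _ a(3) b(3)] pos by (auto simp: corner_pat_def)
  have "P \<subseteq> {(a, 0, 0), (0, b, 0), (0, 0, c)}"
    by (rule edge_points_subset[OF cut_configD(1)[OF cfg]]; (frule e0 | frule e1 | frule e2 | frule e3 | frule e4 | frule e5 | frule e6 | frule e7 | frule e8 | frule e9 | frule e10 | frule e11); simp)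
  then have "P = {(a, 0, 0), (0, b, 0), (0, 0, c)}" using a(3) b(3) c(3) by blast
  then show thesis by (rule that[OF pos])
qed

text \<open>Here and in the patterns that follow, every edge lies in a face with two cut points, so
  counting on faces determines all cut points.\<close>

lemma cut_points_ell:
  assumes cfg: "cut_config P ell_pat"
  obtains p q f e r where "0 < p" "p < 1" "0 < q" "q < 1" "0 < f" "f < 1" "0 < e" "e < 1" "0 < r" "r < 1"
    "P = {(0, 0, p), (1, 0, q), (1, f, 0), (e, 1, 0), (0, 1, r)}"
proof -
  obtain p where p: "0 < p" "p < 1" "(0, 0, p) \<in> P"
    using cut_crossing(3)[OF cfg, of False False] by (auto simp: ell_pat_def)
  obtain q where q: "0 < q" "q < 1" "(1, 0, q) \<in> P"
    using cut_crossing(3)[OF cfg, of True False] by (auto simp: ell_pat_def)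
  obtain f where f: "0 < f" "f < 1" "(1, f, 0) \<in> P"
    using cut_crossing(2)[OF cfg, of True False] by (auto simp: ell_pat_def)
  obtain e where e: "0 < e" "e < 1" "(e, 1, 0) \<in> P"
    using cut_crossing(1)[OF cfg, of True False] by (auto simp: ell_pat_def)
  obtain r where r: "0 < r" "r < 1" "(0, 1, r) \<in> P"
    using cut_crossing(3)[OF cfg, of False True] by (auto simp: ell_pat_def)
  note pos = p(1,2) q(1,2) f(1,2) e(1,2) r(1,2)
  have e0: "(x, 0, 0) \<in> P \<Longrightarrow> False" for x using face_three(2)[OF cfg p(3) q(3)] pos by force
  have e1: "(x, 0, 1) \<in> P \<Longrightarrow> False" for x using face_three(2)[OF cfg p(3) q(3)] pos by force
  have e2: "(x, 1, 0) \<in> P \<Longrightarrow> x = e" for x using cut_configD(2)[OF cfg e(3)] by simp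
  have e3: "(x, 1, 1) \<in> P \<Longrightarrow> False" for x using face_three(2)[OF cfg e(3) r(3)] pos by force
  have e4: "(0, y, 0) \<in> P \<Longrightarrow> False" for y using face_three(1)[OF cfg p(3) r(3)] pos by force
  have e5: "(0, y, 1) \<in> P \<Longrightarrow> False" for y using face_three(1)[OF cfg p(3) r(3)] pos by force
  have e6: "(1, y, 0) \<in> P \<Longrightarrow> y = f" for y using cut_configD(3)[OF cfg f(3)] by simp
  have e7: "(1, y, 1) \<in> P \<Longrightarrow> False" for y using face_three(1)[OF cfg q(3) f(3)] pos by force
  have e8: "(0, 0, z) \<in> P \<Longrightarrow> z = p" for z using cut_configD(4)[OF cfg p(3)] by simp
  have e9: "(0, 1, z) \<in> P \<Longrightarrow> z = r" for z using cut_configD(4)[OF cfg r(3)] by simp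
  have e10: "(1, 0, z) \<in> P \<Longrightarrow> z = q" for z using cut_configD(4)[OF cfg q(3)] by simp
  have e11: "(1, 1, z) \<in> P \<Longrightarrow> False" for z using face_three(1)[OF cfg q(3) f(3)] pos by force
  have "P \<subseteq> {(0, 0, p), (1, 0, q), (1, f, 0), (e, 1, 0), (0, 1, r)}"
    by (rule edge_points_subset[OF cut_configD(1)[OF cfg]]; (frule e0 | frule e1 | frule e2 | frule e3 | frule e4 | frule e5 | frule e6 | frule e7 | frule e8 | frule e9 | frule e10 | frule e11); simp)
  then have "P = {(0, 0, p), (1, 0, q), (1, f, 0), (e, 1, 0), (0, 1, r)}" using p(3) q(3) f(3) e(3) r(3) by blast
  then show thesis by (rule that[OF pos])
qed

lemma cut_points_face:
  assumes cfg: "cut_config P face_pat"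
  obtains p q r t where "0 < p" "p < 1" "0 < q" "q < 1" "0 < r" "r < 1" "0 < t" "t < 1"
    "P = {(0, 0, p), (1, 0, q), (0, 1, r), (1, 1, t)}"
proof -
  obtain p where p: "0 < p" "p < 1" "(0, 0, p) \<in> P"
    using cut_crossing(3)[OF cfg, of False False] by (auto simp: face_pat_def)
  obtain q where q: "0 < q" "q < 1" "(1, 0, q) \<in> P"
    using cut_crossing(3)[OF cfg, of True False] by (auto simp: face_pat_def)
  obtain r where r: "0 < r" "r < 1" "(0, 1, r) \<in> P"
    using cut_crossing(3)[OF cfg, of False True] by (auto simp: face_pat_def)
  obtain t where t: "0 < t" "t < 1" "(1, 1, t) \<in> P"
    using cut_crossing(3)[OF cfg, of True True] by (auto simp: face_pat_def)
  note pos = p(1,2) q(1,2) r(1,2) t(1,2)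
  have e0: "(x, 0, 0) \<in> P \<Longrightarrow> False" for x using face_three(2)[OF cfg p(3) q(3)] pos by force
  have e1: "(x, 0, 1) \<in> P \<Longrightarrow> False" for x using face_three(2)[OF cfg p(3) q(3)] pos by force
  have e2: "(x, 1, 0) \<in> P \<Longrightarrow> False" for x using face_three(2)[OF cfg r(3) t(3)] pos by force
  have e3: "(x, 1, 1) \<in> P \<Longrightarrow> False" for x using face_three(2)[OF cfg r(3) t(3)] pos by force
  have e4: "(0, y, 0) \<in> P \<Longrightarrow> False" for y using face_three(1)[OF cfg p(3) r(3)] pos by force
  have e5: "(0, y, 1) \<in> P \<Longrightarrow> False" for y using face_three(1)[OF cfg p(3) r(3)] pos by force
  have e6: "(1, y, 0) \<in> P \<Longrightarrow> False" for y using face_three(1)[OF cfg q(3) t(3)] pos by force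
  have e7: "(1, y, 1) \<in> P \<Longrightarrow> False" for y using face_three(1)[OF cfg q(3) t(3)] pos by force
  have e8: "(0, 0, z) \<in> P \<Longrightarrow> z = p" for z using cut_configD(4)[OF cfg p(3)] by simp
  have e9: "(0, 1, z) \<in> P \<Longrightarrow> z = r" for z using cut_configD(4)[OF cfg r(3)] by simp
  have e10: "(1, 0, z) \<in> P \<Longrightarrow> z = q" for z using cut_configD(4)[OF cfg q(3)] by simp
  have e11: "(1, 1, z) \<in> P \<Longrightarrow> z = t" for z using cut_configD(4)[OF cfg t(3)] by simp
  have "P \<subseteq> {(0, 0, p), (1, 0, q), (0, 1, r), (1, 1, t)}"
    by (rule edge_points_subset[OF cut_configD(1)[OF cfg]]; (frule e0 | frule e1 | frule e2 | frule e3 | frule e4 | frule e5 | frule e6 | frule e7 | frule e8 | frule e9 | frule e10 | frule e11); simp)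
  then have "P = {(0, 0, p), (1, 0, q), (0, 1, r), (1, 1, t)}" using p(3) q(3) r(3) t(3) by blast
  then show thesis by (rule that[OF pos])
qed

lemma cut_points_tripod:
  assumes cfg: "cut_config P tripod_pat"
  obtains a a' b b' c c' where "0 < a" "a < 1" "0 < a'" "a' < 1" "0 < b" "b < 1" "0 < b'" "b' < 1" "0 < c" "c < 1" "0 < c'" "c' < 1"
    "P = {(1, a, 0), (a', 1, 0), (0, 1, b), (0, b', 1), (c, 0, 1), (1, 0, c')}"
proof -
  obtain a where a: "0 < a" "a < 1" "(1, a, 0) \<in> P"
    using cut_crossing(2)[OF cfg, of True False] by (auto simp: tripod_pat_def)
  obtain a' where a': "0 < a'" "a' < 1" "(a', 1, 0) \<in> P"
    using cut_crossing(1)[OF cfg, of True False] by (auto simp: tripod_pat_def)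
  obtain b where b: "0 < b" "b < 1" "(0, 1, b) \<in> P"
    using cut_crossing(3)[OF cfg, of False True] by (auto simp: tripod_pat_def)
  obtain b' where b': "0 < b'" "b' < 1" "(0, b', 1) \<in> P"
    using cut_crossing(2)[OF cfg, of False True] by (auto simp: tripod_pat_def)
  obtain c where c: "0 < c" "c < 1" "(c, 0, 1) \<in> P"
    using cut_crossing(1)[OF cfg, of False True] by (auto simp: tripod_pat_def)
  obtain c' where c': "0 < c'" "c' < 1" "(1, 0, c') \<in> P"
    using cut_crossing(3)[OF cfg, of True False] by (auto simp: tripod_pat_def)
  note pos = a(1,2) a'(1,2) b(1,2) b'(1,2) c(1,2) c'(1,2)
  have e0: "(x, 0, 0) \<in> P \<Longrightarrow> False" for x using face_three(2)[OF cfg c(3) c'(3)] pos by force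
  have e1: "(x, 0, 1) \<in> P \<Longrightarrow> x = c" for x using cut_configD(2)[OF cfg c(3)] by simp
  have e2: "(x, 1, 0) \<in> P \<Longrightarrow> x = a'" for x using cut_configD(2)[OF cfg a'(3)] by simp
  have e3: "(x, 1, 1) \<in> P \<Longrightarrow> False" for x using face_three(2)[OF cfg a'(3) b(3)] pos by force
  have e4: "(0, y, 0) \<in> P \<Longrightarrow> False" for y using face_three(1)[OF cfg b(3) b'(3)] pos by force
  have e5: "(0, y, 1) \<in> P \<Longrightarrow> y = b'" for y using cut_configD(3)[OF cfg b'(3)] by simp
  have e6: "(1, y, 0) \<in> P \<Longrightarrow> y = a" for y using cut_configD(3)[OF cfg a(3)] by simp
  have e7: "(1, y, 1) \<in> P \<Longrightarrow> False" for y using face_three(1)[OF cfg a(3) c'(3)] pos by force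
  have e8: "(0, 0, z) \<in> P \<Longrightarrow> False" for z using face_three(1)[OF cfg b(3) b'(3)] pos by force
  have e9: "(0, 1, z) \<in> P \<Longrightarrow> z = b" for z using cut_configD(4)[OF cfg b(3)] by simp
  have e10: "(1, 0, z) \<in> P \<Longrightarrow> z = c'" for z using cut_configD(4)[OF cfg c'(3)] by simp
  have e11: "(1, 1, z) \<in> P \<Longrightarrow> False" for z using face_three(1)[OF cfg a(3) c'(3)] pos by force
  have "P \<subseteq> {(1, a, 0), (a', 1, 0), (0, 1, b), (0, b', 1), (c, 0, 1), (1, 0, c')}"
    by (rule edge_points_subset[OF cut_configD(1)[OF cfg]]; (frule e0 | frule e1 | frule e2 | frule e3 | frule e4 | frule e5 | frule e6 | frule e7 | frule e8 | frule e9 | frule e10 | frule e11); simp)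
  then have "P = {(1, a, 0), (a', 1, 0), (0, 1, b), (0, b', 1), (c, 0, 1), (1, 0, c')}" using a(3) a'(3) b(3) b'(3) c(3) c'(3) by blast
  then show thesis by (rule that[OF pos])
qed

lemma cut_points_path:
  assumes cfg: "cut_config P path_pat"
  obtains a a' b b' c c' where "0 < a" "a < 1" "0 < a'" "a' < 1" "0 < b" "b < 1" "0 < b'" "b' < 1" "0 < c" "c < 1" "0 < c'" "c' < 1"
    "P = {(0, a, 0), (a', 1, 0), (b, 1, 1), (1, b', 1), (1, 0, c), (0, 0, c')}"
proof -
  obtain a where a: "0 < a" "a < 1" "(0, a, 0) \<in> P"
    using cut_crossing(2)[OF cfg, of False False] by (auto simp: path_pat_def)
  obtain a' where a': "0 < a'" "a' < 1" "(a', 1, 0) \<in> P"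
    using cut_crossing(1)[OF cfg, of True False] by (auto simp: path_pat_def)
  obtain b where b: "0 < b" "b < 1" "(b, 1, 1) \<in> P"
    using cut_crossing(1)[OF cfg, of True True] by (auto simp: path_pat_def)
  obtain b' where b': "0 < b'" "b' < 1" "(1, b', 1) \<in> P"
    using cut_crossing(2)[OF cfg, of True True] by (auto simp: path_pat_def)
  obtain c where c: "0 < c" "c < 1" "(1, 0, c) \<in> P"
    using cut_crossing(3)[OF cfg, of True False] by (auto simp: path_pat_def)
  obtain c' where c': "0 < c'" "c' < 1" "(0, 0, c') \<in> P"
    using cut_crossing(3)[OF cfg, of False False] by (auto simp: path_pat_def)
  note pos = a(1,2) a'(1,2) b(1,2) b'(1,2) c(1,2) c'(1,2)
  have e0: "(x, 0, 0) \<in> P \<Longrightarrow> False" for x using face_three(2)[OF cfg c(3) c'(3)] pos by force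
  have e1: "(x, 0, 1) \<in> P \<Longrightarrow> False" for x using face_three(2)[OF cfg c(3) c'(3)] pos by force
  have e2: "(x, 1, 0) \<in> P \<Longrightarrow> x = a'" for x using cut_configD(2)[OF cfg a'(3)] by simp
  have e3: "(x, 1, 1) \<in> P \<Longrightarrow> x = b" for x using cut_configD(2)[OF cfg b(3)] by simp
  have e4: "(0, y, 0) \<in> P \<Longrightarrow> y = a" for y using cut_configD(3)[OF cfg a(3)] by simp
  have e5: "(0, y, 1) \<in> P \<Longrightarrow> False" for y using face_three(1)[OF cfg a(3) c'(3)] pos by force
  have e6: "(1, y, 0) \<in> P \<Longrightarrow> False" for y using face_three(1)[OF cfg b'(3) c(3)] pos by force
  have e7: "(1, y, 1) \<in> P \<Longrightarrow> y = b'" for y using cut_configD(3)[OF cfg b'(3)] by simp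
  have e8: "(0, 0, z) \<in> P \<Longrightarrow> z = c'" for z using cut_configD(4)[OF cfg c'(3)] by simp
  have e9: "(0, 1, z) \<in> P \<Longrightarrow> False" for z using face_three(1)[OF cfg a(3) c'(3)] pos by force
  have e10: "(1, 0, z) \<in> P \<Longrightarrow> z = c" for z using cut_configD(4)[OF cfg c(3)] by simp
  have e11: "(1, 1, z) \<in> P \<Longrightarrow> False" for z using face_three(1)[OF cfg b'(3) c(3)] pos by force
  have "P \<subseteq> {(0, a, 0), (a', 1, 0), (b, 1, 1), (1, b', 1), (1, 0, c), (0, 0, c')}"
    by (rule edge_points_subset[OF cut_configD(1)[OF cfg]]; (frule e0 | frule e1 | frule e2 | frule e3 | frule e4 | frule e5 | frule e6 | frule e7 | frule e8 | frule e9 | frule e10 | frule e11); simp)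
  then have "P = {(0, a, 0), (a', 1, 0), (b, 1, 1), (1, b', 1), (1, 0, c), (0, 0, c')}" using a(3) a'(3) b(3) b'(3) c(3) c'(3) by blast
  then show thesis by (rule that[OF pos])
qed

lemma cut_points_antipodal:
  assumes cfg: "cut_config P antipodal_pat"
  obtains a b c a' b' c' where "0 < a" "a < 1" "0 < b" "b < 1" "0 < c" "c < 1" "0 < a'" "a' < 1" "0 < b'" "b' < 1" "0 < c'" "c' < 1"
    "P = {(a, 0, 0), (0, b, 0), (0, 0, c), (a', 1, 1), (1, b', 1), (1, 1, c')}"
proof -
  obtain a where a: "0 < a" "a < 1" "(a, 0, 0) \<in> P"
    using cut_crossing(1)[OF cfg, of False False] by (auto simp: antipodal_pat_def)
  obtain b where b: "0 < b" "b < 1" "(0, b, 0) \<in> P"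
    using cut_crossing(2)[OF cfg, of False False] by (auto simp: antipodal_pat_def)
  obtain c where c: "0 < c" "c < 1" "(0, 0, c) \<in> P"
    using cut_crossing(3)[OF cfg, of False False] by (auto simp: antipodal_pat_def)
  obtain a' where a': "0 < a'" "a' < 1" "(a', 1, 1) \<in> P"
    using cut_crossing(1)[OF cfg, of True True] by (auto simp: antipodal_pat_def)
  obtain b' where b': "0 < b'" "b' < 1" "(1, b', 1) \<in> P"
    using cut_crossing(2)[OF cfg, of True True] by (auto simp: antipodal_pat_def)
  obtain c' where c': "0 < c'" "c' < 1" "(1, 1, c') \<in> P"
    using cut_crossing(3)[OF cfg, of True True] by (auto simp: antipodal_pat_def)
  note pos = a(1,2) b(1,2) c(1,2) a'(1,2) b'(1,2) c'(1,2)
  have e0: "(x, 0, 0) \<in> P \<Longrightarrow> x = a" for x using cut_configD(2)[OF cfg a(3)] by simp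
  have e1: "(x, 0, 1) \<in> P \<Longrightarrow> False" for x using face_three(2)[OF cfg a(3) c(3)] pos by force
  have e2: "(x, 1, 0) \<in> P \<Longrightarrow> False" for x using face_three(2)[OF cfg a'(3) c'(3)] pos by force
  have e3: "(x, 1, 1) \<in> P \<Longrightarrow> x = a'" for x using cut_configD(2)[OF cfg a'(3)] by simp
  have e4: "(0, y, 0) \<in> P \<Longrightarrow> y = b" for y using cut_configD(3)[OF cfg b(3)] by simp
  have e5: "(0, y, 1) \<in> P \<Longrightarrow> False" for y using face_three(1)[OF cfg b(3) c(3)] pos by force
  have e6: "(1, y, 0) \<in> P \<Longrightarrow> False" for y using face_three(1)[OF cfg b'(3) c'(3)] pos by force
  have e7: "(1, y, 1) \<in> P \<Longrightarrow> y = b'" for y using cut_configD(3)[OF cfg b'(3)] by simp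
  have e8: "(0, 0, z) \<in> P \<Longrightarrow> z = c" for z using cut_configD(4)[OF cfg c(3)] by simp
  have e9: "(0, 1, z) \<in> P \<Longrightarrow> False" for z using face_three(1)[OF cfg b(3) c(3)] pos by force
  have e10: "(1, 0, z) \<in> P \<Longrightarrow> False" for z using face_three(1)[OF cfg b'(3) c'(3)] pos by force
  have e11: "(1, 1, z) \<in> P \<Longrightarrow> z = c'" for z using cut_configD(4)[OF cfg c'(3)] by simp
  have "P \<subseteq> {(a, 0, 0), (0, b, 0), (0, 0, c), (a', 1, 1), (1, b', 1), (1, 1, c')}"
    by (rule edge_points_subset[OF cut_configD(1)[OF cfg]]; (frule e0 | frule e1 | frule e2 | frule e3 | frule e4 | frule e5 | frule e6 | frule e7 | frule e8 | frule e9 | frule e10 | frule e11); simp)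
  then have "P = {(a, 0, 0), (0, b, 0), (0, 0, c), (a', 1, 1), (1, b', 1), (1, 1, c')}" using a(3) b(3) c(3) a'(3) b'(3) c'(3) by blast
  then show thesis by (rule that[OF pos])
qed

section \<open>Admissible triangles of each pattern\<close>

lemma bicoercive_swap13:
  "bicoercive (\<lambda>i j k. s k j i) z y x n3 n2 n1 d \<longleftrightarrow> bicoercive s x y z n1 n2 n3 d"
  unfolding bicoercive_swap12[of "\<lambda>i j k. s k i j" z y x n3 n2 n1 d]
    bicoercive_swap23[of "\<lambda>i j k. s j i k" y z x n2 n3 n1 d] bicoercive_swap12[of s y x z n2 n1 n3 d] ..

lemma bicoercive_flip2:
  "bicoercive (\<lambda>i j k. s i (\<not> j) k) x (1 - y) z n1 (- n2) n3 (d - n2) \<longleftrightarrow> bicoercive s x y z n1 n2 n3 d"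
  unfolding bicoercive_swap12[of "\<lambda>i j k. s j (\<not> i) k" x "1 - y" z n1 "- n2" n3 "d - n2"]
    bicoercive_flip1[of "\<lambda>i j k. s j i k" y x z n2 n1 n3 d] bicoercive_swap12[of s y x z n2 n1 n3 d] ..

lemma bicoercive_flip3:
  "bicoercive (\<lambda>i j k. s i j (\<not> k)) x y (1 - z) n1 n2 (- n3) (d - n3) \<longleftrightarrow> bicoercive s x y z n1 n2 n3 d"
  unfolding bicoercive_swap13[of "\<lambda>i j k. s k j (\<not> i)" x y "1 - z" n1 n2 "- n3" "d - n3"]
    bicoercive_flip1[of "\<lambda>i j k. s k j i" z y x n3 n2 n1 d] bicoercive_swap13[of s z y x n3 n2 n1 d] ..

text \<open>Central inversion combined with the exchange of the first and third axes; it is used for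
  the second triangle of the path pattern.\<close>

lemma bicoercive_reverse:
  "bicoercive (\<lambda>i j k. s (\<not> k) (\<not> j) (\<not> i)) (1 - z) (1 - y) (1 - x) (- n3) (- n2) (- n1) (d - n1 - n2 - n3)
     \<longleftrightarrow> bicoercive s x y z n1 n2 n3 d"
  unfolding bicoercive_swap13[of "\<lambda>i j k. s (\<not> i) (\<not> j) (\<not> k)" "1 - z" "1 - y" "1 - x" "- n3" "- n2" "- n1"]
    bicoercive_flip3[of "\<lambda>i j k. s (\<not> i) (\<not> j) k" "1 - x" "1 - y" z "- n1" "- n2" n3 "d - n1 - n2"]
    bicoercive_flip2[of "\<lambda>i j k. s (\<not> i) j k" "1 - x" y z "- n1" n2 n3 "d - n1"] bicoercive_flip1[of s x y z n1 n2 n3 d] ..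

lemma centroid_bicoercive3:
  assumes "(x1, y1, z1) \<noteq> (x2, y2, z2)" "(x1, y1, z1) \<noteq> (x3, y3, z3)" "(x2, y2, z2) \<noteq> (x3, y3, z3)"
    and "\<And>n1 n2 n3 d. n1\<^sup>2 + n2\<^sup>2 + n3\<^sup>2 = 1 \<Longrightarrow> n1 * x1 + n2 * y1 + n3 * z1 = d \<Longrightarrow> n1 * x2 + n2 * y2 + n3 * z2 = d \<Longrightarrow>
      n1 * x3 + n2 * y3 + n3 * z3 = d \<Longrightarrow> bicoercive s ((x1 + (x2 + x3)) / 3) ((y1 + (y2 + y3)) / 3) ((z1 + (z2 + z3)) / 3) n1 n2 n3 d"
  shows "centroid_bicoercive s {(x1, y1, z1), (x2, y2, z2), (x3, y3, z3)}"
proof -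
  have "(\<Sum>w\<in>{p, q, r}. f w) = f p + (f q + f r)" if "p \<noteq> q" "p \<noteq> r" "q \<noteq> r" for p q r :: triple and f :: "triple \<Rightarrow> real"
    using that by simp
  note this[OF assms(1-3)]
  then show ?thesis unfolding centroid_bicoercive_def using assms(4) by simp
qed

text \<open>Writing a cardinality as a sum of truth values turns the selection lemmas below into
  finite checks on booleans.\<close>

lemma card_subset_list:
  assumes "K \<subseteq> set xs" "distinct xs"
  shows "card K = (\<Sum>x\<leftarrow>xs. of_bool (x \<in> K))"
proof -
  have "K = set (filter (\<lambda>x. x \<in> K) xs)" using assms(1) by auto
  then have "card K = length (filter (\<lambda>x. x \<in> K) xs)" using distinct_card[of "filter (\<lambda>x. x \<in> K) xs"] assms(2) by simp
  also have "\<dots> = (\<Sum>x\<leftarrow>xs. of_bool (x \<in> K))" by (induction xs) auto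
  finally show ?thesis .
qed

lemma card3_of_4:
  assumes K: "K \<subseteq> set [p, q, r, t]" and "distinct [p, q, r, t]" "card K = 3"
  shows "K = {p, q, r} \<or> K = {p, q, t} \<or> K = {p, r, t} \<or> K = {q, r, t}"
proof -
  have bools: "(a \<and> b \<and> c \<and> \<not> d) \<or> (a \<and> b \<and> \<not> c \<and> d) \<or> (a \<and> \<not> b \<and> c \<and> d) \<or> (\<not> a \<and> b \<and> c \<and> d)"
    if "of_bool a + (of_bool b + (of_bool c + (of_bool d))) = (3::nat)" for a b c d
    using that by (cases a; cases b; cases c; cases d) simp_all
  have "of_bool (p \<in> K) + (of_bool (q \<in> K) + (of_bool (r \<in> K) + (of_bool (t \<in> K)))) = (3::nat)"
    using card_subset_list[OF assms(1,2)] assms(3) by simp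
  from bools[OF this] show ?thesis
  proof (elim disjE)
    assume "p \<in> K \<and> q \<in> K \<and> r \<in> K \<and> t \<notin> K" then have "K = {p, q, r}" using K by auto then show ?thesis by blast
  next
    assume "p \<in> K \<and> q \<in> K \<and> r \<notin> K \<and> t \<in> K" then have "K = {p, q, t}" using K by auto then show ?thesis by blast
  next
    assume "p \<in> K \<and> q \<notin> K \<and> r \<in> K \<and> t \<in> K" then have "K = {p, r, t}" using K by auto then show ?thesis by blast
  next
    assume "p \<notin> K \<and> q \<in> K \<and> r \<in> K \<and> t \<in> K" then have "K = {q, r, t}" using K by auto then show ?thesis by blast
  qed
qed

text \<open>In the L-shaped pattern, consecutive cut points share a face and form a cycle of length
  five, which has no independent triple.\<close>

lemma card3_cycle5:
  assumes K: "K \<subseteq> set [p1, p2, p3, p4, p5]" "distinct [p1, p2, p3, p4, p5]" "card K = 3"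
    and adj: "\<not> (p1 \<in> K \<and> p2 \<in> K)" "\<not> (p2 \<in> K \<and> p3 \<in> K)" "\<not> (p3 \<in> K \<and> p4 \<in> K)"
      "\<not> (p4 \<in> K \<and> p5 \<in> K)" "\<not> (p5 \<in> K \<and> p1 \<in> K)"
  shows False
proof -
  have bools: False if "of_bool a + (of_bool b + (of_bool c + (of_bool d + (of_bool e)))) = (3::nat)"
    "\<not> (a \<and> b)" "\<not> (b \<and> c)" "\<not> (c \<and> d)" "\<not> (d \<and> e)" "\<not> (e \<and> a)" for a b c d e
    using that by (cases a; cases b; cases c; cases d; cases e) simp_all
  have "of_bool (p1 \<in> K) + (of_bool (p2 \<in> K) + (of_bool (p3 \<in> K) + (of_bool (p4 \<in> K) + (of_bool (p5 \<in> K))))) = (3::nat)"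
    using card_subset_list[OF K(1,2)] K(3) by simp
  from bools[OF this adj] show False .
qed

text \<open>For the hexagon of cut points in the tripod and path patterns: its independent triples
  are the two alternating ones.\<close>

lemma card3_cycle6:
  assumes K: "K \<subseteq> set [p1, p2, p3, p4, p5, p6]" "distinct [p1, p2, p3, p4, p5, p6]" "card K = 3"
    and adj: "\<not> (p1 \<in> K \<and> p2 \<in> K)" "\<not> (p2 \<in> K \<and> p3 \<in> K)" "\<not> (p3 \<in> K \<and> p4 \<in> K)"
      "\<not> (p4 \<in> K \<and> p5 \<in> K)" "\<not> (p5 \<in> K \<and> p6 \<in> K)" "\<not> (p6 \<in> K \<and> p1 \<in> K)"
  shows "K = {p1, p3, p5} \<or> K = {p2, p4, p6}"
proof -
  have bools: "(a \<and> c \<and> e \<and> \<not> b \<and> \<not> d \<and> \<not> f) \<or> (b \<and> d \<and> f \<and> \<not> a \<and> \<not> c \<and> \<not> e)"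
    if "of_bool a + (of_bool b + (of_bool c + (of_bool d + (of_bool e + (of_bool f))))) = (3::nat)"
      "\<not> (a \<and> b)" "\<not> (b \<and> c)" "\<not> (c \<and> d)" "\<not> (d \<and> e)" "\<not> (e \<and> f)" "\<not> (f \<and> a)" for a b c d e f
    using that by (cases a; cases b; cases c; cases d; cases e; cases f) simp_all
  have "of_bool (p1 \<in> K) + (of_bool (p2 \<in> K) + (of_bool (p3 \<in> K) + (of_bool (p4 \<in> K) + (of_bool (p5 \<in> K) + (of_bool (p6 \<in> K)))))) = (3::nat)"
    using card_subset_list[OF K(1,2)] K(3) by simp
  from bools[OF this adj] show ?thesis
  proof
    assume "p1 \<in> K \<and> p3 \<in> K \<and> p5 \<in> K \<and> p2 \<notin> K \<and> p4 \<notin> K \<and> p6 \<notin> K"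
    then have "K = {p1, p3, p5}" using K(1) by auto
    then show ?thesis ..
  next
    assume "p2 \<in> K \<and> p4 \<in> K \<and> p6 \<in> K \<and> p1 \<notin> K \<and> p3 \<notin> K \<and> p5 \<notin> K"
    then have "K = {p2, p4, p6}" using K(1) by auto
    then show ?thesis ..
  qed
qed

text \<open>In the antipodal pattern the cut points form two triples of pairwise cofacial points,
  and an independent set takes at most one point from each.\<close>

lemma card3_triangles:
  assumes K: "K \<subseteq> set [p1, p2, p3, p4, p5, p6]" "distinct [p1, p2, p3, p4, p5, p6]" "card K = 3"
    and adj: "\<not> (p1 \<in> K \<and> p2 \<in> K)" "\<not> (p2 \<in> K \<and> p3 \<in> K)" "\<not> (p3 \<in> K \<and> p1 \<in> K)"
      "\<not> (p4 \<in> K \<and> p5 \<in> K)" "\<not> (p5 \<in> K \<and> p6 \<in> K)" "\<not> (p6 \<in> K \<and> p4 \<in> K)"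
  shows False
proof -
  have bools: False
    if "of_bool a + (of_bool b + (of_bool c + (of_bool d + (of_bool e + (of_bool f))))) = (3::nat)"
      "\<not> (a \<and> b)" "\<not> (b \<and> c)" "\<not> (c \<and> a)" "\<not> (d \<and> e)" "\<not> (e \<and> f)" "\<not> (f \<and> d)" for a b c d e f
    using that by (cases a; cases b; cases c; cases d; cases e; cases f) simp_all
  have "of_bool (p1 \<in> K) + (of_bool (p2 \<in> K) + (of_bool (p3 \<in> K) + (of_bool (p4 \<in> K) + (of_bool (p5 \<in> K) + (of_bool (p6 \<in> K)))))) = (3::nat)"
    using card_subset_list[OF K(1,2)] K(3) by simp
  from bools[OF this adj] show False .
qed

lemma coface_pair: "coface {(x, y, z), (x', y', z')} \<longleftrightarrow> (bin x \<and> x = x') \<or> (bin y \<and> y = y') \<or> (bin z \<and> z = z')"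
  unfolding coface_def by auto

text \<open>Without sign changes there may still be cut points where the surface touches edges. Any
  vertex of the triangle is a point of the plane inside the cube, as \<open>bicoercive_const\<close>
  requires.\<close>

lemma stable_const: "stable (\<lambda>i j k. False)"
  unfolding stable_def centroid_bicoercive_def
proof (intro allI impI)
  fix P K n1 n2 n3 d
  assume a: "cut_config P (\<lambda>i j k. False)" "admissible_triple P K" "n1\<^sup>2 + n2\<^sup>2 + n3\<^sup>2 = 1"
    "\<forall>(x, y, z)\<in>K. n1 * x + n2 * y + n3 * z = d"
  from a(2) have "K \<noteq> {}" "K \<subseteq> P" unfolding admissible_triple_def by auto
  then obtain x y z where "(x, y, z) \<in> K" by (metis ex_in_conv prod_cases3)
  moreover from this have "(x, y, z) \<in> edge_points" using \<open>K \<subseteq> P\<close> cut_configD(1)[OF a(1)] by blast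
  then have "0 \<le> x" "x \<le> 1" "0 \<le> y" "y \<le> 1" "0 \<le> z" "z \<le> 1" by (auto simp: edge_points_def bin_def)
  ultimately show "bicoercive (\<lambda>i j k. False) ((\<Sum>(x, y, z)\<in>K. x) / 3) ((\<Sum>(x, y, z)\<in>K. y) / 3) ((\<Sum>(x, y, z)\<in>K. z) / 3) n1 n2 n3 d"
    using a(4) by (intro bicoercive_const[OF a(3), of _ x y z]) auto
qed

lemma stable_corner: "stable corner_pat"
  unfolding stable_def
proof (intro allI impI)
  fix P K assume cfg: "cut_config P corner_pat" and adm: "admissible_triple P K"
  obtain a b c where pos: "0 < a" "a < 1" "0 < b" "b < 1" "0 < c" "c < 1"
    and P: "P = {(a, 0, 0), (0, b, 0), (0, 0, c)}" by (rule cut_points_corner[OF cfg])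
  have "K = P"
    by (rule card_subset_eq) (use adm pos in \<open>auto simp: P admissible_triple_def\<close>)
  moreover have "centroid_bicoercive corner_pat {(a, 0, 0), (0, b, 0), (0, 0, c)}"
    by (rule centroid_bicoercive3) (use pos bicoercive_corner[OF _ pos] in auto)
  ultimately show "centroid_bicoercive corner_pat K" unfolding P by simp
qed

text \<open>Any three of the four cut points are treated, whichever the selection rule prefers.
  Exchanging the first two axes and reflecting the third preserve the pattern and reduce all four
  choices to \<open>bicoercive_edge\<close>.\<close>

lemma stable_edge: "stable edge_pat"
  unfolding stable_def
proof (intro allI impI)
  fix P K assume cfg: "cut_config P edge_pat" and adm: "admissible_triple P K"
  obtain a b c e where pos: "0 < a" "a < 1" "0 < b" "b < 1" "0 < c" "c < 1" "0 < e" "e < 1"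
    and P: "P = {(a, 0, 0), (0, b, 0), (c, 0, 1), (0, e, 1)}" by (rule cut_points_edge[OF cfg])
  have swap: "(\<lambda>i j k. edge_pat j i k) = edge_pat" and flip: "(\<lambda>i j k. edge_pat i j (\<not> k)) = edge_pat"
    by (auto simp: edge_pat_def fun_eq_iff)
  have 4: "centroid_bicoercive edge_pat {(0, b, 0), (a, 0, 1), (0, c, 1)}"
    if pos: "0 < a" "a < 1" "0 < b" "b < 1" "0 < c" "c < 1" for a b c
  proof (rule centroid_bicoercive3)
    fix n1 n2 n3 d
    assume n: "n1\<^sup>2 + n2\<^sup>2 + n3\<^sup>2 = 1" "n1 * 0 + n2 * b + n3 * 0 = d" "n1 * a + n2 * 0 + n3 * 1 = d"
      "n1 * 0 + n2 * c + n3 * 1 = d"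
    show "bicoercive edge_pat ((0 + (a + 0)) / 3) ((b + (0 + c)) / 3) ((0 + (1 + 1)) / 3) n1 n2 n3 d"
      using bicoercive_edge[OF n(1), of b a c d] pos n(2-4) by simp
  qed (use pos in auto)
  have 3: "centroid_bicoercive edge_pat {(0, b, 1), (a, 0, 0), (0, c, 0)}"
    if pos: "0 < a" "a < 1" "0 < b" "b < 1" "0 < c" "c < 1" for a b c
  proof (rule centroid_bicoercive3)
    fix n1 n2 n3 d
    assume n: "n1\<^sup>2 + n2\<^sup>2 + n3\<^sup>2 = 1" "n1 * 0 + n2 * b + n3 * 1 = d" "n1 * a + n2 * 0 + n3 * 0 = d"
      "n1 * 0 + n2 * c + n3 * 0 = d"
    have "n1\<^sup>2 + n2\<^sup>2 + (- n3)\<^sup>2 = 1" using n(1) by simp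
    from bicoercive_edge[OF this, of b a c "d - n3"] pos n(2-4)
    have "bicoercive edge_pat (a / 3) ((b + c) / 3) (1 - 1 / 3) n1 n2 (- n3) (d - n3)" by simp
    then have "bicoercive (\<lambda>i j k. edge_pat i j (\<not> k)) (a / 3) ((b + c) / 3) (1 - 1 / 3) n1 n2 (- n3) (d - n3)"
      unfolding flip .
    then have "bicoercive edge_pat (a / 3) ((b + c) / 3) (1 / 3) n1 n2 n3 d" by (rule bicoercive_flip3[THEN iffD1])
    then show "bicoercive edge_pat ((0 + (a + 0)) / 3) ((b + (0 + c)) / 3) ((1 + (0 + 0)) / 3) n1 n2 n3 d" by simp
  qed (use pos in auto)
  have sw: "centroid_bicoercive edge_pat K'" if "centroid_bicoercive edge_pat (swap12 ` K')" for K'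
    by (rule centroid_bicoercive_swap12) (simp only: swap that)
  have "K = {(a, 0, 0), (0, b, 0), (c, 0, 1)} \<or> K = {(a, 0, 0), (0, b, 0), (0, e, 1)} \<or>
      K = {(a, 0, 0), (c, 0, 1), (0, e, 1)} \<or> K = {(0, b, 0), (c, 0, 1), (0, e, 1)}"
    by (rule card3_of_4) (use adm P pos in \<open>auto simp: admissible_triple_def\<close>)
  then show "centroid_bicoercive edge_pat K"
  proof (elim disjE)
    assume K: "K = {(0, b, 0), (c, 0, 1), (0, e, 1)}"
    show ?thesis unfolding K by (rule 4) (fact pos)+
  next
    assume K: "K = {(a, 0, 0), (c, 0, 1), (0, e, 1)}"
    have "swap12 ` K = {(0, a, 0), (e, 0, 1), (0, c, 1)}" unfolding K by (auto simp: swap12_def)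
    then show ?thesis using sw[of K] 4[of e a c] pos by simp
  next
    assume K: "K = {(a, 0, 0), (0, b, 0), (0, e, 1)}"
    have "K = {(0, e, 1), (a, 0, 0), (0, b, 0)}" unfolding K by auto
    then show ?thesis using 3[of a e b] pos by simp
  next
    assume K: "K = {(a, 0, 0), (0, b, 0), (c, 0, 1)}"
    have "swap12 ` K = {(0, c, 1), (b, 0, 0), (0, a, 0)}" unfolding K by (auto simp: swap12_def)
    then show ?thesis using sw[of K] 3[of b c a] pos by simp
  qed
qed

text \<open>With more than four cut points and no matching family of parallel edges, only the last
  alternative of \<open>admissible_triple\<close> remains. It is phrased in coordinates so that each
  adjacent pair follows by simplification.\<close>

lemma admissible_skew:
  assumes adm: "admissible_triple P K" and P: "4 < card P"
    and E: "\<And>E. E \<in> {edges1, edges2, edges3} \<Longrightarrow> \<not> P \<subseteq> E \<and> K \<noteq> P \<inter> E"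
    and pq: "(x, y, z) \<noteq> (x', y', z')" "(bin x \<and> x = x') \<or> (bin y \<and> y = y') \<or> (bin z \<and> z = z')"
  shows "\<not> ((x, y, z) \<in> K \<and> (x', y', z') \<in> K)"
proof -
  from adm consider "card P \<le> 4" | "\<exists>E\<in>{edges1, edges2, edges3}. P \<subseteq> E \<or> K = P \<inter> E"
    | "\<forall>p\<in>K. \<forall>q\<in>K. p \<noteq> q \<longrightarrow> \<not> coface {p, q}"
    unfolding admissible_triple_def by (elim conjE disjE)
  then have "\<forall>p\<in>K. \<forall>q\<in>K. p \<noteq> q \<longrightarrow> \<not> coface {p, q}"
  proof cases
    case 1
    with P show ?thesis by simp
  next
    case 2
    with E show ?thesis by blast
  qed
  note skew = this[rule_format, OF _ _ pq(1)]
  show ?thesis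
  proof
    assume "(x, y, z) \<in> K \<and> (x', y', z') \<in> K"
    then have "\<not> coface {(x, y, z), (x', y', z')}" by (elim conjE) (rule skew)
    with pq(2) show False unfolding coface_pair by blast
  qed
qed

text \<open>Each other direction carries only one cut point, so a triple different from the one on
  the three parallel edges would have no two points on a common face, which the five-cycle
  forbids.\<close>

lemma stable_ell: "stable ell_pat"
  unfolding stable_def
proof (intro allI impI)
  fix P K assume cfg: "cut_config P ell_pat" and adm: "admissible_triple P K"
  obtain p q f e r where pos: "0 < p" "p < 1" "0 < q" "q < 1" "0 < f" "f < 1" "0 < e" "e < 1" "0 < r" "r < 1"
    and P: "P = {(0, 0, p), (1, 0, q), (1, f, 0), (e, 1, 0), (0, 1, r)}" by (rule cut_points_ell[OF cfg])
  have K: "K \<subseteq> P" "card K = 3" using adm unfolding admissible_triple_def by auto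
  have card: "4 < card P" unfolding P using pos by simp
  have inter: "P \<inter> edges1 = {(e, 1, 0)}" "P \<inter> edges2 = {(1, f, 0)}" "P \<inter> edges3 = {(0, 0, p), (1, 0, q), (0, 1, r)}"
    unfolding P edges1_def edges2_def edges3_def using pos by auto
  have K_eq: "K = {(0, 0, p), (1, 0, q), (0, 1, r)}"
  proof (rule ccontr)
    assume ne: "K \<noteq> {(0, 0, p), (1, 0, q), (0, 1, r)}"
    have E: "\<not> P \<subseteq> E \<and> K \<noteq> P \<inter> E" if "E \<in> {edges1, edges2, edges3}" for E
    proof -
      from that have "card (P \<inter> E) \<le> 3 \<and> K \<noteq> P \<inter> E"
      proof (elim insertE emptyE)
        assume "E = edges1" then show ?thesis using inter(1) K(2) by auto
      next
        assume "E = edges2" then show ?thesis using inter(2) K(2) by auto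
      next
        assume "E = edges3" then show ?thesis using inter(3) ne by simp
      qed
      then show ?thesis using card by (auto simp: Int_absorb2)
    qed
    note skew = admissible_skew[OF adm card E]
    have adj: "\<not> ((0, 0, p) \<in> K \<and> (1, 0, q) \<in> K)"
      "\<not> ((1, 0, q) \<in> K \<and> (1, f, 0) \<in> K)"
      "\<not> ((1, f, 0) \<in> K \<and> (e, 1, 0) \<in> K)"
      "\<not> ((e, 1, 0) \<in> K \<and> (0, 1, r) \<in> K)"
      "\<not> ((0, 1, r) \<in> K \<and> (0, 0, p) \<in> K)"
      by (rule skew; use pos in simp)+
    show False
      by (rule card3_cycle5[OF _ _ K(2) adj(1) adj(2) adj(3) adj(4) adj(5)])
        (use K(1) P pos in simp_all)
  qed
  show "centroid_bicoercive ell_pat K" unfolding K_eq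
  proof (rule centroid_bicoercive3)
    fix n1 n2 n3 d
    assume n: "n1\<^sup>2 + n2\<^sup>2 + n3\<^sup>2 = 1" "n1 * 0 + n2 * 0 + n3 * p = d" "n1 * 1 + n2 * 0 + n3 * q = d"
      "n1 * 0 + n2 * 1 + n3 * r = d"
    show "bicoercive ell_pat ((0 + (1 + 0)) / 3) ((0 + (0 + 1)) / 3) ((p + (q + r)) / 3) n1 n2 n3 d"
    proof -
      have "bicoercive ell_pat (1 / 3) (1 / 3) ((p + q + r) / 3) n1 n2 n3 d"
      proof (rule bicoercive_ell[OF n(1)])
        show "n3 * p = d" using n(2) by simp
        show "n1 + n3 * q = d" using n(3) by simp
        show "n2 + n3 * r = d" using n(4) by simp
      qed (fact pos)+
      then show ?thesis by (simp add: add.assoc)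
    qed
  qed (use pos in auto)
qed

text \<open>Omitting one of the four cut points leaves one that is adjacent to the other two.
  Reflections in the first two axes preserve the pattern and move this one to the edge over the
  origin.\<close>

lemma stable_face: "stable face_pat"
  unfolding stable_def
proof (intro allI impI)
  fix P K assume cfg: "cut_config P face_pat" and adm: "admissible_triple P K"
  obtain p q r t where pos: "0 < p" "p < 1" "0 < q" "q < 1" "0 < r" "r < 1" "0 < t" "t < 1"
    and P: "P = {(0, 0, p), (1, 0, q), (0, 1, r), (1, 1, t)}" by (rule cut_points_face[OF cfg])
  have base: "bicoercive face_pat (1 / 3) (1 / 3) ((p + (q + r)) / 3) n1 n2 n3 d"
    if "n1\<^sup>2 + n2\<^sup>2 + n3\<^sup>2 = 1" "0 < p" "p < 1" "0 < q" "q < 1" "0 < r" "r < 1"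
      "n3 * p = d" "n1 + n3 * q = d" "n2 + n3 * r = d" for p q r n1 n2 n3 d
    using bicoercive_face[OF that] by (simp add: add.assoc)
  have flip1: "bicoercive face_pat x y z n1 n2 n3 d" if "bicoercive face_pat (1 - x) y z (- n1) n2 n3 (d - n1)" for x y z n1 n2 n3 d
    using that bicoercive_flip1[of face_pat x y z n1 n2 n3 d] unfolding face_pat_def by simp
  have flip2: "bicoercive face_pat x y z n1 n2 n3 d" if "bicoercive face_pat x (1 - y) z n1 (- n2) n3 (d - n2)" for x y z n1 n2 n3 d
    using that bicoercive_flip2[of face_pat x y z n1 n2 n3 d] unfolding face_pat_def by simp
  have "K = {(0, 0, p), (1, 0, q), (0, 1, r)} \<or> K = {(0, 0, p), (1, 0, q), (1, 1, t)} \<or>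
      K = {(0, 0, p), (0, 1, r), (1, 1, t)} \<or> K = {(1, 0, q), (0, 1, r), (1, 1, t)}"
    by (rule card3_of_4) (use adm P pos in \<open>auto simp: admissible_triple_def\<close>)
  then show "centroid_bicoercive face_pat K"
  proof (elim disjE)
    assume K: "K = {(0, 0, p), (1, 0, q), (0, 1, r)}"
    show ?thesis unfolding K
    proof (rule centroid_bicoercive3)
      fix n1 n2 n3 d
      assume n: "n1\<^sup>2 + n2\<^sup>2 + n3\<^sup>2 = 1" "n1 * 0 + n2 * 0 + n3 * p = d" "n1 * 1 + n2 * 0 + n3 * q = d"
        "n1 * 0 + n2 * 1 + n3 * r = d"
      show "bicoercive face_pat ((0 + (1 + 0)) / 3) ((0 + (0 + 1)) / 3) ((p + (q + r)) / 3) n1 n2 n3 d"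
        using base[OF n(1), of p q r d] pos n(2-4) by simp
    qed auto
  next
    assume K: "K = {(0, 0, p), (1, 0, q), (1, 1, t)}"
    show ?thesis unfolding K
    proof (rule centroid_bicoercive3)
      fix n1 n2 n3 d
      assume n: "n1\<^sup>2 + n2\<^sup>2 + n3\<^sup>2 = 1" "n1 * 0 + n2 * 0 + n3 * p = d" "n1 * 1 + n2 * 0 + n3 * q = d"
        "n1 * 1 + n2 * 1 + n3 * t = d"
      have "bicoercive face_pat (1 - 2 / 3) (1 / 3) ((q + (p + t)) / 3) (- n1) n2 n3 (d - n1)"
        using base[of "- n1" n2 n3 q p t "d - n1"] pos n by simp
      from flip1[OF this] show "bicoercive face_pat ((0 + (1 + 1)) / 3) ((0 + (0 + 1)) / 3) ((p + (q + t)) / 3) n1 n2 n3 d"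
        by (simp add: add.left_commute)
    qed auto
  next
    assume K: "K = {(0, 0, p), (0, 1, r), (1, 1, t)}"
    show ?thesis unfolding K
    proof (rule centroid_bicoercive3)
      fix n1 n2 n3 d
      assume n: "n1\<^sup>2 + n2\<^sup>2 + n3\<^sup>2 = 1" "n1 * 0 + n2 * 0 + n3 * p = d" "n1 * 0 + n2 * 1 + n3 * r = d"
        "n1 * 1 + n2 * 1 + n3 * t = d"
      have "bicoercive face_pat (1 / 3) (1 - 2 / 3) ((r + (t + p)) / 3) n1 (- n2) n3 (d - n2)"
        using base[of n1 "- n2" n3 r t p "d - n2"] pos n by simp
      from flip2[OF this] show "bicoercive face_pat ((0 + (0 + 1)) / 3) ((0 + (1 + 1)) / 3) ((p + (r + t)) / 3) n1 n2 n3 d"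
        by (simp add: add.left_commute add.commute)
    qed auto
  next
    assume K: "K = {(1, 0, q), (0, 1, r), (1, 1, t)}"
    show ?thesis unfolding K
    proof (rule centroid_bicoercive3)
      fix n1 n2 n3 d
      assume n: "n1\<^sup>2 + n2\<^sup>2 + n3\<^sup>2 = 1" "n1 * 1 + n2 * 0 + n3 * q = d" "n1 * 0 + n2 * 1 + n3 * r = d"
        "n1 * 1 + n2 * 1 + n3 * t = d"
      have "bicoercive face_pat (1 - 2 / 3) (1 - 2 / 3) ((t + (r + q)) / 3) (- n1) (- n2) n3 (d - n2 - n1)"
        using base[of "- n1" "- n2" n3 t r q "d - n2 - n1"] pos n by simp
      from flip2[OF flip1[OF this]] show "bicoercive face_pat ((1 + (0 + 1)) / 3) ((0 + (1 + 1)) / 3) ((q + (r + t)) / 3) n1 n2 n3 d"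
        by (simp add: add.left_commute add.commute)
    qed auto
  qed
qed

text \<open>Exchanging the first two axes preserves the pattern and gives the second alternating
  triple the shape of the first.\<close>

lemma stable_tripod: "stable tripod_pat"
  unfolding stable_def
proof (intro allI impI)
  fix P K assume cfg: "cut_config P tripod_pat" and adm: "admissible_triple P K"
  obtain a a' b b' c c' where pos: "0 < a" "a < 1" "0 < a'" "a' < 1" "0 < b" "b < 1" "0 < b'" "b' < 1" "0 < c" "c < 1" "0 < c'" "c' < 1"
    and P: "P = {(1, a, 0), (a', 1, 0), (0, 1, b), (0, b', 1), (c, 0, 1), (1, 0, c')}" by (rule cut_points_tripod[OF cfg])
  have K: "K \<subseteq> P" "card K = 3" using adm unfolding admissible_triple_def by auto
  have card: "4 < card P" unfolding P using pos by simp
  have inter: "P \<inter> edges1 = {(a', 1, 0), (c, 0, 1)}" "P \<inter> edges2 = {(1, a, 0), (0, b', 1)}" "P \<inter> edges3 = {(0, 1, b), (1, 0, c')}"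
    unfolding P edges1_def edges2_def edges3_def using pos by auto
  have E: "\<not> P \<subseteq> E \<and> K \<noteq> P \<inter> E" if "E \<in> {edges1, edges2, edges3}" for E
  proof -
    have "card (P \<inter> E) \<le> 2" using that inter pos by auto
    then show ?thesis using card K(2) by (auto simp: Int_absorb2)
  qed
  note skew = admissible_skew[OF adm card E]
  have adj: "\<not> ((1, a, 0) \<in> K \<and> (a', 1, 0) \<in> K)"
    "\<not> ((a', 1, 0) \<in> K \<and> (0, 1, b) \<in> K)"
    "\<not> ((0, 1, b) \<in> K \<and> (0, b', 1) \<in> K)"
    "\<not> ((0, b', 1) \<in> K \<and> (c, 0, 1) \<in> K)"
    "\<not> ((c, 0, 1) \<in> K \<and> (1, 0, c') \<in> K)"
    "\<not> ((1, 0, c') \<in> K \<and> (1, a, 0) \<in> K)"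
    by (rule skew; use pos in simp)+
  have cases: "K = {(1, a, 0), (0, 1, b), (c, 0, 1)} \<or> K = {(a', 1, 0), (0, b', 1), (1, 0, c')}"
    by (rule card3_cycle6[OF _ _ K(2) adj(1) adj(2) adj(3) adj(4) adj(5) adj(6)])
      (use K(1) P pos in simp_all)
  have base: "centroid_bicoercive tripod_pat {(1, a, 0), (0, 1, b), (c, 0, 1)}"
    if pos: "0 < a" "a < 1" "0 < b" "b < 1" "0 < c" "c < 1" for a b c
  proof (rule centroid_bicoercive3)
    fix n1 n2 n3 d
    assume n: "n1\<^sup>2 + n2\<^sup>2 + n3\<^sup>2 = 1" "n1 * 1 + n2 * a + n3 * 0 = d" "n1 * 0 + n2 * 1 + n3 * b = d"
      "n1 * c + n2 * 0 + n3 * 1 = d"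
    show "bicoercive tripod_pat ((1 + (0 + c)) / 3) ((a + (1 + 0)) / 3) ((0 + (b + 1)) / 3) n1 n2 n3 d"
    proof -
      have "bicoercive tripod_pat ((1 + c) / 3) ((1 + a) / 3) ((1 + b) / 3) n1 n2 n3 d"
      proof (rule bicoercive_tripod[OF n(1) pos])
        show "n1 + n2 * a = d" using n(2) by simp
        show "n2 + n3 * b = d" using n(3) by simp
        show "n3 + n1 * c = d" using n(4) by simp
      qed
      then show ?thesis by (simp add: add.commute)
    qed
  qed (use pos in auto)
  have swap: "(\<lambda>i j k. tripod_pat j i k) = tripod_pat" by (auto simp: tripod_pat_def fun_eq_iff)
  show "centroid_bicoercive tripod_pat K" using cases
  proof
    assume "K = {(1, a, 0), (0, 1, b), (c, 0, 1)}"
    then show ?thesis using base[of a b c] pos by simp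
  next
    assume "K = {(a', 1, 0), (0, b', 1), (1, 0, c')}"
    then have "swap12 ` K = {(1, a', 0), (0, 1, c'), (b', 0, 1)}" by (auto simp: swap12_def)
    then show ?thesis using base[of a' c' b'] pos by - (rule centroid_bicoercive_swap12, simp add: swap)
  qed
qed

lemma stable_path: "stable path_pat"
  unfolding stable_def
proof (intro allI impI)
  fix P K assume cfg: "cut_config P path_pat" and adm: "admissible_triple P K"
  obtain a a' b b' c c' where pos: "0 < a" "a < 1" "0 < a'" "a' < 1" "0 < b" "b < 1" "0 < b'" "b' < 1" "0 < c" "c < 1" "0 < c'" "c' < 1"
    and P: "P = {(0, a, 0), (a', 1, 0), (b, 1, 1), (1, b', 1), (1, 0, c), (0, 0, c')}" by (rule cut_points_path[OF cfg])
  have K: "K \<subseteq> P" "card K = 3" using adm unfolding admissible_triple_def by auto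
  have card: "4 < card P" unfolding P using pos by simp
  have inter: "P \<inter> edges1 = {(a', 1, 0), (b, 1, 1)}" "P \<inter> edges2 = {(0, a, 0), (1, b', 1)}" "P \<inter> edges3 = {(1, 0, c), (0, 0, c')}"
    unfolding P edges1_def edges2_def edges3_def using pos by auto
  have E: "\<not> P \<subseteq> E \<and> K \<noteq> P \<inter> E" if "E \<in> {edges1, edges2, edges3}" for E
  proof -
    have "card (P \<inter> E) \<le> 2" using that inter pos by auto
    then show ?thesis using card K(2) by (auto simp: Int_absorb2)
  qed
  note skew = admissible_skew[OF adm card E]
  have adj: "\<not> ((0, a, 0) \<in> K \<and> (a', 1, 0) \<in> K)"
    "\<not> ((a', 1, 0) \<in> K \<and> (b, 1, 1) \<in> K)"
    "\<not> ((b, 1, 1) \<in> K \<and> (1, b', 1) \<in> K)"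
    "\<not> ((1, b', 1) \<in> K \<and> (1, 0, c) \<in> K)"
    "\<not> ((1, 0, c) \<in> K \<and> (0, 0, c') \<in> K)"
    "\<not> ((0, 0, c') \<in> K \<and> (0, a, 0) \<in> K)"
    by (rule skew; use pos in simp)+
  have cases: "K = {(0, a, 0), (b, 1, 1), (1, 0, c)} \<or> K = {(a', 1, 0), (1, b', 1), (0, 0, c')}"
    by (rule card3_cycle6[OF _ _ K(2) adj(1) adj(2) adj(3) adj(4) adj(5) adj(6)])
      (use K(1) P pos in simp_all)
  show "centroid_bicoercive path_pat K" using cases
  proof
    assume K: "K = {(0, a, 0), (b, 1, 1), (1, 0, c)}"
    show ?thesis unfolding K
    proof (rule centroid_bicoercive3)
      fix n1 n2 n3 d
      assume n: "n1\<^sup>2 + n2\<^sup>2 + n3\<^sup>2 = 1" "n1 * 0 + n2 * a + n3 * 0 = d" "n1 * b + n2 * 1 + n3 * 1 = d"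
        "n1 * 1 + n2 * 0 + n3 * c = d"
      show "bicoercive path_pat ((0 + (b + 1)) / 3) ((a + (1 + 0)) / 3) ((0 + (1 + c)) / 3) n1 n2 n3 d"
        using bicoercive_path[OF n(1), of a b c d] pos n(2-4) by (simp add: add.commute)
    qed auto
  next
    assume K: "K = {(a', 1, 0), (1, b', 1), (0, 0, c')}"
    text \<open>Walking the path backwards is the isometry \<open>(x, y, z) \<mapsto> (1 - z, 1 - y, 1 - x)\<close>.\<close>
    show ?thesis unfolding K
    proof (rule centroid_bicoercive3)
      fix n1 n2 n3 d
      assume n: "n1\<^sup>2 + n2\<^sup>2 + n3\<^sup>2 = 1" "n1 * a' + n2 * 1 + n3 * 0 = d" "n1 * 1 + n2 * b' + n3 * 1 = d"
        "n1 * 0 + n2 * 0 + n3 * c' = d"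
      define D where "D = d - n1 - n2 - n3"
      have n': "(- n3)\<^sup>2 + (- n2)\<^sup>2 + (- n1)\<^sup>2 = 1" using n(1) by simp
      have e: "- n2 * (1 - b') = D" "- n3 * (1 - c') + - n2 + - n1 = D" "- n3 + - n1 * (1 - a') = D"
        using n(2-4) unfolding D_def by (simp_all add: algebra_simps)
      have "bicoercive path_pat ((1 + (1 - c')) / 3) ((1 + (1 - b')) / 3) ((1 + (1 - a')) / 3) (- n3) (- n2) (- n1) D"
        by (rule bicoercive_path[OF n']) (use pos e in auto)
      moreover have "(\<lambda>i j k. path_pat (\<not> k) (\<not> j) (\<not> i)) = path_pat" by (auto simp: path_pat_def fun_eq_iff)
      moreover have "(1 + (1 - c')) / 3 = 1 - (0 + (1 + c')) / 3" "(1 + (1 - b')) / 3 = 1 - (1 + (b' + 0)) / 3"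
        "(1 + (1 - a')) / 3 = 1 - (a' + (1 + 0)) / 3" by (simp_all add: field_simps)
      ultimately show "bicoercive path_pat ((a' + (1 + 0)) / 3) ((1 + (b' + 0)) / 3) ((0 + (1 + c')) / 3) n1 n2 n3 d"
        using bicoercive_reverse[of path_pat "(0 + (1 + c')) / 3" "(1 + (b' + 0)) / 3" "(a' + (1 + 0)) / 3" n3 n2 n1 d]
        unfolding D_def by metis
    qed auto
  qed
qed

text \<open>Vacuous: the cut points surround two opposite vertices, three each, and no admissible
  triple can be chosen among them.\<close>

lemma stable_antipodal: "stable antipodal_pat"
  unfolding stable_def
proof (intro allI impI)
  fix P K assume cfg: "cut_config P antipodal_pat" and adm: "admissible_triple P K"
  obtain a b c a' b' c' where pos: "0 < a" "a < 1" "0 < b" "b < 1" "0 < c" "c < 1" "0 < a'" "a' < 1" "0 < b'" "b' < 1" "0 < c'" "c' < 1"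
    and P: "P = {(a, 0, 0), (0, b, 0), (0, 0, c), (a', 1, 1), (1, b', 1), (1, 1, c')}" by (rule cut_points_antipodal[OF cfg])
  have K: "K \<subseteq> P" "card K = 3" using adm unfolding admissible_triple_def by auto
  have card: "4 < card P" unfolding P using pos by simp
  have inter: "P \<inter> edges1 = {(a, 0, 0), (a', 1, 1)}" "P \<inter> edges2 = {(0, b, 0), (1, b', 1)}" "P \<inter> edges3 = {(0, 0, c), (1, 1, c')}"
    unfolding P edges1_def edges2_def edges3_def using pos by auto
  have E: "\<not> P \<subseteq> E \<and> K \<noteq> P \<inter> E" if "E \<in> {edges1, edges2, edges3}" for E
  proof -
    have "card (P \<inter> E) \<le> 2" using that inter pos by auto
    then show ?thesis using card K(2) by (auto simp: Int_absorb2)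
  qed
  note skew = admissible_skew[OF adm card E]
  have adj: "\<not> ((a, 0, 0) \<in> K \<and> (0, b, 0) \<in> K)"
    "\<not> ((0, b, 0) \<in> K \<and> (0, 0, c) \<in> K)"
    "\<not> ((0, 0, c) \<in> K \<and> (a, 0, 0) \<in> K)"
    "\<not> ((a', 1, 1) \<in> K \<and> (1, b', 1) \<in> K)"
    "\<not> ((1, b', 1) \<in> K \<and> (1, 1, c') \<in> K)"
    "\<not> ((1, 1, c') \<in> K \<and> (a', 1, 1) \<in> K)"
    by (rule skew; use pos in simp)+
  have False
    by (rule card3_triangles[OF _ _ K(2) adj(1) adj(2) adj(3) adj(4) adj(5) adj(6)])
      (use K(1) P pos in simp_all)
  then show "centroid_bicoercive antipodal_pat K" ..
qed

text \<open>Arguing by contradiction turns the checkerboard lemmas, whose conclusion is stability,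
  into the exclusions that \<open>stable8_if_representatives\<close> expects.\<close>

lemma all_stable: "stable s"
proof -
  have reps: "(\<lambda>i j k. False) = pat8 False False False False False False False False"
    "corner_pat = pat8 True False False False False False False False"
    "edge_pat = pat8 True True False False False False False False"
    "ell_pat = pat8 True False True False True False False False"
    "face_pat = pat8 True False True False True False True False"
    "tripod_pat = pat8 True True True False True False False False"
    "path_pat = pat8 True False False False True False True True"
    "antipodal_pat = pat8 True False False False False False False True"
    by (auto simp: fun_eq_iff pat8_def corner_pat_def edge_pat_def ell_pat_def face_pat_def tripod_pat_def path_pat_def antipodal_pat_def)
  note stables = stable_const[unfolded reps] stable_corner[unfolded reps] stable_edge[unfolded reps] stable_ell[unfolded reps]
    stable_face[unfolded reps] stable_tripod[unfolded reps] stable_path[unfolded reps] stable_antipodal[unfolded reps]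
  show ?thesis
  proof (rule ccontr)
    assume ns: "\<not> stable s"
    note checker = stable_checkerboard3[of s False] stable_checkerboard3[of s True] stable_checkerboard2[of s False]
      stable_checkerboard2[of s True] stable_checkerboard1[of s False] stable_checkerboard1[of s True]
    have "stable s"
      by (subst pat8_eq, rule stable8_if_representatives) (use ns checker stables in blast)+
    with ns show False by blast
  qed
qed

section \<open>Balls tangent to a surface of positive reach\<close>

text \<open>The data over which \<open>C2_surface\<close> and \<open>unit_normal\<close> quantify,
  named so that one choice can be carried through an argument.\<close>

definition chart :: "pt set \<Rightarrow> pt \<Rightarrow> pt set \<Rightarrow> (pt \<Rightarrow> real) \<Rightarrow> (pt \<Rightarrow> pt) \<Rightarrow> bool" where
  "chart \<Gamma> x U g G \<longleftrightarrow> open U \<and> x \<in> U \<and> C2_on U g G \<and> (\<forall>y\<in>U. G y \<noteq> 0) \<and> \<Gamma> \<inter> U = {y\<in>U. g y = 0}"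

lemma chart_derivative: "chart \<Gamma> x U g G \<Longrightarrow> y \<in> U \<Longrightarrow> (g has_derivative (\<lambda>v. G y \<bullet> v)) (at y)"
  unfolding chart_def C2_on_def by blast

lemma chart_zero_iff: "chart \<Gamma> x U g G \<Longrightarrow> y \<in> U \<Longrightarrow> y \<in> \<Gamma> \<longleftrightarrow> g y = 0"
  unfolding chart_def by blast

lemma gradient_expansion:
  fixes f :: "'a::real_inner \<Rightarrow> real"
  assumes "(f has_derivative (\<lambda>v. w \<bullet> v)) (at x)" "0 < \<delta>"
  shows "\<exists>r>0. \<forall>u. norm u < r \<longrightarrow> \<bar>f (x + u) - f x - w \<bullet> u\<bar> \<le> \<delta> * norm u"
proof -
  obtain r where r: "0 < r" "\<And>y. norm (y - x) < r \<Longrightarrow> norm (f y - f x - w \<bullet> (y - x)) \<le> \<delta> * norm (y - x)"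
    using assms unfolding has_derivative_at_alt by blast
  show ?thesis using r(1) r(2)[of "x + u" for u] by (intro exI[of _ r]) simp
qed

text \<open>Every direction in the kernel of the gradient is approximately realised by points of the zero set:
  correcting the direction by a small multiple of the gradient changes the sign of \<open>g\<close>.\<close>
lemma zero_in_direction:
  fixes g :: "'a::real_inner \<Rightarrow> real"
  assumes der: "\<And>y. y \<in> U \<Longrightarrow> (g has_derivative (\<lambda>v. G y \<bullet> v)) (at y)" and U: "open U" "x \<in> U"
    and g: "g x = 0" "G x \<noteq> 0" and v: "v \<bullet> G x = 0" and pos: "0 < \<eta>" "0 < \<epsilon>"
  obtains t \<sigma> where "0 < t" "t < \<epsilon>" "\<bar>\<sigma>\<bar> \<le> \<eta>" "x + t *\<^sub>R (v + \<sigma> *\<^sub>R G x) \<in> U" "g (x + t *\<^sub>R (v + \<sigma> *\<^sub>R G x)) = 0"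
proof -
  define N where "N = norm v + \<eta> * norm (G x) + 1"
  have N: "0 < N" unfolding N_def using pos by (simp add: add_nonneg_pos)
  \<comment> \<open>Makes the error of the linear expansion at most half the value
    \<open>t * \<eta> * (norm (G x))\<^sup>2\<close> that the linear part reaches at
    \<open>\<sigma> = \<eta>\<close>; the signs at the two ends then differ and the intermediate
    value theorem applies.\<close>
  define \<delta> where "\<delta> = \<eta> * (norm (G x))\<^sup>2 / (2 * N)"
  have \<delta>: "0 < \<delta>" unfolding \<delta>_def using N pos g by simp
  obtain r1 where r1: "0 < r1" "\<And>u. norm u < r1 \<Longrightarrow> \<bar>g (x + u) - g x - G x \<bullet> u\<bar> \<le> \<delta> * norm u"
    using gradient_expansion[OF der[OF U(2)] \<delta>] by blast
  obtain r2 where r2: "0 < r2" "ball x r2 \<subseteq> U" using U open_contains_ball by blast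
  define r where "r = min \<epsilon> (min r1 r2 / N)"
  define t where "t = r / 2"
  have "0 < r" unfolding r_def using pos r1 r2 N by simp
  then have t: "0 < t" "t < r" unfolding t_def by auto
  have "t < min r1 r2 / N" using t unfolding r_def by simp
  then have tN: "t * N < r1" "t * N < r2" using N by (simp_all add: field_simps)
  have norm: "norm (t *\<^sub>R (v + \<sigma> *\<^sub>R G x)) \<le> t * N" if "\<bar>\<sigma>\<bar> \<le> \<eta>" for \<sigma>
  proof -
    have "norm (v + \<sigma> *\<^sub>R G x) \<le> norm v + \<bar>\<sigma>\<bar> * norm (G x)" by (metis norm_scaleR norm_triangle_ineq)
    also have "\<dots> \<le> N" unfolding N_def using mult_right_mono[OF that, of "norm (G x)"] by simp
    finally show ?thesis using t by simp
  qed
  have inU: "x + t *\<^sub>R (v + \<sigma> *\<^sub>R G x) \<in> U" if "\<bar>\<sigma>\<bar> \<le> \<eta>" for \<sigma>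
    using norm[OF that] tN r2 by (auto simp: dist_norm subset_iff)
  have approx: "\<bar>g (x + t *\<^sub>R (v + \<sigma> *\<^sub>R G x)) - t * \<sigma> * (norm (G x))\<^sup>2\<bar> \<le> t * \<eta> * (norm (G x))\<^sup>2 / 2"
    if "\<bar>\<sigma>\<bar> \<le> \<eta>" for \<sigma>
  proof -
    have "G x \<bullet> (t *\<^sub>R (v + \<sigma> *\<^sub>R G x)) = t * \<sigma> * (norm (G x))\<^sup>2"
      using v by (simp add: inner_add_right inner_commute power2_norm_eq_inner)
    moreover have "\<delta> * norm (t *\<^sub>R (v + \<sigma> *\<^sub>R G x)) \<le> \<delta> * (t * N)"
      using norm[OF that] \<delta> by (intro mult_left_mono) auto
    moreover have "\<delta> * (t * N) = t * \<eta> * (norm (G x))\<^sup>2 / 2" unfolding \<delta>_def using N by (simp add: field_simps)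
    moreover have "\<bar>g (x + t *\<^sub>R (v + \<sigma> *\<^sub>R G x)) - g x - G x \<bullet> (t *\<^sub>R (v + \<sigma> *\<^sub>R G x))\<bar>
        \<le> \<delta> * norm (t *\<^sub>R (v + \<sigma> *\<^sub>R G x))"
      by (rule r1(2)) (use norm[OF that] tN in linarith)
    ultimately show ?thesis using g(1) by linarith
  qed
  let ?f = "\<lambda>\<sigma>. g (x + t *\<^sub>R (v + \<sigma> *\<^sub>R G x))"
  have p: "0 < t * \<eta> * (norm (G x))\<^sup>2" using t pos g by simp
  have "continuous_on {-\<eta>..\<eta>} ?f"
  proof (rule continuous_on_compose2[of U g])
    show "continuous_on U g" using has_derivative_continuous[OF der] by (simp add: continuous_at_imp_continuous_on)
    show "continuous_on {-\<eta>..\<eta>} (\<lambda>\<sigma>. x + t *\<^sub>R (v + \<sigma> *\<^sub>R G x))" by (intro continuous_intros)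
  qed (use inU in auto)
  moreover have "?f (-\<eta>) \<le> 0" "0 \<le> ?f \<eta>"
  proof -
    have "\<bar>?f (-\<eta>) + t * \<eta> * (norm (G x))\<^sup>2\<bar> \<le> t * \<eta> * (norm (G x))\<^sup>2 / 2"
      "\<bar>?f \<eta> - t * \<eta> * (norm (G x))\<^sup>2\<bar> \<le> t * \<eta> * (norm (G x))\<^sup>2 / 2"
      using approx[of "-\<eta>"] approx[of \<eta>] pos by simp_all
    then show "?f (-\<eta>) \<le> 0" "0 \<le> ?f \<eta>" using p by linarith+
  qed
  ultimately obtain \<sigma> where \<sigma>: "-\<eta> \<le> \<sigma>" "\<sigma> \<le> \<eta>" "?f \<sigma> = 0"
    using IVT'[of ?f "-\<eta>" 0 \<eta>] pos by auto
  then have "\<bar>\<sigma>\<bar> \<le> \<eta>" by (simp add: abs_le_iff)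
  then show thesis using that[OF t(1) _ _ inU \<sigma>(3)] t(2) unfolding r_def by simp
qed

text \<open>A tangential direction of descent would be realised, up to a small multiple of the
  gradient, by points of the surface close to \<open>x\<close> with a smaller value of
  \<open>f\<close>.\<close>

lemma chart_minimum_direction:
  assumes c: "chart \<Gamma> x U g G" and x: "x \<in> \<Gamma>" and v: "v \<bullet> G x = 0"
    and f: "(f has_derivative (\<lambda>u. w \<bullet> u)) (at x)" and r: "0 < r"
    and min: "\<And>y. y \<in> \<Gamma> \<Longrightarrow> dist x y < r \<Longrightarrow> f x \<le> f y"
  shows "0 \<le> w \<bullet> v"
proof (rule ccontr)
  assume "\<not> 0 \<le> w \<bullet> v"
  define c0 where "c0 = - (w \<bullet> v)"
  have c0: "0 < c0" unfolding c0_def using \<open>\<not> 0 \<le> w \<bullet> v\<close> by simp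
  have Gx: "G x \<noteq> 0" "open U" "x \<in> U" using c unfolding chart_def by auto
  \<comment> \<open>The choices of \<open>\<eta>\<close> and \<open>\<delta>\<close> let the
    correction along \<open>G x\<close> and the expansion error each consume at most a quarter of
    the descent rate \<open>c0\<close>.\<close>
  define \<eta> where "\<eta> = c0 / (4 * (norm w * norm (G x) + 1))"
  have \<eta>: "0 < \<eta>" unfolding \<eta>_def using c0 by (simp add: add_nonneg_pos)
  define N where "N = norm v + \<eta> * norm (G x) + 1"
  have N: "0 < N" unfolding N_def using \<eta> by (simp add: add_nonneg_pos)
  define \<delta> where "\<delta> = c0 / (4 * N)"
  have \<delta>: "0 < \<delta>" unfolding \<delta>_def using c0 N by simp
  obtain r1 where r1: "0 < r1" "\<And>u. norm u < r1 \<Longrightarrow> \<bar>f (x + u) - f x - w \<bullet> u\<bar> \<le> \<delta> * norm u"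
    using gradient_expansion[OF f \<delta>] by blast
  have "g x = 0" using chart_zero_iff[OF c Gx(3)] x by simp
  then obtain t \<sigma> where t: "0 < t" "t < min r r1 / N" "\<bar>\<sigma>\<bar> \<le> \<eta>" "x + t *\<^sub>R (v + \<sigma> *\<^sub>R G x) \<in> U" "g (x + t *\<^sub>R (v + \<sigma> *\<^sub>R G x)) = 0"
    using zero_in_direction[OF chart_derivative[OF c] Gx(2,3) _ Gx(1) v \<eta>, of "min r r1 / N"] r r1 N by auto
  define u where "u = t *\<^sub>R (v + \<sigma> *\<^sub>R G x)"
  have "norm (v + \<sigma> *\<^sub>R G x) \<le> norm v + \<bar>\<sigma>\<bar> * norm (G x)" by (metis norm_scaleR norm_triangle_ineq)
  also have "\<dots> \<le> N" unfolding N_def using mult_right_mono[OF t(3), of "norm (G x)"] by simp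
  finally have u: "norm u \<le> t * N" unfolding u_def using t(1) by simp
  have "t * N < min r r1" using t(2) N by (simp add: field_simps)
  with u have ur: "norm u < r" "norm u < r1" by auto
  have "x + u \<in> \<Gamma>" using chart_zero_iff[OF c t(4)] t(5) unfolding u_def by simp
  then have "f x \<le> f (x + u)" using min[of "x + u"] ur by (simp add: dist_norm)
  then have "- (w \<bullet> u) \<le> \<delta> * norm u" using r1(2)[OF ur(2)] by linarith
  also have "\<dots> \<le> \<delta> * (t * N)" using u \<delta> by (intro mult_left_mono) auto
  also have "\<dots> = t * (c0 / 4)" unfolding \<delta>_def using N by (simp add: field_simps)
  finally have "- (w \<bullet> u) \<le> t * (c0 / 4)" .
  moreover have "- (w \<bullet> u) = t * (c0 - \<sigma> * (w \<bullet> G x))" unfolding u_def c0_def by (simp add: inner_add_right algebra_simps)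
  ultimately have "c0 - \<sigma> * (w \<bullet> G x) \<le> c0 / 4" using t(1) by (simp only: mult_le_cancel_left_pos)
  moreover have "\<sigma> * (w \<bullet> G x) \<le> c0 / 4"
  proof -
    have "\<sigma> * (w \<bullet> G x) \<le> \<bar>\<sigma>\<bar> * \<bar>w \<bullet> G x\<bar>" by (metis abs_ge_self abs_mult)
    also have "\<dots> \<le> \<eta> * (norm w * norm (G x) + 1)"
      using t(3) Cauchy_Schwarz_ineq2[of w "G x"] by (intro mult_mono) auto
    also have "\<dots> = c0 / 4" unfolding \<eta>_def using add_nonneg_pos[of "norm w * norm (G x)" 1] by (simp add: field_simps)
    finally show ?thesis .
  qed
  ultimately show False using c0 by linarith
qed

text \<open>The Lagrange multiplier rule: the part of \<open>w\<close> orthogonal to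
  \<open>G x\<close> is a tangential direction, and \<open>chart_minimum_direction\<close> for its
  negative shows that it vanishes.\<close>

lemma chart_minimum_parallel:
  assumes c: "chart \<Gamma> x U g G" and x: "x \<in> \<Gamma>"
    and f: "(f has_derivative (\<lambda>u. w \<bullet> u)) (at x)" and r: "0 < r"
    and min: "\<And>y. y \<in> \<Gamma> \<Longrightarrow> dist x y < r \<Longrightarrow> f x \<le> f y"
  shows "\<exists>k. w = k *\<^sub>R G x"
proof -
  have Gx: "G x \<noteq> 0" using c unfolding chart_def by auto
  define k where "k = (w \<bullet> G x) / (G x \<bullet> G x)"
  define v where "v = w - k *\<^sub>R G x"
  have v: "v \<bullet> G x = 0" unfolding v_def k_def using Gx by (simp add: inner_diff_left)
  have "0 \<le> w \<bullet> (- v)" by (rule chart_minimum_direction[OF c x _ f r min]) (use v in auto)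
  moreover have "w \<bullet> v = v \<bullet> v" using v unfolding v_def by (simp add: inner_diff_left inner_diff_right inner_commute)
  ultimately have "v = 0" by (simp add: inner_ge_zero inner_eq_zero_iff) (metis inner_eq_zero_iff inner_ge_zero order_antisym)
  then show ?thesis unfolding v_def by auto
qed

text \<open>The defining function of the second chart vanishes on the surface, so \<open>x\<close>
  is a constrained minimum of it in the first chart. Hence the normal line does not depend on the
  chart.\<close>

lemma charts_parallel:
  assumes c: "chart \<Gamma> x U g G" and c': "chart \<Gamma> x U' g' G'" and x: "x \<in> \<Gamma>"
  shows "\<exists>k. G' x = k *\<^sub>R G x"
proof -
  have U': "open U'" "x \<in> U'" using c' unfolding chart_def by auto
  then obtain r where r: "0 < r" "ball x r \<subseteq> U'" using open_contains_ball by blast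
  show ?thesis
  proof (rule chart_minimum_parallel[OF c x chart_derivative[OF c' U'(2)] r(1)])
    fix y assume y: "y \<in> \<Gamma>" "dist x y < r"
    then have "y \<in> U'" using r by auto
    then show "g' x \<le> g' y" using chart_zero_iff[OF c'] y x U' by simp
  qed
qed

lemma unit_normal_iff: "unit_normal \<Gamma> x n \<longleftrightarrow> x \<in> \<Gamma> \<and> norm n = 1 \<and> (\<exists>U g G k. chart \<Gamma> x U g G \<and> n = k *\<^sub>R G x)"
  unfolding unit_normal_def chart_def by blast

lemma unit_normal_chart:
  assumes "unit_normal \<Gamma> x n" "chart \<Gamma> x U g G"
  obtains k where "n = k *\<^sub>R G x" "\<bar>k\<bar> * norm (G x) = 1"
proof -
  obtain U' g' G' k where c: "chart \<Gamma> x U' g' G'" "n = k *\<^sub>R G' x" and x: "x \<in> \<Gamma>" "norm n = 1"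
    using assms(1) unfolding unit_normal_iff by blast
  obtain k' where "G' x = k' *\<^sub>R G x" using charts_parallel[OF assms(2) c(1) x(1)] by blast
  then have "n = (k * k') *\<^sub>R G x" using c(2) by simp
  then show thesis using that[of "k * k'"] x(2) by simp
qed

lemma unit_normal_of_chart:
  assumes "chart \<Gamma> x U g G" "x \<in> \<Gamma>"
  shows "unit_normal \<Gamma> x ((1 / norm (G x)) *\<^sub>R G x)"
proof -
  have "G x \<noteq> 0" using assms(1) unfolding chart_def by blast
  then show ?thesis using assms unfolding unit_normal_iff by auto
qed

lemma surface_chart: "closed_C2_surface \<Gamma> \<Longrightarrow> x \<in> \<Gamma> \<Longrightarrow> \<exists>U g G. chart \<Gamma> x U g G"
  unfolding closed_C2_surface_def C2_surface_def chart_def by blast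

section \<open>Curvature bound and positivity of the reach\<close>

text \<open>For nearby \<open>y\<close> this is a first-order Taylor expansion with a gradient that
  is Lipschitz by the bound on second derivatives. For distant \<open>y\<close> the length of
  \<open>y - x\<close> is bounded below, so the linear Cauchy-Schwarz bound is already
  quadratic.\<close>

lemma local_quadratic_bound:
  assumes S: "closed_C2_surface \<Gamma>" and x0: "x0 \<in> \<Gamma>"
  shows "\<exists>\<epsilon>>0. \<exists>\<kappa>. \<forall>x y n. unit_normal \<Gamma> x n \<longrightarrow> dist x0 x < \<epsilon> \<longrightarrow> y \<in> \<Gamma> \<longrightarrow> \<bar>(y - x) \<bullet> n\<bar> \<le> \<kappa> * (norm (y - x))\<^sup>2"
proof -
  obtain U g G where c: "chart \<Gamma> x0 U g G" using surface_chart[OF S x0] by blast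
  then have U: "open U" "x0 \<in> U" "\<And>y. y \<in> U \<Longrightarrow> G y \<noteq> 0" unfolding chart_def by blast+
  obtain H :: "pt \<Rightarrow> real^3^3" where H: "\<And>y. y \<in> U \<Longrightarrow> (G has_derivative (\<lambda>v. H y *v v)) (at y)" "continuous_on U H"
    using c unfolding chart_def C2_on_def by blast
  obtain r where r: "0 < r" "cball x0 r \<subseteq> U" using U open_contains_cball by blast
  have contG: "continuous_on (cball x0 r) G"
  proof (rule continuous_at_imp_continuous_on, rule ballI)
    fix y assume "y \<in> cball x0 r"
    then show "isCont G y" using has_derivative_continuous[OF H(1)] r(2) by blast
  qed
  have ne: "cball x0 r \<noteq> {}" using r by auto
  from continuous_attains_inf[OF compact_cball ne continuous_on_norm[OF contG]]
  obtain y0 where y0: "y0 \<in> cball x0 r" "\<forall>y\<in>cball x0 r. norm (G y0) \<le> norm (G y)" by (elim bexE)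
  \<comment> \<open>A lower bound for the gradient, hence an upper bound for the factor that
    normalises it.\<close>
  define \<mu> where "\<mu> = norm (G y0)"
  have \<mu>: "0 < \<mu>" unfolding \<mu>_def using U(3) y0(1) r(2) by auto
  have "bounded (H ` cball x0 r)"
    by (intro compact_imp_bounded compact_continuous_image continuous_on_subset[OF H(2) r(2)] compact_cball)
  then obtain B0 where B0: "\<And>y. y \<in> cball x0 r \<Longrightarrow> norm (H y) \<le> B0" unfolding bounded_iff by blast
  define B where "B = real CARD(3) * real CARD(3) * B0"
  have onorm: "onorm (\<lambda>v. H y *v v) \<le> B" if "y \<in> cball x0 r" for y
  proof -
    have "\<bar>H y $ i $ j\<bar> \<le> B0" for i j
      using component_le_norm_cart[of "H y $ i" j] Finite_Cartesian_Product.norm_nth_le[of "H y" i] B0[OF that] by linarith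
    then show ?thesis unfolding B_def by (rule onorm_le_matrix_component)
  qed
  have "0 \<le> B" using onorm[of x0] onorm_pos_le[of "\<lambda>v. H x0 *v v"] r by (meson centre_in_cball less_eq_real_def matrix_vector_mul_bounded_linear order_trans)
  have lip: "norm (G y - G x) \<le> B * norm (y - x)" if "x \<in> cball x0 r" "y \<in> cball x0 r" for x y
    by (rule differentiable_bound[OF convex_cball, where f' = "\<lambda>z v. H z *v v"])
      (use that onorm r(2) in \<open>auto intro!: has_derivative_at_withinI H(1) simp: subset_iff\<close>)
  have taylor: "\<bar>g y - g x - G x \<bullet> (y - x)\<bar> \<le> B * (norm (y - x))\<^sup>2" if xy: "x \<in> cball x0 r" "y \<in> cball x0 r" for x y
  proof -
    have seg: "closed_segment x y \<subseteq> cball x0 r" using xy by (simp add: closed_segment_subset)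
    have "norm ((g y - G x \<bullet> y) - (g x - G x \<bullet> x)) \<le> B * norm (y - x) * norm (y - x)"
    proof (rule differentiable_bound[where f' = "\<lambda>z v. (G z - G x) \<bullet> v" and S = "closed_segment x y"])
      fix z assume z: "z \<in> closed_segment x y"
      then have zU: "z \<in> U" "z \<in> cball x0 r" using seg r(2) by auto
      have "((\<lambda>z. g z - G x \<bullet> z) has_derivative (\<lambda>v. G z \<bullet> v - G x \<bullet> v)) (at z)"
        by (intro has_derivative_diff chart_derivative[OF c zU(1)] has_derivative_inner_right has_derivative_ident)
      then show "((\<lambda>z. g z - G x \<bullet> z) has_derivative (\<lambda>v. (G z - G x) \<bullet> v)) (at z within closed_segment x y)"
        by (auto simp: inner_diff_left intro: has_derivative_at_withinI)
      have "norm (z - x) \<le> norm (y - x)" using segment_bound1[OF z] by (simp add: norm_minus_commute)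
      then have "norm (G z - G x) \<le> B * norm (y - x)"
        using lip[OF xy(1) zU(2)] mult_left_mono[OF _ \<open>0 \<le> B\<close>] order_trans by blast
      moreover have "onorm (\<lambda>v. (G z - G x) \<bullet> v) \<le> norm (G z - G x)"
        by (rule onorm_le) (simp add: Cauchy_Schwarz_ineq2)
      ultimately show "onorm (\<lambda>v. (G z - G x) \<bullet> v) \<le> B * norm (y - x)" by linarith
    qed auto
    then show ?thesis by (simp add: inner_diff_right power2_eq_square algebra_simps)
  qed
  have "\<bar>(y - x) \<bullet> n\<bar> \<le> max (B / \<mu>) (2 / r) * (norm (y - x))\<^sup>2"
    if n: "unit_normal \<Gamma> x n" and x: "dist x0 x < r / 2" and y: "y \<in> \<Gamma>" for x y n
  proof (cases "dist x0 y \<le> r")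
    case True
    have xy: "x \<in> cball x0 r" "y \<in> cball x0 r" using True x r by auto
    then have xU: "x \<in> U" "y \<in> U" using r by auto
    have "x \<in> \<Gamma>" using n unfolding unit_normal_def by blast
    then have "g x = 0" "g y = 0" using chart_zero_iff[OF c] xU y by auto
    then have t: "\<bar>G x \<bullet> (y - x)\<bar> \<le> B * (norm (y - x))\<^sup>2" using taylor[OF xy] by simp
    have c': "chart \<Gamma> x U g G" using c xU unfolding chart_def by blast
    obtain k where k: "n = k *\<^sub>R G x" "\<bar>k\<bar> * norm (G x) = 1" by (rule unit_normal_chart[OF n c'])
    have "\<mu> \<le> norm (G x)" using y0(2) xy(1) unfolding \<mu>_def by blast
    then have "\<bar>k\<bar> * \<mu> \<le> 1" using k(2) mult_left_mono[of \<mu> "norm (G x)" "\<bar>k\<bar>"] by simp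
    then have k1: "\<bar>k\<bar> \<le> 1 / \<mu>" using \<mu> by (simp add: field_simps)
    have "\<bar>(y - x) \<bullet> n\<bar> = \<bar>k\<bar> * \<bar>G x \<bullet> (y - x)\<bar>" unfolding k(1) by (simp add: abs_mult inner_commute)
    also have "\<dots> \<le> (1 / \<mu>) * (B * (norm (y - x))\<^sup>2)" by (intro mult_mono k1 t) (use \<mu> in auto)
    also have "\<dots> = (B / \<mu>) * (norm (y - x))\<^sup>2" by simp
    also have "\<dots> \<le> max (B / \<mu>) (2 / r) * (norm (y - x))\<^sup>2" by (intro mult_right_mono) auto
    finally show ?thesis .
  next
    case False
    have "dist x0 y \<le> dist x0 x + dist x y" by (rule dist_triangle)
    then have "r / 2 \<le> norm (y - x)" using False x by (simp add: dist_norm norm_minus_commute)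
    then have le: "1 \<le> (2 / r) * norm (y - x)" using r by (simp add: field_simps)
    have "norm n = 1" using n unfolding unit_normal_def by blast
    then have "\<bar>(y - x) \<bullet> n\<bar> \<le> norm (y - x)" using Cauchy_Schwarz_ineq2[of "y - x" n] by simp
    also have "\<dots> \<le> (2 / r) * (norm (y - x))\<^sup>2"
      using mult_right_mono[OF le, of "norm (y - x)"] by (simp add: power2_eq_square)
    also have "\<dots> \<le> max (B / \<mu>) (2 / r) * (norm (y - x))\<^sup>2" by (intro mult_right_mono) auto
    finally show ?thesis .
  qed
  then show ?thesis using r(1) by (intro exI[of _ "r / 2"] conjI exI[of _ "max (B / \<mu>) (2 / r)"]) auto
qed

text \<open>Compactness yields finitely many local constants; their sum serves everywhere, and the
  leading 1 keeps it positive.\<close>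

lemma quadratic_bound:
  assumes S: "closed_C2_surface \<Gamma>"
  obtains \<kappa> where "0 < \<kappa>" "\<And>x y n. unit_normal \<Gamma> x n \<Longrightarrow> y \<in> \<Gamma> \<Longrightarrow> \<bar>(y - x) \<bullet> n\<bar> \<le> \<kappa> * (norm (y - x))\<^sup>2"
proof -
  obtain e k where e: "\<And>z. z \<in> \<Gamma> \<Longrightarrow> 0 < e z"
    and k: "\<And>z x y n. z \<in> \<Gamma> \<Longrightarrow> unit_normal \<Gamma> x n \<Longrightarrow> dist z x < e z \<Longrightarrow> y \<in> \<Gamma> \<Longrightarrow> \<bar>(y - x) \<bullet> n\<bar> \<le> k z * (norm (y - x))\<^sup>2"
    using local_quadratic_bound[OF S] by metis
  have comp: "compact \<Gamma>" using S unfolding closed_C2_surface_def by blast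
  obtain F where F: "F \<subseteq> \<Gamma>" "finite F" "\<Gamma> \<subseteq> (\<Union>z\<in>F. ball z (e z))"
    by (rule compactE_image[OF comp, of \<Gamma> "\<lambda>z. ball z (e z)"]) (use e in auto)
  define \<kappa> where "\<kappa> = 1 + (\<Sum>z\<in>F. \<bar>k z\<bar>)"
  have "0 < \<kappa>" unfolding \<kappa>_def by (simp add: add_pos_nonneg sum_nonneg)
  moreover have "\<bar>(y - x) \<bullet> n\<bar> \<le> \<kappa> * (norm (y - x))\<^sup>2" if n: "unit_normal \<Gamma> x n" and y: "y \<in> \<Gamma>" for x y n
  proof -
    have "x \<in> \<Gamma>" using n unfolding unit_normal_def by blast
    then obtain z where z: "z \<in> F" "dist z x < e z" using F(3) by auto
    then have "\<bar>(y - x) \<bullet> n\<bar> \<le> k z * (norm (y - x))\<^sup>2" using k[OF _ n _ y] F(1) by blast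
    also have "k z \<le> \<kappa>" using member_le_sum[OF z(1), of "\<lambda>z. \<bar>k z\<bar>"] F(2) unfolding \<kappa>_def by simp
    finally show ?thesis by (simp add: mult_right_mono)
  qed
  ultimately show thesis by (rule that)
qed

text \<open>The condition whose supremum is \<open>reach \<Gamma>\<close>. Working with one such
  radius avoids asking whether the supremum is attained.\<close>

definition reach_radius :: "pt set \<Rightarrow> real \<Rightarrow> bool" where
  "reach_radius \<Gamma> r \<longleftrightarrow> r > 0 \<and> (\<forall>x\<in>\<Gamma>. \<forall>y\<in>\<Gamma>. \<forall>n m. x \<noteq> y \<longrightarrow>
        unit_normal \<Gamma> x n \<longrightarrow> unit_normal \<Gamma> y m \<longrightarrow>
        normal_segment x n r \<inter> normal_segment y m r = {})"

text \<open>If normal segments with half-length \<open>1 / (4 * \<kappa>)\<close> met, comparing the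
  distances of the meeting point to the two feet would bound the squared length of the vector
  \<open>d\<close> between them by half of itself. The set in \<open>reach\<close> is thus nonempty,
  without which its supremum would carry no information.\<close>

lemma reach_radius_exists:
  assumes S: "closed_C2_surface \<Gamma>" shows "\<exists>r. reach_radius \<Gamma> r"
proof -
  obtain \<kappa> where \<kappa>: "0 < \<kappa>" "\<And>x y n. unit_normal \<Gamma> x n \<Longrightarrow> y \<in> \<Gamma> \<Longrightarrow> \<bar>(y - x) \<bullet> n\<bar> \<le> \<kappa> * (norm (y - x))\<^sup>2"
    using quadratic_bound[OF S] by metis
  \<comment> \<open>By symmetry \<open>x\<close> may be taken as the foot at least as far from the
    meeting point as \<open>y\<close>.\<close>
  have key: False if xy: "y \<in> \<Gamma>" "x \<noteq> y" "unit_normal \<Gamma> x n" "norm m = 1"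
    and ts: "\<bar>s\<bar> \<le> \<bar>t\<bar>" "\<bar>t\<bar> \<le> 1 / (4 * \<kappa>)" "x + t *\<^sub>R n = y + s *\<^sub>R m" for x y n m t s
  proof -
    have n: "norm n = 1" using xy unfolding unit_normal_def by blast
    define d where "d = y - x"
    have d: "0 < (norm d)\<^sup>2" unfolding d_def using xy by simp
    have "t *\<^sub>R n - d = s *\<^sub>R m" unfolding d_def using ts(3) by (simp add: algebra_simps)
    then have "(norm (t *\<^sub>R n - d))\<^sup>2 = s\<^sup>2" using xy(4) by simp
    moreover have "(norm (t *\<^sub>R n - d))\<^sup>2 = t\<^sup>2 - 2 * t * (d \<bullet> n) + (norm d)\<^sup>2"
    proof -
      have "(norm (t *\<^sub>R n - d))\<^sup>2 = t\<^sup>2 * (n \<bullet> n) - 2 * t * (d \<bullet> n) + d \<bullet> d"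
        unfolding power2_norm_eq_inner
        by (simp add: inner_diff_left inner_diff_right inner_commute[of n d] power2_eq_square algebra_simps)
      then show ?thesis using n by (simp add: norm_eq_1 power2_norm_eq_inner)
    qed
    moreover have "s\<^sup>2 \<le> t\<^sup>2" using ts(1) by (simp add: abs_le_square_iff)
    ultimately have "(norm d)\<^sup>2 \<le> 2 * t * (d \<bullet> n)" by linarith
    also have "\<dots> \<le> 2 * (\<bar>t\<bar> * \<bar>d \<bullet> n\<bar>)" by (metis abs_ge_self abs_mult mult.assoc mult_left_mono zero_le_numeral)
    also have "\<dots> \<le> 2 * (1 / (4 * \<kappa>) * (\<kappa> * (norm d)\<^sup>2))"
      using \<kappa>(2)[OF xy(3,1)] ts(2) \<kappa>(1) unfolding d_def[symmetric] by (intro mult_left_mono mult_mono) auto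
    also have "\<dots> = (norm d)\<^sup>2 / 2" using \<kappa>(1) by (simp add: field_simps)
    finally show False using d by simp
  qed
  have "normal_segment x n (1 / (4 * \<kappa>)) \<inter> normal_segment y m (1 / (4 * \<kappa>)) = {}"
    if xy: "x \<in> \<Gamma>" "y \<in> \<Gamma>" "x \<noteq> y" "unit_normal \<Gamma> x n" "unit_normal \<Gamma> y m" for x y n m
  proof (rule ccontr)
    assume "\<not> ?thesis"
    then obtain t s where ts: "\<bar>t\<bar> \<le> 1 / (4 * \<kappa>)" "\<bar>s\<bar> \<le> 1 / (4 * \<kappa>)" "x + t *\<^sub>R n = y + s *\<^sub>R m"
      unfolding normal_segment_def by blast
    have "norm n = 1" "norm m = 1" using xy unfolding unit_normal_def by auto
    then show False
      using key[OF xy(2,3,4), of m s t] key[OF xy(1) xy(3)[symmetric] xy(5), of n t s] ts by (cases "\<bar>s\<bar> \<le> \<bar>t\<bar>") auto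
  qed
  then show ?thesis unfolding reach_radius_def using \<kappa>(1) by (intro exI[of _ "1 / (4 * \<kappa>)"]) auto
qed

text \<open>If the admissible radii are unbounded, \<open>reach \<Gamma>\<close> is an unspecified
  real number, but radii beyond \<open>l\<close> exist all the same.\<close>

lemma reach_radius_greater:
  assumes "closed_C2_surface \<Gamma>" "l < reach \<Gamma>"
  obtains r where "reach_radius \<Gamma> r" "l < r"
proof -
  have reach: "reach \<Gamma> = Sup {r. reach_radius \<Gamma> r}" unfolding reach_def reach_radius_def ..
  show thesis
  proof (cases "bdd_above {r. reach_radius \<Gamma> r}")
    case True
    then show ?thesis using less_cSupD[of "{r. reach_radius \<Gamma> r}" l] reach_radius_exists[OF assms(1)] assms(2) that
      unfolding reach by auto
  next
    case False
    then show ?thesis using that unfolding bdd_above_def by (metis mem_Collect_eq not_le_imp_less)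
  qed
qed

section \<open>Tangent balls on the two sides of the surface\<close>

text \<open>By the multiplier rule, a surface point nearest to the centre has the centre on its
  normal line. If it were inside the ball, it would differ from \<open>x\<close>, and the two normal
  segments would meet in the centre.\<close>

lemma normal_ball_disjoint:
  assumes S: "closed_C2_surface \<Gamma>" and r: "reach_radius \<Gamma> r" and n: "unit_normal \<Gamma> x n"
  shows "ball (x + r *\<^sub>R n) r \<inter> \<Gamma> = {}"
proof (rule ccontr)
  assume "\<not> ?thesis"
  then obtain y where y: "y \<in> \<Gamma>" "dist (x + r *\<^sub>R n) y < r" by auto
  define c where "c = x + r *\<^sub>R n"
  have r0: "0 < r" using r unfolding reach_radius_def by blast
  have x: "x \<in> \<Gamma>" "norm n = 1" using n unfolding unit_normal_def by auto
  have comp: "compact \<Gamma>" using S unfolding closed_C2_surface_def by blast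
  obtain z where z: "z \<in> \<Gamma>" "\<And>w. w \<in> \<Gamma> \<Longrightarrow> dist c z \<le> dist c w"
    using distance_attains_inf[OF compact_imp_closed[OF comp], of c] x by blast
  have zr: "dist c z < r" using z(2)[OF y(1)] y(2) unfolding c_def by simp
  then have xz: "x \<noteq> z" using r0 x unfolding c_def dist_norm by auto
  obtain U g G where ch: "chart \<Gamma> z U g G" using surface_chart[OF S z(1)] by blast
  have "((\<lambda>w. (w - c) \<bullet> (w - c)) has_derivative (\<lambda>u. (2 *\<^sub>R (z - c)) \<bullet> u)) (at z)"
    by (auto intro!: derivative_eq_intros simp: inner_commute)
  then obtain k where k: "2 *\<^sub>R (z - c) = k *\<^sub>R G z"
  proof (rule exE[OF chart_minimum_parallel[OF ch z(1) _ zero_less_one]])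
    fix w assume "w \<in> \<Gamma>" "dist z w < 1"
    then have "(dist c z)\<^sup>2 \<le> (dist c w)\<^sup>2" using z(2) by (intro power_mono) auto
    then show "(z - c) \<bullet> (z - c) \<le> (w - c) \<bullet> (w - c)"
      by (metis dist_commute dist_norm power2_norm_eq_inner)
  qed auto
  define m where "m = (1 / norm (G z)) *\<^sub>R G z"
  have m: "unit_normal \<Gamma> z m" unfolding m_def by (rule unit_normal_of_chart[OF ch z(1)])
  have Gz: "G z \<noteq> 0" using ch unfolding chart_def by blast
  define t where "t = - (k * norm (G z) / 2)"
  have "z - c = (1/2) *\<^sub>R (2 *\<^sub>R (z - c))" by simp
  also have "\<dots> = (- t) *\<^sub>R m" unfolding k t_def m_def using Gz by simp
  finally have c: "c = z + t *\<^sub>R m" by (simp add: algebra_simps)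
  have "\<bar>t\<bar> = dist c z" using m unfolding c unit_normal_def by (simp add: dist_norm)
  then have "c \<in> normal_segment z m r" unfolding normal_segment_def using c zr by auto
  moreover have "c \<in> normal_segment x n r" unfolding normal_segment_def c_def using r0 by auto
  ultimately show False using r x(1) z(1) xz n m unfolding reach_radius_def by blast
qed

text \<open>Moving along the normal keeps the sign of \<open>g\<close>, so a point close to \<open>x\<close> can be joined to a tangent
  ball without meeting the surface.\<close>
lemma connect_to_normal_ball:
  assumes c: "chart \<Gamma> x U g G" and r: "0 < r" and \<tau>: "\<tau> = 1 \<or> \<tau> = -1"
  defines "n \<equiv> (\<tau> / norm (G x)) *\<^sub>R G x"
  shows "\<exists>\<epsilon>>0. \<forall>z. dist x z < \<epsilon> \<longrightarrow> 0 < \<tau> * g z \<longrightarrow>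
    (\<exists>C. connected C \<and> z \<in> C \<and> C \<inter> ball (x + r *\<^sub>R n) r \<noteq> {} \<and> C \<inter> \<Gamma> = {})"
proof -
  have U: "open U" "x \<in> U" "G x \<noteq> 0" using c unfolding chart_def by blast+
  have n1: "norm n = 1" unfolding n_def using U(3) \<tau> by auto
  have pos: "0 < \<tau> * (G x \<bullet> n)" unfolding n_def using U(3) \<tau> by (auto simp: zero_less_divide_iff)
  obtain H :: "pt \<Rightarrow> real^3^3" where H: "\<forall>y\<in>U. (G has_derivative (\<lambda>v. H y *v v)) (at y)"
    using c unfolding chart_def C2_on_def by blast
  then have "isCont G x" using has_derivative_continuous U(2) by blast
  then have "isCont (\<lambda>y. \<tau> * (G y \<bullet> n)) x" by (intro continuous_intros)
  then have "\<forall>\<^sub>F y in at x. 0 < \<tau> * (G y \<bullet> n)"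
    using pos unfolding isCont_def by (rule order_tendstoD(1))
  then obtain \<rho>1 where \<rho>1: "0 < \<rho>1" "\<And>y. y \<noteq> x \<Longrightarrow> dist y x < \<rho>1 \<Longrightarrow> 0 < \<tau> * (G y \<bullet> n)"
    unfolding eventually_at by auto
  have \<rho>1': "0 < \<tau> * (G y \<bullet> n)" if "dist x y < \<rho>1" for y
    using pos \<rho>1(2)[of y] that by (cases "y = x") (simp_all add: dist_commute)
  obtain \<rho>2 where \<rho>2: "0 < \<rho>2" "ball x \<rho>2 \<subseteq> U" using U open_contains_ball by blast
  define \<rho> where "\<rho> = min \<rho>1 \<rho>2"
  have \<rho>: "0 < \<rho>" "\<And>y. dist x y < \<rho> \<Longrightarrow> y \<in> U" "\<And>y. dist x y < \<rho> \<Longrightarrow> 0 < \<tau> * (G y \<bullet> n)"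
    using \<rho>1(1) \<rho>1' \<rho>2 unfolding \<rho>_def by auto
  \<comment> \<open>A point closer than \<open>s0\<close> to \<open>x\<close> enters the ball after
    a step \<open>s0\<close> along \<open>n\<close>, and on the way stays where the derivative of
    \<open>g\<close> along \<open>n\<close> keeps its sign.\<close>
  define s0 where "s0 = min (\<rho> / 2) r"
  have s0: "0 < s0" "s0 \<le> \<rho> / 2" "s0 \<le> r" using \<rho>(1) r unfolding s0_def by auto
  have "\<exists>C. connected C \<and> z \<in> C \<and> C \<inter> ball (x + r *\<^sub>R n) r \<noteq> {} \<and> C \<inter> \<Gamma> = {}"
    if z: "dist x z < s0" "0 < \<tau> * g z" for z
  proof (intro exI conjI)
    let ?C = "(\<lambda>s. z + s *\<^sub>R n) ` {0..s0}"
    show "connected ?C" by (intro connected_continuous_image continuous_intros) simp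
    show "z \<in> ?C" using s0 by (intro image_eqI[of _ _ 0]) auto
    have "norm ((z - x) + (s0 - r) *\<^sub>R n) \<le> norm (z - x) + norm ((s0 - r) *\<^sub>R n)" by (rule norm_triangle_ineq)
    also have "\<dots> = dist x z + (r - s0)" using n1 s0 by (simp add: dist_norm norm_minus_commute)
    also have "\<dots> < r" using z by simp
    finally have "norm ((z + s0 *\<^sub>R n) - (x + r *\<^sub>R n)) < r" by (simp add: algebra_simps)
    then have "z + s0 *\<^sub>R n \<in> ball (x + r *\<^sub>R n) r" by (simp add: dist_norm norm_minus_commute)
    moreover have "z + s0 *\<^sub>R n \<in> ?C" using s0 by (intro image_eqI[of _ _ s0]) auto
    ultimately show "?C \<inter> ball (x + r *\<^sub>R n) r \<noteq> {}" by blast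
    have near: "dist x (z + s *\<^sub>R n) < \<rho>" if "0 \<le> s" "s \<le> s0" for s
    proof -
      have "norm ((z - x) + s *\<^sub>R n) \<le> norm (z - x) + norm (s *\<^sub>R n)" by (rule norm_triangle_ineq)
      also have "\<dots> = dist x z + s" using n1 that by (simp add: dist_norm norm_minus_commute)
      finally have "dist (z + s *\<^sub>R n) x \<le> dist x z + s" by (simp add: dist_norm algebra_simps)
      then show ?thesis using z s0 that by (simp add: dist_commute)
    qed
    have "g (z + s *\<^sub>R n) \<noteq> 0" if s: "0 \<le> s" "s \<le> s0" for s
    proof -
      have "\<tau> * g (z + 0 *\<^sub>R n) \<le> \<tau> * g (z + s *\<^sub>R n)"
      proof (rule DERIV_nonneg_imp_nondecreasing[OF s(1)])
        fix u assume u: "0 \<le> u" "u \<le> s"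
        then have d: "dist x (z + u *\<^sub>R n) < \<rho>" using near s by simp
        have "((\<lambda>u. z + u *\<^sub>R n) has_derivative (\<lambda>h. h *\<^sub>R n)) (at u)"
          by (auto intro!: derivative_eq_intros)
        from has_derivative_compose[OF this chart_derivative[OF c \<rho>(2)[OF d]]]
        have "((\<lambda>u. g (z + u *\<^sub>R n)) has_derivative (\<lambda>h. (G (z + u *\<^sub>R n) \<bullet> n) * h)) (at u)"
          by (simp add: mult.commute)
        then have "((\<lambda>u. g (z + u *\<^sub>R n)) has_real_derivative (G (z + u *\<^sub>R n) \<bullet> n)) (at u)"
          by (simp add: has_field_derivative_def)
        then have "((\<lambda>u. \<tau> * g (z + u *\<^sub>R n)) has_real_derivative \<tau> * (G (z + u *\<^sub>R n) \<bullet> n)) (at u)"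
          by (rule DERIV_cmult)
        then show "\<exists>y. ((\<lambda>u. \<tau> * g (z + u *\<^sub>R n)) has_real_derivative y) (at u) \<and> 0 \<le> y"
          using \<rho>(3)[OF d] by (intro exI conjI) auto
      qed
      then show ?thesis using z(2) by auto
    qed
    then show "?C \<inter> \<Gamma> = {}" using chart_zero_iff[OF c] \<rho>(2)[OF near] by auto
  qed
  then show ?thesis using s0(1) by blast
qed

text \<open>Each ball is connected and misses the surface, so it lies on one side. If both lay on
  the same side, points of the other side close to \<open>x\<close>, provided by the closures, could
  be joined to one of the balls without meeting the surface.\<close>

lemma normal_balls_sides:
  assumes S: "closed_C2_surface \<Gamma>" and r: "reach_radius \<Gamma> r" and x: "x \<in> \<Gamma>"
    and sides: "open Up" "open Um" "Up \<inter> Um = {}" "Up \<union> Um = - \<Gamma>" and cl: "x \<in> closure Up" "x \<in> closure Um"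
  obtains n where "norm n = 1" "ball (x + r *\<^sub>R n) r \<subseteq> Um" "ball (x - r *\<^sub>R n) r \<subseteq> Up"
proof -
  have r0: "0 < r" using r unfolding reach_radius_def by blast
  obtain U g G where c: "chart \<Gamma> x U g G" using surface_chart[OF S x] by blast
  have U: "open U" "x \<in> U" "G x \<noteq> 0" using c unfolding chart_def by blast+
  define n where "n = (1 / norm (G x)) *\<^sub>R G x"
  have n: "unit_normal \<Gamma> x n" unfolding n_def by (rule unit_normal_of_chart[OF c x])
  have "unit_normal \<Gamma> x (- n)"
  proof -
    have "- n = (- (1 / norm (G x))) *\<^sub>R G x" "norm (- n) = 1" using U(3) unfolding n_def by simp_all
    then show ?thesis using c x unfolding unit_normal_iff by blast
  qed
  from normal_ball_disjoint[OF S r n] normal_ball_disjoint[OF S r this]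
  have disj: "ball (x + r *\<^sub>R n) r \<inter> \<Gamma> = {}" "ball (x - r *\<^sub>R n) r \<inter> \<Gamma> = {}" by simp_all
  have side: "C \<subseteq> Up \<or> C \<subseteq> Um" if "connected C" "C \<inter> \<Gamma> = {}" for C
    using connectedD[OF that(1) sides(1,2)] that(2) sides(3,4) by blast
  have bs: "ball (x + r *\<^sub>R n) r \<subseteq> Up \<or> ball (x + r *\<^sub>R n) r \<subseteq> Um" "ball (x - r *\<^sub>R n) r \<subseteq> Up \<or> ball (x - r *\<^sub>R n) r \<subseteq> Um"
    by (intro side connected_ball disj)+
  obtain e1 where e1: "0 < e1" "\<And>z. dist x z < e1 \<Longrightarrow> 0 < g z \<Longrightarrow>
      \<exists>C. connected C \<and> z \<in> C \<and> C \<inter> ball (x + r *\<^sub>R n) r \<noteq> {} \<and> C \<inter> \<Gamma> = {}"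
    using connect_to_normal_ball[OF c r0, of 1] unfolding n_def by auto
  obtain e2 where e2: "0 < e2" "\<And>z. dist x z < e2 \<Longrightarrow> g z < 0 \<Longrightarrow>
      \<exists>C. connected C \<and> z \<in> C \<and> C \<inter> ball (x - r *\<^sub>R n) r \<noteq> {} \<and> C \<inter> \<Gamma> = {}"
    using connect_to_normal_ball[OF c r0, of "-1"] unfolding n_def by auto
  obtain e3 where e3: "0 < e3" "ball x e3 \<subseteq> U" using U open_contains_ball by blast
  have ne: "\<not> (ball (x + r *\<^sub>R n) r \<subseteq> A \<and> ball (x - r *\<^sub>R n) r \<subseteq> A)"
    if A: "(A = Up \<and> B = Um) \<or> (A = Um \<and> B = Up)" for A B
  proof
    assume b: "ball (x + r *\<^sub>R n) r \<subseteq> A \<and> ball (x - r *\<^sub>R n) r \<subseteq> A"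
    have "x \<in> closure B" using A cl by auto
    then obtain z where z: "z \<in> B" "dist z x < min e1 (min e2 e3)"
      unfolding closure_approachable using e1(1) e2(1) e3(1) by (meson min_less_iff_conj)
    then have zx: "dist x z < e1" "dist x z < e2" "z \<in> U" using e3(2) by (auto simp: dist_commute)
    have "z \<notin> \<Gamma>" using z(1) A sides(4) by auto
    then have "g z \<noteq> 0" using chart_zero_iff[OF c zx(3)] by simp
    then obtain C where C: "connected C" "z \<in> C" "C \<inter> A \<noteq> {}" "C \<inter> \<Gamma> = {}"
      using e1(2)[OF zx(1)] e2(2)[OF zx(2)] b by (metis (no_types, lifting) Int_emptyI disjoint_iff linorder_neqE_linordered_idom subsetD)
    then show False using side[OF C(1,4)] z(1) A sides(3) by blast
  qed
  show thesis
  proof (cases "ball (x + r *\<^sub>R n) r \<subseteq> Um")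
    case True
    then have "ball (x - r *\<^sub>R n) r \<subseteq> Up" using ne[of Um Up] bs by blast
    with True show thesis using that[of n] n unfolding unit_normal_def by blast
  next
    case False
    then have "ball (x + r *\<^sub>R n) r \<subseteq> Up" using bs by blast
    moreover from this have "ball (x - r *\<^sub>R n) r \<subseteq> Um" using ne[of Up Um] bs by blast
    moreover have "norm (- n) = 1" using n unfolding unit_normal_def by simp
    ultimately show thesis using that[of "- n"] by simp
  qed
qed

section \<open>Nodal values and derivatives of trilinear functions\<close>

lemma vsum_scale: "vsum s (\<lambda>i j k. c * f i j k) = c * vsum s f"
  unfolding vsum_def by (simp add: algebra_simps)

lemma vsum_add: "vsum s (\<lambda>i j k. f i j k + g i j k) = vsum s f + vsum s g"
  unfolding vsum_def by (simp add: algebra_simps)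

lemma vsum_abs_le:
  assumes "\<And>i j k. \<bar>f i j k\<bar> \<le> B"
  shows "\<bar>vsum s f\<bar> \<le> 8 * B"
proof -
  have B: "0 \<le> B" using assms[of True True True] by linarith
  have "of_bool (s i j k) * f i j k \<le> B \<and> - B \<le> of_bool (s i j k) * f i j k" for i j k
    using assms[of i j k] B by (cases "s i j k") auto
  then have b: "of_bool (s i j k) * f i j k \<le> B" "- B \<le> of_bool (s i j k) * f i j k" for i j k by blast+
  have "vsum s f \<le> B + B + B + B + B + B + B + B" "(- B) + (- B) + (- B) + (- B) + (- B) + (- B) + (- B) + (- B) \<le> vsum s f"
    unfolding vsum_def by (intro add_mono b)+
  then show ?thesis by (simp add: abs_le_iff)
qed

lemma vsum_member_le:
  assumes "\<And>i j k. 0 \<le> f i j k" "s i j k"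
  shows "f i j k \<le> vsum s f"
proof -
  have nn: "0 \<le> of_bool (s i j k) * f i j k" for i j k using assms(1) by simp
  have "\<forall>i j k. of_bool (s i j k) * f i j k \<le> vsum s f"
    unfolding vsum_def all_bool_eq
    using nn[of True True True] nn[of True True False] nn[of True False True] nn[of True False False]
      nn[of False True True] nn[of False True False] nn[of False False True] nn[of False False False]
    by (intro conjI) linarith+
  then have "of_bool (s i j k) * f i j k \<le> vsum s f" by blast
  then show ?thesis using assms(2) by simp
qed

lemma slope_bound:
  assumes "n1\<^sup>2 + n2\<^sup>2 + n3\<^sup>2 = 1" "0 \<le> x" "x \<le> 1" "0 \<le> y" "y \<le> 1" "0 \<le> z" "z \<le> 1"
  shows "\<bar>slope x y z n1 n2 n3 i j k\<bar> \<le> 3"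
proof -
  have n: "\<bar>n1\<bar> \<le> 1" "\<bar>n2\<bar> \<le> 1" "\<bar>n3\<bar> \<le> 1"
    using assms(1) zero_le_power2[of n1] zero_le_power2[of n2] zero_le_power2[of n3]
    unfolding abs_square_le_1[symmetric] by linarith+
  have w: "\<bar>wt i x\<bar> \<le> 1" "\<bar>wt i y\<bar> \<le> 1" "\<bar>wt i z\<bar> \<le> 1" for i using assms unfolding wt_def by auto
  have s: "\<bar>sg i\<bar> \<le> 1" for i unfolding sg_def by auto
  have p: "\<bar>p * q * u * v\<bar> \<le> 1" if "\<bar>p\<bar> \<le> 1" "\<bar>q\<bar> \<le> 1" "\<bar>u\<bar> \<le> 1" "\<bar>v\<bar> \<le> 1" for p q u v :: real
    unfolding abs_mult using that by (simp add: mult_le_one)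
  show ?thesis
    using p[OF n(1) s[of i] w(2)[of j] w(3)[of k]] p[OF n(2) s[of j] w(1)[of i] w(3)[of k]]
      p[OF n(3) s[of k] w(1)[of i] w(2)[of j]]
    unfolding slope_def by linarith
qed

text \<open>With \<open>\<rho> = \<beta>\<^sup>- / \<beta>\<^sup>+\<close> the normal derivative \<open>\<sigma>\<close> solves \<open>\<sigma> (\<rho> + (1 - \<rho>) \<delta>) = \<gamma>\<close>, where \<open>\<delta>\<close> is the energy
  of the minus side and \<open>\<gamma>\<close> is bounded independently of the coefficients.\<close>
lemma nodal_bounds:
  assumes \<rho>: "0 < \<rho>" "\<rho> \<le> 1" and unit: "n1\<^sup>2 + n2\<^sup>2 + n3\<^sup>2 = 1"
    and F: "0 \<le> x" "x \<le> 1" "0 \<le> y" "y \<le> 1" "0 \<le> z" "z \<le> 1"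
    and d: "d = n1 * u + n2 * v + n3 * w" "0 \<le> u" "u \<le> 1" "0 \<le> v" "v \<le> 1" "0 \<le> w" "w \<le> 1"
    and coercive: "coercive s x y z n1 n2 n3 d"
    and \<sigma>: "\<sigma> = vsum (\<lambda>i j k. True) (\<lambda>i j k. c i j k * slope x y z n1 n2 n3 i j k)"
    and e: "\<And>i j k. \<bar>e i j k\<bar> \<le> 1"
    and c: "\<And>i j k. c i j k = e i j k + (if s i j k then 0 else (1 - \<rho>) * \<sigma> * lev n1 n2 n3 d i j k)"
  shows "\<bar>c i j k - (1 - \<rho>) * \<sigma> * lev n1 n2 n3 d i j k\<bar> \<le> 12001" and "\<bar>c i j k\<bar> \<le> 49 / \<rho>"
proof -
  define \<gamma> where "\<gamma> = vsum (\<lambda>i j k. True) (\<lambda>i j k. e i j k * slope x y z n1 n2 n3 i j k)"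
  define \<delta> where "\<delta> = energy s x y z n1 n2 n3 d"
  have slope: "\<bar>slope x y z n1 n2 n3 i j k\<bar> \<le> 3" for i j k by (rule slope_bound[OF unit F])
  have lev: "\<bar>lev n1 n2 n3 d i j k\<bar> \<le> 2" for i j k by (rule lev_bound[OF unit d])
  have "\<bar>e i j k * slope x y z n1 n2 n3 i j k\<bar> \<le> 3" for i j k
    unfolding abs_mult using mult_mono[OF e[of i j k] slope[of i j k]] by simp
  from vsum_abs_le[OF this] have \<gamma>: "\<bar>\<gamma>\<bar> \<le> 24" unfolding \<gamma>_def by simp
  have "0 \<le> vsum s (\<lambda>i j k. \<bar>lev n1 n2 n3 d i j k\<bar>)" unfolding vsum_def by simp
  then have \<delta>: "0 \<le> \<delta>" "vsum s (\<lambda>i j k. \<bar>lev n1 n2 n3 d i j k\<bar>) \<le> 500 * \<delta>"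
    using coercive unfolding coercive_def \<delta>_def by simp_all
  have "vsum (\<lambda>i j k. True) (\<lambda>i j k. c i j k * slope x y z n1 n2 n3 i j k)
    = \<gamma> + (1 - \<rho>) * \<sigma> * energy (\<lambda>i j k. \<not> s i j k) x y z n1 n2 n3 d"
  proof -
    have "c i j k * slope x y z n1 n2 n3 i j k = e i j k * slope x y z n1 n2 n3 i j k
      + (1 - \<rho>) * \<sigma> * (of_bool (\<not> s i j k) * (lev n1 n2 n3 d i j k * slope x y z n1 n2 n3 i j k))" for i j k
      unfolding c by (simp add: algebra_simps)
    moreover have "vsum (\<lambda>i j k. True) (\<lambda>i j k. of_bool (t i j k) * f i j k) = vsum t f" for t f
      unfolding vsum_def by simp
    ultimately show ?thesis unfolding \<gamma>_def energy_def by (simp only: vsum_add vsum_scale)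
  qed
  then have "\<sigma> = \<gamma> + (1 - \<rho>) * \<sigma> * (1 - \<delta>)"
    unfolding \<sigma>[symmetric] energy_compl unit \<delta>_def .
  then have eq: "\<sigma> * (\<rho> + (1 - \<rho>) * \<delta>) = \<gamma>" by (simp add: algebra_simps)
  have D: "0 \<le> (1 - \<rho>) * \<delta>" using \<rho> \<delta> by simp
  have abs_eq: "\<bar>\<sigma>\<bar> * (\<rho> + (1 - \<rho>) * \<delta>) = \<bar>\<gamma>\<bar>"
    unfolding eq[symmetric] abs_mult using D \<rho> by simp
  have "\<bar>\<sigma>\<bar> * \<rho> \<le> \<bar>\<sigma>\<bar> * (\<rho> + (1 - \<rho>) * \<delta>)" using D by (intro mult_left_mono) auto
  then have "\<bar>\<sigma>\<bar> * \<rho> \<le> 24" using abs_eq \<gamma> by linarith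
  then have \<sigma>_bound: "\<bar>\<sigma>\<bar> \<le> 24 / \<rho>" using \<rho> by (simp add: field_simps)
  \<comment> \<open>The correction contributes at most \<open>48 / \<rho>\<close> and the nodal
    value at most \<open>1 \<le> 1 / \<rho>\<close>, whence 49.\<close>
  have "\<bar>(1 - \<rho>) * \<sigma> * lev n1 n2 n3 d i j k\<bar> \<le> 1 * (24 / \<rho>) * 2"
    unfolding abs_mult by (intro mult_mono lev \<sigma>_bound) (use \<rho> in auto)
  moreover have "1 \<le> 1 / \<rho>" using \<rho> by simp
  ultimately show "\<bar>c i j k\<bar> \<le> 49 / \<rho>"
    using e[of i j k] unfolding c by auto
  show "\<bar>c i j k - (1 - \<rho>) * \<sigma> * lev n1 n2 n3 d i j k\<bar> \<le> 12001"
  proof (cases "s i j k")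
    case False
    then show ?thesis unfolding c using e[of i j k] by simp
  next
    case True
    \<comment> \<open>Replacing the level by \<open>500 * \<delta>\<close> produces a part of the
      left side of \<open>abs_eq\<close>. The constant is \<open>500 * 24 + 1\<close>, where 24
      stems from eight vertices with slopes at most 3.\<close>
    have "\<bar>lev n1 n2 n3 d i j k\<bar> \<le> 500 * \<delta>"
      using vsum_member_le[of "\<lambda>i j k. \<bar>lev n1 n2 n3 d i j k\<bar>" s i j k] True \<delta>(2) by simp
    then have "\<bar>(1 - \<rho>) * \<sigma> * lev n1 n2 n3 d i j k\<bar> \<le> (1 - \<rho>) * \<bar>\<sigma>\<bar> * (500 * \<delta>)"
      unfolding abs_mult using \<rho> by (intro mult_mono) auto
    also have "\<dots> = 500 * (\<bar>\<sigma>\<bar> * ((1 - \<rho>) * \<delta>))" by simp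
    also have "\<dots> \<le> 500 * (\<bar>\<sigma>\<bar> * (\<rho> + (1 - \<rho>) * \<delta>))" using \<rho> by (intro mult_left_mono) auto
    also have "\<dots> \<le> 12000" unfolding abs_eq using \<gamma> by simp
    finally show ?thesis unfolding c using True e[of i j k] by simp
  qed
qed

section \<open>Multiaffine functions and their derivatives\<close>

text \<open>The range from -1 to 2 describes the cube with one layer of neighbours around it, which
  contains the patch \<open>\<omega>\<close> in scaled coordinates.\<close>

definition multiaffine :: "real \<Rightarrow> (real \<Rightarrow> real \<Rightarrow> real \<Rightarrow> real) \<Rightarrow> bool" where
  "multiaffine B g \<longleftrightarrow> (\<forall>x y z. g x y z = (1 - x) * g 0 y z + x * g 1 y z) \<and>
     (\<forall>x y z. g x y z = (1 - y) * g x 0 z + y * g x 1 z) \<and>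
     (\<forall>x y z. g x y z = (1 - z) * g x y 0 + z * g x y 1) \<and>
     (\<forall>x y z. -1 \<le> x \<longrightarrow> x \<le> 2 \<longrightarrow> -1 \<le> y \<longrightarrow> y \<le> 2 \<longrightarrow> -1 \<le> z \<longrightarrow> z \<le> 2 \<longrightarrow> \<bar>g x y z\<bar> \<le> B)"

text \<open>For a function affine in each variable this is the exact partial derivative; the result
  is multiaffine again, so second derivatives are iterated differences.\<close>

definition difference :: "3 \<Rightarrow> (real \<Rightarrow> real \<Rightarrow> real \<Rightarrow> real) \<Rightarrow> real \<Rightarrow> real \<Rightarrow> real \<Rightarrow> real" where
  "difference i g x y z = (if i = 1 then g 1 y z - g 0 y z else if i = 2 then g x 1 z - g x 0 z else g x y 1 - g x y 0)"

lemma multiaffineD: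
  assumes "multiaffine B g"
  shows "g x y z = (1 - x) * g 0 y z + x * g 1 y z" "g x y z = (1 - y) * g x 0 z + y * g x 1 z"
    "g x y z = (1 - z) * g x y 0 + z * g x y 1"
    "-1 \<le> x \<Longrightarrow> x \<le> 2 \<Longrightarrow> -1 \<le> y \<Longrightarrow> y \<le> 2 \<Longrightarrow> -1 \<le> z \<Longrightarrow> z \<le> 2 \<Longrightarrow> \<bar>g x y z\<bar> \<le> B"
  using assms unfolding multiaffine_def by blast+

lemma multiaffineI:
  assumes "\<And>x y z. g x y z = (1 - x) * g 0 y z + x * g 1 y z" "\<And>x y z. g x y z = (1 - y) * g x 0 z + y * g x 1 z"
    "\<And>x y z. g x y z = (1 - z) * g x y 0 + z * g x y 1"
    "\<And>x y z. -1 \<le> x \<Longrightarrow> x \<le> 2 \<Longrightarrow> -1 \<le> y \<Longrightarrow> y \<le> 2 \<Longrightarrow> -1 \<le> z \<Longrightarrow> z \<le> 2 \<Longrightarrow> \<bar>g x y z\<bar> \<le> B"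
  shows "multiaffine B g"
  unfolding multiaffine_def by (intro conjI allI impI assms(4)) (rule assms(1-3) | assumption)+

text \<open>The arguments 0 and 1 stay within the range from -1 to 2, so the bound merely
  doubles.\<close>

lemma multiaffine_difference:
  assumes g: "multiaffine B g" shows "multiaffine (2 * B) (difference i g)"
proof (rule multiaffineI)
  note a = multiaffineD[OF g]
  fix x y z
  consider (1) "i = 1" | (2) "i = 2" | (3) "i = 3" using exhaust_3[of i] by blast
  note i = this
  show "difference i g x y z = (1 - x) * difference i g 0 y z + x * difference i g 1 y z"
  proof (cases rule: i)
    case 1 show ?thesis unfolding difference_def 1 by (simp add: algebra_simps)
  next
    case 2 show ?thesis unfolding difference_def 2 using a(1)[of x 1 z] a(1)[of x 0 z] by (simp add: algebra_simps)
  next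
    case 3 show ?thesis unfolding difference_def 3 using a(1)[of x y 1] a(1)[of x y 0] by (simp add: algebra_simps)
  qed
  show "difference i g x y z = (1 - y) * difference i g x 0 z + y * difference i g x 1 z"
  proof (cases rule: i)
    case 1 show ?thesis unfolding difference_def 1 using a(2)[of 1 y z] a(2)[of 0 y z] by (simp add: algebra_simps)
  next
    case 2 show ?thesis unfolding difference_def 2 by (simp add: algebra_simps)
  next
    case 3 show ?thesis unfolding difference_def 3 using a(2)[of x y 1] a(2)[of x y 0] by (simp add: algebra_simps)
  qed
  show "difference i g x y z = (1 - z) * difference i g x y 0 + z * difference i g x y 1"
  proof (cases rule: i)
    case 1 show ?thesis unfolding difference_def 1 using a(3)[of 1 y z] a(3)[of 0 y z] by (simp add: algebra_simps)
  next
    case 2 show ?thesis unfolding difference_def 2 using a(3)[of x 1 z] a(3)[of x 0 z] by (simp add: algebra_simps)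
  next
    case 3 show ?thesis unfolding difference_def 3 by (simp add: algebra_simps)
  qed
  assume r: "-1 \<le> x" "x \<le> 2" "-1 \<le> y" "y \<le> 2" "-1 \<le> z" "z \<le> 2"
  have diff: "\<bar>u - v\<bar> \<le> 2 * B" if "\<bar>u\<bar> \<le> B" "\<bar>v\<bar> \<le> B" for u v using that by linarith
  show "\<bar>difference i g x y z\<bar> \<le> 2 * B"
    unfolding difference_def using r by (auto intro!: diff a(4))
qed

definition scaled :: "pt \<Rightarrow> real \<Rightarrow> (real \<Rightarrow> real \<Rightarrow> real \<Rightarrow> real) \<Rightarrow> pt \<Rightarrow> real" where
  "scaled a h g X = g ((X$1 - a$1) / h) ((X$2 - a$2) / h) ((X$3 - a$3) / h)"

text \<open>Along a coordinate line the function is affine, so the derivative is a difference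
  quotient. The factor \<open>k\<close> lets the rule be applied to its own result.\<close>

lemma pd_scaled:
  assumes g: "multiaffine B g" and h: "0 < h"
  shows "pd i (\<lambda>X. k * scaled a h g X) = (\<lambda>X. k / h * scaled a h (difference i g) X)"
proof
  fix X :: pt
  have a1: "g x y z = g 0 y z + x * (g 1 y z - g 0 y z)" and a2: "g x y z = g x 0 z + y * (g x 1 z - g x 0 z)"
    and a3: "g x y z = g x y 0 + z * (g x y 1 - g x y 0)" for x y z
    using multiaffineD(1-3)[OF g, of x y z] by (simp_all add: algebra_simps)
  have s1: "g (x + u) y z = g x y z + u * (g 1 y z - g 0 y z)" for x y z u
    unfolding a1[of "x + u" y z] a1[of x y z] by (simp add: algebra_simps)
  have s2: "g x (y + u) z = g x y z + u * (g x 1 z - g x 0 z)" for x y z u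
    unfolding a2[of x "y + u" z] a2[of x y z] by (simp add: algebra_simps)
  have s3: "g x y (z + u) = g x y z + u * (g x y 1 - g x y 0)" for x y z u
    unfolding a3[of x y "z + u"] a3[of x y z] by (simp add: algebra_simps)
  have comp: "((X + t *\<^sub>R axis i 1) $ l - a $ l) / h = (X $ l - a $ l) / h + (if l = i then t / h else 0)" for t l
    by (simp add: axis_def add_divide_distrib diff_divide_distrib)
  have aff: "(\<lambda>t. k * scaled a h g (X + t *\<^sub>R axis i 1)) = (\<lambda>t. k * scaled a h g X + t * (k / h * scaled a h (difference i g) X))"
  proof
    fix t
    consider "i = 1" | "i = 2" | "i = 3" using exhaust_3[of i] by blast
    then show "k * scaled a h g (X + t *\<^sub>R axis i 1) = k * scaled a h g X + t * (k / h * scaled a h (difference i g) X)"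
    proof cases
      case 1
      show ?thesis unfolding scaled_def comp unfolding 1 difference_def by (simp add: s1 distrib_left mult.left_commute[of k t])
    next
      case 2
      show ?thesis unfolding scaled_def comp unfolding 2 difference_def by (simp add: s2 distrib_left mult.left_commute[of k t])
    next
      case 3
      show ?thesis unfolding scaled_def comp unfolding 3 difference_def by (simp add: s3 distrib_left mult.left_commute[of k t])
    qed
  qed
  have "((\<lambda>t. k * scaled a h g X + t * (k / h * scaled a h (difference i g) X)) has_real_derivative k / h * scaled a h (difference i g) X) (at 0)"
    using h by (auto intro!: derivative_eq_intros)
  then show "pd i (\<lambda>X. k * scaled a h g X) X = k / h * scaled a h (difference i g) X"
    unfolding pd_def aff by (rule DERIV_imp_deriv)
qed

text \<open>The factor 4 pays for two differences, each of which doubles the bound.\<close>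

lemma multiaffine_derivative_bounds:
  assumes g: "multiaffine B g" and h: "0 < h" and f: "f = scaled a h g"
    and X: "\<And>i. a$i - h \<le> X$i" "\<And>i. X$i \<le> a$i + 2 * h" and B: "4 * B \<le> M"
  shows "\<bar>f X\<bar> \<le> M" "\<bar>pd i f X\<bar> \<le> M / h" "\<bar>pd i (pd j f) X\<bar> \<le> M / h^2"
proof -
  have u: "-1 \<le> (X$l - a$l) / h" "(X$l - a$l) / h \<le> 2" for l
    using X[of l] h by (simp_all add: field_simps)
  have bound: "\<bar>scaled a h g X\<bar> \<le> B" if "multiaffine B g" for B g
    using that u unfolding multiaffine_def scaled_def by blast
  have B0: "0 \<le> B" using bound[OF g] by linarith
  have f1: "f = (\<lambda>X. 1 * scaled a h g X)" unfolding f by simp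
  have p1: "pd j f = (\<lambda>X. 1 / h * scaled a h (difference j g) X)" for j unfolding f1 by (rule pd_scaled[OF g h])
  have p2: "pd i (pd j f) = (\<lambda>X. 1 / h / h * scaled a h (difference i (difference j g)) X)"
    unfolding p1 by (rule pd_scaled[OF multiaffine_difference[OF g] h])
  show "\<bar>f X\<bar> \<le> M" unfolding f using bound[OF g] B B0 by linarith
  have "\<bar>scaled a h (difference i g) X\<bar> \<le> M" using bound[OF multiaffine_difference[OF g], of i] B B0 by linarith
  then show "\<bar>pd i f X\<bar> \<le> M / h" unfolding p1 using h by (simp add: abs_mult divide_right_mono)
  have "\<bar>scaled a h (difference i (difference j g)) X\<bar> \<le> M"
    using bound[OF multiaffine_difference[OF multiaffine_difference[OF g]], of i j] B by linarith
  then show "\<bar>pd i (pd j f) X\<bar> \<le> M / h^2" unfolding p2 using h by (simp add: abs_mult divide_right_mono power2_eq_square)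
qed

definition trilinear :: "(bool \<Rightarrow> bool \<Rightarrow> bool \<Rightarrow> real) \<Rightarrow> real \<Rightarrow> real \<Rightarrow> real \<Rightarrow> real" where
  "trilinear c x y z = vsum (\<lambda>i j k. True) (\<lambda>i j k. c i j k * (wt i x * wt j y * wt k z))"

text \<open>There are eight terms, and each of the three weights is at most 2 in size on the range
  from -1 to 2, whence 64.\<close>

lemma trilinear_multiaffine:
  assumes "\<And>i j k. \<bar>c i j k\<bar> \<le> M"
  shows "multiaffine (64 * M) (trilinear c)"
proof -
  have M: "0 \<le> M" using assms[of True True True] by linarith
  have "\<bar>trilinear c x y z\<bar> \<le> 64 * M" if "-1 \<le> x" "x \<le> 2" "-1 \<le> y" "y \<le> 2" "-1 \<le> z" "z \<le> 2" for x y z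
  proof -
    have w: "\<bar>wt i x\<bar> \<le> 2" "\<bar>wt i y\<bar> \<le> 2" "\<bar>wt i z\<bar> \<le> 2" for i using that unfolding wt_def by auto
    have "\<bar>c i j k * (wt i x * wt j y * wt k z)\<bar> \<le> M * (2 * 2 * 2)" for i j k
      unfolding abs_mult by (intro mult_mono assms w) (use M in auto)
    from vsum_abs_le[OF this] show ?thesis unfolding trilinear_def by simp
  qed
  then show ?thesis
  proof (intro multiaffineI)
    fix x y z
    have "c i j k * (wt i x * wt j y * wt k z) = (1 - x) * (c i j k * (wt i 0 * wt j y * wt k z)) + x * (c i j k * (wt i 1 * wt j y * wt k z))" for i j k
      by (cases i) (simp_all add: wt_def mult_ac)
    then show "trilinear c x y z = (1 - x) * trilinear c 0 y z + x * trilinear c 1 y z"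
      unfolding trilinear_def by (simp only: vsum_add vsum_scale)
    have "c i j k * (wt i x * wt j y * wt k z) = (1 - y) * (c i j k * (wt i x * wt j 0 * wt k z)) + y * (c i j k * (wt i x * wt j 1 * wt k z))" for i j k
      by (cases j) (simp_all add: wt_def mult_ac)
    then show "trilinear c x y z = (1 - y) * trilinear c x 0 z + y * trilinear c x 1 z"
      unfolding trilinear_def by (simp only: vsum_add vsum_scale)
    have "c i j k * (wt i x * wt j y * wt k z) = (1 - z) * (c i j k * (wt i x * wt j y * wt k 0)) + z * (c i j k * (wt i x * wt j y * wt k 1))" for i j k
      by (cases k) (simp_all add: wt_def mult_ac)
    then show "trilinear c x y z = (1 - z) * trilinear c x y 0 + z * trilinear c x y 1"
      unfolding trilinear_def by (simp only: vsum_add vsum_scale)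
  qed
qed

lemma difference_trilinear:
  "difference 1 (trilinear c) x y z = vsum (\<lambda>i j k. True) (\<lambda>i j k. c i j k * (sg i * wt j y * wt k z))"
  "difference 2 (trilinear c) x y z = vsum (\<lambda>i j k. True) (\<lambda>i j k. c i j k * (sg j * wt i x * wt k z))"
  "difference 3 (trilinear c) x y z = vsum (\<lambda>i j k. True) (\<lambda>i j k. c i j k * (sg k * wt i x * wt j y))"
  unfolding difference_def trilinear_def vsum_def wt_def sg_def by (simp_all add: algebra_simps)

lemma slope_trilinear:
  "vsum (\<lambda>i j k. True) (\<lambda>i j k. c i j k * slope x y z n1 n2 n3 i j k) =
    n1 * difference 1 (trilinear c) x y z + n2 * difference 2 (trilinear c) x y z + n3 * difference 3 (trilinear c) x y z"
proof -
  have "c i j k * slope x y z n1 n2 n3 i j k = n1 * (c i j k * (sg i * wt j y * wt k z))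
    + n2 * (c i j k * (sg j * wt i x * wt k z)) + n3 * (c i j k * (sg k * wt i x * wt j y))" for i j k
    unfolding slope_def by (simp add: algebra_simps)
  then show ?thesis unfolding difference_trilinear by (simp only: vsum_add vsum_scale)
qed

section \<open>Coordinates, edges and faces of a mesh cube\<close>

definition corner_coords :: "pt \<Rightarrow> real \<Rightarrow> real \<Rightarrow> real \<Rightarrow> real \<Rightarrow> pt" where
  "corner_coords a h x y z = a + h *\<^sub>R vector [x, y, z]"

lemma corner_coords_nth [simp]:
  "corner_coords a h x y z $ 1 = a$1 + h * x" "corner_coords a h x y z $ 2 = a$2 + h * y"
  "corner_coords a h x y z $ 3 = a$3 + h * z"
  unfolding corner_coords_def by (simp_all add: vector_3)

lemma corner_coords_eq_iff: "h \<noteq> 0 \<Longrightarrow> corner_coords a h x y z = corner_coords a h x' y' z' \<longleftrightarrow> x = x' \<and> y = y' \<and> z = z'"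
  unfolding vec_eq_iff forall_3 by simp

lemma corner_coords_surj: "h \<noteq> 0 \<Longrightarrow> \<exists>x y z. X = corner_coords a h x y z"
  by (intro exI[of _ "(X$1 - a$1) / h"] exI[of _ "(X$2 - a$2) / h"] exI[of _ "(X$3 - a$3) / h"])
    (simp add: vec_eq_iff forall_3)

lemma inner_corner_coords_diff:
  "(corner_coords a h x' y' z' - corner_coords a h x y z) \<bullet> n = h * (n$1 * (x' - x) + n$2 * (y' - y) + n$3 * (z' - z))"
  unfolding inner_vec_def sum_3 by (simp add: algebra_simps)

lemma norm_corner_coords_diff:
  "(norm (corner_coords a h x' y' z' - corner_coords a h x y z))\<^sup>2 = h\<^sup>2 * ((x' - x)\<^sup>2 + (y' - y)\<^sup>2 + (z' - z)\<^sup>2)"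
  unfolding power2_norm_eq_inner inner_vec_def sum_3 by (simp add: algebra_simps power2_eq_square)

lemma corner_coords_vertex:
  assumes "h \<noteq> 0"
  shows "corner_coords a h x y z \<in> cube_vertices a h \<longleftrightarrow> bin x \<and> bin y \<and> bin z"
  unfolding cube_vertices_def mem_Collect_eq forall_3 bin_def using assms by auto

lemma cube_iff: "X \<in> cube a h \<longleftrightarrow> (\<forall>j. a$j \<le> X$j \<and> X$j \<le> a$j + h)"
proof -
  have one: "(One :: pt) $ i = 1" for i
    using inner_sum_left_Basis[of "axis i 1 :: pt" "\<lambda>_. 1"] by (simp add: inner_axis axis_in_Basis_iff)
  show ?thesis unfolding cube_def mem_box_cart vector_add_component vector_scaleR_component one by simp
qed

lemma corner_coords_cube:
  assumes "0 < h"
  shows "corner_coords a h x y z \<in> cube a h \<longleftrightarrow> 0 \<le> x \<and> x \<le> 1 \<and> 0 \<le> y \<and> y \<le> 1 \<and> 0 \<le> z \<and> z \<le> 1"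
proof -
  have "h * u \<le> h \<longleftrightarrow> u \<le> 1" for u using mult_le_cancel_left_pos[OF assms, of u 1] by simp
  then show ?thesis
    unfolding cube_iff forall_3 using assms by (auto simp: zero_le_mult_iff)
qed

text \<open>A single edge has to contain both points, so that the condition of at most one
  intersection per edge applies to them.\<close>

lemma edge_through:
  assumes h: "0 < h" and X: "\<And>j. j \<noteq> k \<Longrightarrow> X$j = a$j \<or> X$j = a$j + h" "a$k \<le> X$k" "X$k \<le> a$k + h"
    and Y: "\<And>j. j \<noteq> k \<Longrightarrow> Y$j = X$j" "a$k \<le> Y$k" "Y$k \<le> a$k + h"
  shows "\<exists>E\<in>cube_edges_dir a h k. X \<in> E \<and> Y \<in> E"
proof -
  define v w where "v = (\<chi> j. if j = k then a$k else X$j)" and "w = (\<chi> j. if j = k then a$k + h else X$j)"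
  have mem: "Z \<in> closed_segment v w" if "\<And>j. j \<noteq> k \<Longrightarrow> Z$j = X$j" "a$k \<le> Z$k" "Z$k \<le> a$k + h" for Z
  proof -
    have "Z = (1 - (Z$k - a$k) / h) *\<^sub>R v + ((Z$k - a$k) / h) *\<^sub>R w"
      unfolding vec_eq_iff
    proof
      fix j
      show "Z $ j = ((1 - (Z$k - a$k) / h) *\<^sub>R v + ((Z$k - a$k) / h) *\<^sub>R w) $ j"
        using h that(1)[of j] by (cases "j = k") (simp_all add: v_def w_def field_simps)
    qed
    moreover have "0 \<le> (Z$k - a$k) / h" "(Z$k - a$k) / h \<le> 1" using h that by simp_all
    ultimately show ?thesis unfolding closed_segment_def by blast
  qed
  have "closed_segment v w \<in> cube_edges_dir a h k"
    unfolding cube_edges_dir_def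
  proof (intro CollectI exI conjI)
    show "v \<in> cube_vertices a h" "w \<in> cube_vertices a h" using X(1) unfolding cube_vertices_def v_def w_def by auto
    show "v $ k \<noteq> w $ k" "\<forall>j. j \<noteq> k \<longrightarrow> v $ j = w $ j" using h unfolding v_def w_def by auto
  qed simp
  moreover have "X \<in> closed_segment v w" by (rule mem) (use X in auto)
  moreover have "Y \<in> closed_segment v w" by (rule mem) (use Y in auto)
  ultimately show ?thesis by blast
qed

lemma edge_dirD:
  assumes E: "E \<in> cube_edges_dir a h k" and h: "0 < h" and X: "X \<in> E"
  shows "j \<noteq> k \<Longrightarrow> X$j = a$j \<or> X$j = a$j + h" "a$k \<le> X$k" "X$k \<le> a$k + h"
    and "Y \<in> E \<Longrightarrow> j \<noteq> k \<Longrightarrow> Y$j = X$j"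
proof -
  obtain v w where vw: "E = closed_segment v w" "v \<in> cube_vertices a h" "w \<in> cube_vertices a h" "v$k \<noteq> w$k" "\<And>j. j \<noteq> k \<Longrightarrow> v$j = w$j"
    using E unfolding cube_edges_dir_def by blast
  have const: "Z$j = v$j" if Z: "Z \<in> E" and "j \<noteq> k" for Z j
  proof -
    obtain u where "Z = (1 - u) *\<^sub>R v + u *\<^sub>R w" using Z unfolding vw(1) closed_segment_def by blast
    then have "Z$j = (1 - u) * v$j + u * w$j" by simp
    then show ?thesis unfolding vw(5)[OF \<open>j \<noteq> k\<close>] by (simp add: algebra_simps)
  qed
  show "X$j = a$j \<or> X$j = a$j + h" if "j \<noteq> k" for j
    using const[OF X that] vw(2) unfolding cube_vertices_def by simp
  show "Y$j = X$j" if "Y \<in> E" "j \<noteq> k" for Y j using const[OF that] const[OF X that(2)] by simp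
  obtain u where u: "0 \<le> u" "u \<le> 1" "X = (1 - u) *\<^sub>R v + u *\<^sub>R w" using X unfolding vw(1) closed_segment_def by blast
  have v: "v$k = a$k \<or> v$k = a$k + h" "w$k = a$k \<or> w$k = a$k + h" using vw(2,3) unfolding cube_vertices_def by blast+
  have "0 \<le> (1 - u) * (v$k - a$k) + u * (w$k - a$k)" "0 \<le> (1 - u) * (a$k + h - v$k) + u * (a$k + h - w$k)"
    using v h u by (auto intro!: add_nonneg_nonneg)
  moreover have "X$k = (1 - u) * v$k + u * w$k" unfolding u(3) by simp
  ultimately show "a$k \<le> X$k" "X$k \<le> a$k + h" by (simp_all add: algebra_simps)
qed

text \<open>An edge in a direction other than \<open>k\<close> has constant coordinate
  \<open>k\<close>, so it lies in the face as soon as one of its points does.\<close>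

lemma face_boundaryI:
  assumes E: "E \<in> cube_edges_dir a h l" and h: "0 < h" and X: "X \<in> E" "X$k = c" and "l \<noteq> k"
  shows "X \<in> face_boundary a h {x \<in> cube a h. x$k = c}"
proof -
  have "Y \<in> cube a h \<and> Y$k = c" if Y: "Y \<in> E" for Y
  proof
    show "Y$k = c" using edge_dirD(4)[OF E h X(1) Y] X(2) \<open>l \<noteq> k\<close> by simp
    have "a$j \<le> Y$j \<and> Y$j \<le> a$j + h" for j using edge_dirD(1)[OF E h Y, of j] edge_dirD(2,3)[OF E h Y] h by (cases "j = l") auto
    then show "Y \<in> cube a h" unfolding cube_iff by blast
  qed
  then show ?thesis using E X(1) unfolding face_boundary_def cube_edges_def by blast
qed

lemma edges_dir_Union:
  assumes h: "0 < h"
  shows "corner_coords a h x y z \<in> \<Union>(cube_edges_dir a h 1) \<longleftrightarrow> 0 \<le> x \<and> x \<le> 1 \<and> bin y \<and> bin z"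
    and "corner_coords a h x y z \<in> \<Union>(cube_edges_dir a h 2) \<longleftrightarrow> bin x \<and> 0 \<le> y \<and> y \<le> 1 \<and> bin z"
    and "corner_coords a h x y z \<in> \<Union>(cube_edges_dir a h 3) \<longleftrightarrow> bin x \<and> bin y \<and> 0 \<le> z \<and> z \<le> 1"
proof -
  let ?X = "corner_coords a h x y z"
  have iff: "?X \<in> \<Union>(cube_edges_dir a h k) \<longleftrightarrow> (\<forall>j. j \<noteq> k \<longrightarrow> ?X$j = a$j \<or> ?X$j = a$j + h) \<and> a$k \<le> ?X$k \<and> ?X$k \<le> a$k + h" for k
  proof
    assume "?X \<in> \<Union>(cube_edges_dir a h k)"
    then obtain E where "E \<in> cube_edges_dir a h k" "?X \<in> E" by blast
    from edge_dirD[OF this(1) h this(2)] show "(\<forall>j. j \<noteq> k \<longrightarrow> ?X$j = a$j \<or> ?X$j = a$j + h) \<and> a$k \<le> ?X$k \<and> ?X$k \<le> a$k + h" by blast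
  next
    assume "(\<forall>j. j \<noteq> k \<longrightarrow> ?X$j = a$j \<or> ?X$j = a$j + h) \<and> a$k \<le> ?X$k \<and> ?X$k \<le> a$k + h"
    then have "\<exists>E\<in>cube_edges_dir a h k. ?X \<in> E \<and> ?X \<in> E" by (intro edge_through[OF h]) auto
    then show "?X \<in> \<Union>(cube_edges_dir a h k)" by blast
  qed
  have le: "h * u \<le> h \<longleftrightarrow> u \<le> 1" for u using mult_le_cancel_left_pos[OF h, of u 1] by simp
  show "?X \<in> \<Union>(cube_edges_dir a h 1) \<longleftrightarrow> 0 \<le> x \<and> x \<le> 1 \<and> bin y \<and> bin z"
    "?X \<in> \<Union>(cube_edges_dir a h 2) \<longleftrightarrow> bin x \<and> 0 \<le> y \<and> y \<le> 1 \<and> bin z"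
    "?X \<in> \<Union>(cube_edges_dir a h 3) \<longleftrightarrow> bin x \<and> bin y \<and> 0 \<le> z \<and> z \<le> 1"
    unfolding iff forall_3 bin_def using h by (auto simp: le zero_le_mult_iff)
qed

lemma trilinear_interpolation:
  assumes "\<And>x y z. g x y z = (1 - x) * g 0 y z + x * g 1 y z" "\<And>x y z. g x y z = (1 - y) * g x 0 z + y * g x 1 z"
    "\<And>x y z. g x y z = (1 - z) * g x y 0 + z * g x y 1"
  shows "g x y z = trilinear (\<lambda>i j k. g (of_bool i) (of_bool j) (of_bool k)) x y z"
proof -
  have "g x y z = (1 - x) * ((1 - y) * ((1 - z) * g 0 0 0 + z * g 0 0 1) + y * ((1 - z) * g 0 1 0 + z * g 0 1 1))
    + x * ((1 - y) * ((1 - z) * g 1 0 0 + z * g 1 0 1) + y * ((1 - z) * g 1 1 0 + z * g 1 1 1))"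
    unfolding assms(3)[of 0 0 z, symmetric] assms(3)[of 0 1 z, symmetric] assms(3)[of 1 0 z, symmetric] assms(3)[of 1 1 z, symmetric]
      assms(2)[of 0 y z, symmetric] assms(2)[of 1 y z, symmetric] by (rule assms(1))
  then show ?thesis unfolding trilinear_def vsum_def wt_def by (simp add: algebra_simps)
qed

lemma scaled_corner_coords: "h \<noteq> 0 \<Longrightarrow> scaled a h g (corner_coords a h x y z) = g x y z"
  unfolding scaled_def by simp

text \<open>In scaled coordinates a function in \<open>Q1\<close> is affine in each variable, hence
  equal to the interpolant of its corner values.\<close>

lemma Q1_trilinear:
  assumes p: "p \<in> Q1" and h: "h \<noteq> 0"
  shows "p = scaled a h (trilinear (\<lambda>i j k. p (corner_coords a h (of_bool i) (of_bool j) (of_bool k))))"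
proof
  fix X
  obtain c0 c1 c2 c3 c4 c5 c6 c7 where c: "\<And>x. p x = c0 + c1 * x$1 + c2 * x$2 + c3 * x$3 + c4 * x$1 * x$2 + c5 * x$1 * x$3
      + c6 * x$2 * x$3 + c7 * x$1 * x$2 * x$3"
    using p unfolding Q1_def by blast
  obtain x y z where X: "X = corner_coords a h x y z" using corner_coords_surj[OF h] by blast
  show "p X = scaled a h (trilinear (\<lambda>i j k. p (corner_coords a h (of_bool i) (of_bool j) (of_bool k)))) X"
    unfolding X scaled_corner_coords[OF h]
    by (rule trilinear_interpolation[of "\<lambda>x y z. p (corner_coords a h x y z)"]; unfold c corner_coords_nth; simp add: algebra_simps)
qed

text \<open>The map \<open>CT\<close> adds an affine function, so the plus piece is determined by
  its corner values as well.\<close>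

lemma Q1_add_affine:
  assumes "p \<in> Q1" shows "(\<lambda>X. p X + k * ((X - D) \<bullet> n)) \<in> Q1"
proof -
  obtain c0 c1 c2 c3 c4 c5 c6 c7 where c: "\<And>x. p x = c0 + c1 * x$1 + c2 * x$2 + c3 * x$3 + c4 * x$1 * x$2 + c5 * x$1 * x$3
      + c6 * x$2 * x$3 + c7 * x$1 * x$2 * x$3"
    using assms unfolding Q1_def by blast
  have "p x + k * ((x - D) \<bullet> n) = (c0 - k * (D \<bullet> n)) + (c1 + k * n$1) * x$1 + (c2 + k * n$2) * x$2 + (c3 + k * n$3) * x$3
      + c4 * x$1 * x$2 + c5 * x$1 * x$3 + c6 * x$2 * x$3 + c7 * x$1 * x$2 * x$3" for x
    unfolding c inner_vec_def sum_3 by (simp add: algebra_simps)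
  then show ?thesis unfolding Q1_def by blast
qed

section \<open>Cut cubes of the mesh\<close>

text \<open>The reach enters as a concrete radius \<open>r\<close>, and the mesh condition supplies
  \<open>5 * h \<le> r\<close> because \<open>3 * sqrt 3\<close> exceeds 5.\<close>

locale cut_cube =
  fixes \<Gamma> Up Um :: "pt set" and a :: pt and h r :: real
  assumes h: "0 < h" and r: "5 * h \<le> r" "reach_radius \<Gamma> r"
    and surface: "closed_C2_surface \<Gamma>"
    and sides: "open Up" "open Um" "Up \<inter> Um = {}" "Up \<union> Um = - \<Gamma>"
    and closures: "\<Gamma> \<subseteq> closure Up" "\<Gamma> \<subseteq> closure Um"
    and edge_once: "\<And>E X Y. E \<in> cube_edges a h \<Longrightarrow> X \<in> \<Gamma> \<inter> E \<Longrightarrow> Y \<in> \<Gamma> \<inter> E \<Longrightarrow> X = Y"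
    and face_twice: "\<And>F. F \<in> cube_faces a h \<Longrightarrow> finite (\<Gamma> \<inter> face_boundary a h F) \<and> card (\<Gamma> \<inter> face_boundary a h F) \<le> 2"
    and no_vertex: "cube_vertices a h \<inter> \<Gamma> = {}"
begin

abbreviation pos :: "real \<Rightarrow> real \<Rightarrow> real \<Rightarrow> pt" where "pos \<equiv> corner_coords a h"

definition cuts :: "triple set" where "cuts = {(x, y, z). pos x y z \<in> cut_points \<Gamma> a h}"

definition minus :: "bool \<Rightarrow> bool \<Rightarrow> bool \<Rightarrow> bool" where
  "minus i j k \<longleftrightarrow> pos (of_bool i) (of_bool j) (of_bool k) \<in> Um"

text \<open>No vertex lies on the surface, so a cut point is in the interior of its edge.\<close>

lemma cuts_iff: "(x, y, z) \<in> cuts \<longleftrightarrow> pos x y z \<in> \<Gamma> \<and> (x, y, z) \<in> edge_points"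
proof -
  have ex3: "(\<exists>k::3. Q k) \<longleftrightarrow> Q 1 \<or> Q 2 \<or> Q 3" for Q using exhaust_3 by metis
  have "pos x y z \<in> \<Union>(cube_edges a h) \<longleftrightarrow> (\<exists>k. pos x y z \<in> \<Union>(cube_edges_dir a h k))"
    unfolding cube_edges_def by blast
  also have "\<dots> \<longleftrightarrow> (0 \<le> x \<and> x \<le> 1 \<and> bin y \<and> bin z) \<or> (bin x \<and> 0 \<le> y \<and> y \<le> 1 \<and> bin z) \<or> (bin x \<and> bin y \<and> 0 \<le> z \<and> z \<le> 1)"
    unfolding ex3 edges_dir_Union[OF h] by blast
  finally have e: "pos x y z \<in> \<Union>(cube_edges a h) \<longleftrightarrow>
    (0 \<le> x \<and> x \<le> 1 \<and> bin y \<and> bin z) \<or> (bin x \<and> 0 \<le> y \<and> y \<le> 1 \<and> bin z) \<or> (bin x \<and> bin y \<and> 0 \<le> z \<and> z \<le> 1)" .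
  have v: "\<not> (bin x \<and> bin y \<and> bin z)" if "pos x y z \<in> \<Gamma>"
    using that no_vertex corner_coords_vertex[of h a x y z] h by auto
  have b: "bin u \<longleftrightarrow> u = 0 \<or> u = 1" for u unfolding bin_def ..
  have s: "0 \<le> u \<and> u \<le> 1 \<longleftrightarrow> (0 < u \<and> u < 1) \<or> bin u" for u unfolding b by auto
  have s': "\<not> (0 < u \<and> u < 1 \<and> bin u)" for u unfolding b by auto
  show ?thesis unfolding cuts_def mem_Collect_eq prod.case cut_points_def Int_iff e edge_points_def
    using v s[of x] s[of y] s[of z] by blast
qed

lemma cuts_range: "(x, y, z) \<in> cuts \<Longrightarrow> 0 \<le> x \<and> x \<le> 1 \<and> 0 \<le> y \<and> y \<le> 1 \<and> 0 \<le> z \<and> z \<le> 1"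
  unfolding cuts_iff edge_points_def bin_def by auto

lemma cuts_edge_unique:
  shows "(x, y, z) \<in> cuts \<Longrightarrow> (x', y, z) \<in> cuts \<Longrightarrow> bin y \<Longrightarrow> bin z \<Longrightarrow> x = x'"
    and "(x, y, z) \<in> cuts \<Longrightarrow> (x, y', z) \<in> cuts \<Longrightarrow> bin x \<Longrightarrow> bin z \<Longrightarrow> y = y'"
    and "(x, y, z) \<in> cuts \<Longrightarrow> (x, y, z') \<in> cuts \<Longrightarrow> bin x \<Longrightarrow> bin y \<Longrightarrow> z = z'"
proof -
  have key: "X = Y" if X: "\<And>j. j \<noteq> k \<Longrightarrow> X$j = a$j \<or> X$j = a$j + h" "a$k \<le> X$k" "X$k \<le> a$k + h"
    and Y: "\<And>j. j \<noteq> k \<Longrightarrow> Y$j = X$j" "a$k \<le> Y$k" "Y$k \<le> a$k + h" and G: "X \<in> \<Gamma>" "Y \<in> \<Gamma>" for X Y k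
  proof -
    obtain E where "E \<in> cube_edges_dir a h k" "X \<in> E" "Y \<in> E" using edge_through[OF h X Y] by blast
    then show ?thesis using edge_once[of E X Y] G unfolding cube_edges_def by blast
  qed
  have le: "h * u \<le> h \<longleftrightarrow> u \<le> 1" "0 \<le> h * u \<longleftrightarrow> 0 \<le> u" for u
    using mult_le_cancel_left_pos[OF h, of u 1] h by (simp_all add: zero_le_mult_iff)
  have b: "a$j + h * u = a$j \<or> a$j + h * u = a$j + h" if "bin u" for u j using that unfolding bin_def by auto
  show "x = x'" if t: "(x, y, z) \<in> cuts" "(x', y, z) \<in> cuts" "bin y" "bin z"
  proof -
    have "pos x y z = pos x' y z"
    proof (rule key[of 1])
      fix j :: 3 assume "j \<noteq> 1"
      then have "j = 2 \<or> j = 3" using exhaust_3[of j] by blast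
      then show "pos x y z $ j = a $ j \<or> pos x y z $ j = a $ j + h" "pos x' y z $ j = pos x y z $ j"
        using b[OF t(3)] b[OF t(4)] by auto
    qed (use t cuts_range[OF t(1)] cuts_range[OF t(2)] in \<open>simp_all add: cuts_iff le\<close>)
    then show ?thesis using h by (simp add: corner_coords_eq_iff)
  qed
  show "y = y'" if t: "(x, y, z) \<in> cuts" "(x, y', z) \<in> cuts" "bin x" "bin z"
  proof -
    have "pos x y z = pos x y' z"
    proof (rule key[of 2])
      fix j :: 3 assume "j \<noteq> 2"
      then have "j = 1 \<or> j = 3" using exhaust_3[of j] by blast
      then show "pos x y z $ j = a $ j \<or> pos x y z $ j = a $ j + h" "pos x y' z $ j = pos x y z $ j"
        using b[OF t(3)] b[OF t(4)] by auto
    qed (use t cuts_range[OF t(1)] cuts_range[OF t(2)] in \<open>simp_all add: cuts_iff le\<close>)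
    then show ?thesis using h by (simp add: corner_coords_eq_iff)
  qed
  show "z = z'" if t: "(x, y, z) \<in> cuts" "(x, y, z') \<in> cuts" "bin x" "bin y"
  proof -
    have "pos x y z = pos x y z'"
    proof (rule key[of 3])
      fix j :: 3 assume "j \<noteq> 3"
      then have "j = 1 \<or> j = 2" using exhaust_3[of j] by blast
      then show "pos x y z $ j = a $ j \<or> pos x y z $ j = a $ j + h" "pos x y z' $ j = pos x y z $ j"
        using b[OF t(3)] b[OF t(4)] by auto
    qed (use t cuts_range[OF t(1)] cuts_range[OF t(2)] in \<open>simp_all add: cuts_iff le\<close>)
    then show ?thesis using h by (simp add: corner_coords_eq_iff)
  qed
qed

lemma vertex_side: "bin x \<Longrightarrow> bin y \<Longrightarrow> bin z \<Longrightarrow> pos x y z \<notin> \<Gamma>"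
  using no_vertex corner_coords_vertex[of h a x y z] h by auto

text \<open>A segment missing the surface would be disconnected by the two open sides.\<close>

lemma segment_cut:
  assumes "v \<in> Um \<longleftrightarrow> w \<notin> Um" "v \<notin> \<Gamma>" "w \<notin> \<Gamma>"
  shows "\<exists>t. 0 \<le> t \<and> t \<le> 1 \<and> (1 - t) *\<^sub>R v + t *\<^sub>R w \<in> \<Gamma>"
proof (rule ccontr)
  assume "\<not> ?thesis"
  then have "closed_segment v w \<inter> \<Gamma> = {}" unfolding closed_segment_def by auto
  moreover have "v \<in> closed_segment v w" "w \<in> closed_segment v w" by auto
  ultimately show False
    using connectedD[OF connected_segment(1)[of v w] sides(1,2)] sides(3,4) assms by blast
qed

lemma cuts_crossing:
  shows "minus False j k \<noteq> minus True j k \<Longrightarrow> \<exists>x. (x, of_bool j, of_bool k) \<in> cuts"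
    and "minus i False k \<noteq> minus i True k \<Longrightarrow> \<exists>y. (of_bool i, y, of_bool k) \<in> cuts"
    and "minus i j False \<noteq> minus i j True \<Longrightarrow> \<exists>z. (of_bool i, of_bool j, z) \<in> cuts"
proof -
  have bin_of_bool: "bin (of_bool b)" for b unfolding bin_def by simp
  have range: "bin t \<or> (0 < t \<and> t < 1)" if "0 \<le> t" "t \<le> 1" for t using that unfolding bin_def by auto
  have cut: "(t, of_bool j, of_bool k) \<in> cuts" if "0 \<le> t" "t \<le> 1" "pos t (of_bool j) (of_bool k) \<in> \<Gamma>" for t j k
    using that vertex_side[of t "of_bool j" "of_bool k"] unfolding cuts_iff edge_points_def mem_Collect_eq prod.case using bin_of_bool range by blast
  have cut2: "(of_bool i, t, of_bool k) \<in> cuts" if "0 \<le> t" "t \<le> 1" "pos (of_bool i) t (of_bool k) \<in> \<Gamma>" for t i k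
    using that vertex_side[of "of_bool i" t "of_bool k"] unfolding cuts_iff edge_points_def mem_Collect_eq prod.case using bin_of_bool range by blast
  have cut3: "(of_bool i, of_bool j, t) \<in> cuts" if "0 \<le> t" "t \<le> 1" "pos (of_bool i) (of_bool j) t \<in> \<Gamma>" for t i j
    using that vertex_side[of "of_bool i" "of_bool j" t] unfolding cuts_iff edge_points_def mem_Collect_eq prod.case using bin_of_bool range by blast
  show "\<exists>x. (x, of_bool j, of_bool k) \<in> cuts" if m: "minus False j k \<noteq> minus True j k"
  proof -
    have "\<exists>t. 0 \<le> t \<and> t \<le> 1 \<and> (1 - t) *\<^sub>R pos 0 (of_bool j) (of_bool k) + t *\<^sub>R pos 1 (of_bool j) (of_bool k) \<in> \<Gamma>"
      by (rule segment_cut) (use m vertex_side in \<open>auto simp: minus_def\<close>)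
    moreover have "(1 - t) *\<^sub>R pos 0 (of_bool j) (of_bool k) + t *\<^sub>R pos 1 (of_bool j) (of_bool k) = (pos t (of_bool j) (of_bool k))" (is "_ = ?p t") for t
      unfolding vec_eq_iff forall_3 by (simp add: algebra_simps)
    ultimately obtain t where "0 \<le> t" "t \<le> 1" "?p t \<in> \<Gamma>" by metis
    then show ?thesis by (intro exI) (rule cut)
  qed
  show "\<exists>y. (of_bool i, y, of_bool k) \<in> cuts" if m: "minus i False k \<noteq> minus i True k"
  proof -
    have "\<exists>t. 0 \<le> t \<and> t \<le> 1 \<and> (1 - t) *\<^sub>R pos (of_bool i) 0 (of_bool k) + t *\<^sub>R pos (of_bool i) 1 (of_bool k) \<in> \<Gamma>"
      by (rule segment_cut) (use m vertex_side in \<open>auto simp: minus_def\<close>)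
    moreover have "(1 - t) *\<^sub>R pos (of_bool i) 0 (of_bool k) + t *\<^sub>R pos (of_bool i) 1 (of_bool k) = (pos (of_bool i) t (of_bool k))" (is "_ = ?p t") for t
      unfolding vec_eq_iff forall_3 by (simp add: algebra_simps)
    ultimately obtain t where "0 \<le> t" "t \<le> 1" "?p t \<in> \<Gamma>" by metis
    then show ?thesis by (intro exI) (rule cut2)
  qed
  show "\<exists>z. (of_bool i, of_bool j, z) \<in> cuts" if m: "minus i j False \<noteq> minus i j True"
  proof -
    have "\<exists>t. 0 \<le> t \<and> t \<le> 1 \<and> (1 - t) *\<^sub>R pos (of_bool i) (of_bool j) 0 + t *\<^sub>R pos (of_bool i) (of_bool j) 1 \<in> \<Gamma>"
      by (rule segment_cut) (use m vertex_side in \<open>auto simp: minus_def\<close>)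
    moreover have "(1 - t) *\<^sub>R pos (of_bool i) (of_bool j) 0 + t *\<^sub>R pos (of_bool i) (of_bool j) 1 = (pos (of_bool i) (of_bool j) t)" (is "_ = ?p t") for t
      unfolding vec_eq_iff forall_3 by (simp add: algebra_simps)
    ultimately obtain t where "0 \<le> t" "t \<le> 1" "?p t \<in> \<Gamma>" by metis
    then show ?thesis by (intro exI) (rule cut3)
  qed
qed

text \<open>The tangent balls have radius at least \<open>5 * h\<close>; dividing by
  \<open>h\<close>, a point outside them satisfies \<open>near\<close>. A ball lies on one side, so
  it contains no vertex of the other side and no cut point.\<close>

lemma cuts_supported:
  assumes "(x, y, z) \<in> cuts" shows "supported cuts minus (x, y, z)"
proof -
  have X: "pos x y z \<in> \<Gamma>" using assms unfolding cuts_iff by blast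
  have r0: "0 < r" using r h by linarith
  obtain n where n: "norm n = 1" "ball (pos x y z + r *\<^sub>R n) r \<subseteq> Um" "ball (pos x y z - r *\<^sub>R n) r \<subseteq> Up"
    using normal_balls_sides[OF surface r(2) X sides] X closures by blast
  have near: "near (m$1) (m$2) (m$3) (x' - x) (y' - y) (z' - z)"
    if m: "norm m = 1" and out: "pos x' y' z' \<notin> ball (pos x y z + r *\<^sub>R m) r" for m x' y' z'
  proof -
    define u where "u = pos x' y' z' - pos x y z"
    have "r \<le> norm (u - r *\<^sub>R m)" using out unfolding u_def by (simp add: dist_norm norm_minus_commute algebra_simps)
    then have "r\<^sup>2 \<le> (norm (u - r *\<^sub>R m))\<^sup>2" using r0 by (intro power_mono) auto
    also have "\<dots> = (norm u)\<^sup>2 - 2 * r * (u \<bullet> m) + r\<^sup>2 * (m \<bullet> m)"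
      unfolding power2_norm_eq_inner by (simp add: inner_diff_left inner_diff_right inner_commute[of m u] power2_eq_square algebra_simps)
    finally have le: "2 * r * (u \<bullet> m) \<le> (norm u)\<^sup>2" using m by (simp add: norm_eq_1)
    define A B where "A = m$1 * (x' - x) + m$2 * (y' - y) + m$3 * (z' - z)" and "B = (x' - x)\<^sup>2 + (y' - y)\<^sup>2 + (z' - z)\<^sup>2"
    have AB: "u \<bullet> m = h * A" "(norm u)\<^sup>2 = h\<^sup>2 * B"
      unfolding u_def A_def B_def by (rule inner_corner_coords_diff, rule norm_corner_coords_diff)
    have "h * (2 * r * A) \<le> h * (h * B)" using le unfolding AB by (simp add: power2_eq_square mult_ac)
    then have rA: "2 * r * A \<le> h * B" using h by (simp only: mult_le_cancel_left_pos)
    have B0: "0 \<le> B" unfolding B_def by simp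
    \<comment> \<open>Passing from \<open>r\<close> to \<open>5 * h\<close> requires a nonnegative
      \<open>A\<close>; for negative \<open>A\<close> the claim holds since \<open>B\<close> is
      nonnegative.\<close>
    have "A \<le> B / 10"
    proof (cases "0 \<le> A")
      case True
      have "h * (10 * A) \<le> 2 * r * A" using mult_right_mono[OF r(1) True] by (simp add: mult_ac)
      with rA have "h * (10 * A) \<le> h * B" by linarith
      then show ?thesis using h by (simp add: mult_le_cancel_left_pos)
    qed (use B0 in auto)
    then show ?thesis unfolding near_def A_def B_def .
  qed
  have out: "pos x' y' z' \<notin> ball (pos x y z + r *\<^sub>R n) r" if "pos x' y' z' \<notin> Um" for x' y' z' using n(2) that by blast
  have out': "pos x' y' z' \<notin> ball (pos x y z + r *\<^sub>R (- n)) r" if "pos x' y' z' \<notin> Up" for x' y' z' using n(3) that by auto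
  have n': "norm (- n) = 1" using n(1) by simp
  have G: "pos x' y' z' \<notin> Um" "pos x' y' z' \<notin> Up" if "(x', y', z') \<in> cuts" for x' y' z'
    using that sides(4) unfolding cuts_iff by auto
  show ?thesis
  proof (rule supportedI[of "n$1" "n$2" "n$3"])
    show "(n$1)\<^sup>2 + (n$2)\<^sup>2 + (n$3)\<^sup>2 = 1"
      using n(1) unfolding norm_eq_1 inner_vec_def sum_3 by (simp add: power2_eq_square)
    fix i j k
    show "near (- n$1) (- n$2) (- n$3) (of_bool i - x) (of_bool j - y) (of_bool k - z)" if "minus i j k"
    proof -
      have "pos (of_bool i) (of_bool j) (of_bool k) \<notin> Up" using that sides(3) unfolding minus_def by blast
      from near[OF n' out'[OF this]] show ?thesis by (simp only: vector_uminus_component)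
    qed
    show "near (n$1) (n$2) (n$3) (of_bool i - x) (of_bool j - y) (of_bool k - z)" if "\<not> minus i j k"
      by (rule near[OF n(1) out]) (use that in \<open>simp only: minus_def not_False_eq_True\<close>)
  next
    fix x' y' z' assume "(x', y', z') \<in> cuts"
    from near[OF n(1) out[OF G(1)[OF this]]] near[OF n' out'[OF G(2)[OF this]]]
    show "near (n$1) (n$2) (n$3) (x' - x) (y' - y) (z' - z)" "near (- n$1) (- n$2) (- n$3) (x' - x) (y' - y) (z' - z)" by simp_all
  qed
qed

definition point :: "triple \<Rightarrow> pt" where "point = (\<lambda>(x, y, z). pos x y z)"

lemma point_eq [simp]: "point (x, y, z) = pos x y z"
  unfolding point_def by simp

lemma inj_point: "inj point"
  unfolding inj_def point_def using h by (auto simp: corner_coords_eq_iff)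

lemma surj_point: "surj point"
  unfolding surj_def using corner_coords_surj[of h _ a] h by force

lemma cut_points_eq: "cut_points \<Gamma> a h = point ` cuts"
proof
  show "point ` cuts \<subseteq> cut_points \<Gamma> a h" unfolding cuts_def by auto
  show "cut_points \<Gamma> a h \<subseteq> point ` cuts"
  proof
    fix X assume X: "X \<in> cut_points \<Gamma> a h"
    obtain x y z where "X = pos x y z" using corner_coords_surj[of h X a] h by auto
    then show "X \<in> point ` cuts" using X unfolding cuts_def by (intro image_eqI[of _ _ "(x, y, z)"]) auto
  qed
qed

lemma edge_pointsE:
  assumes "(x, y, z) \<in> edge_points"
  obtains "0 < x" "x < 1" "bin y" "bin z" | "bin x" "0 < y" "y < 1" "bin z" | "bin x" "bin y" "0 < z" "z < 1"
  using assms unfolding edge_points_def by blast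

text \<open>The edge through the point cannot run in direction \<open>k\<close>, since then
  coordinate \<open>k\<close> would lie strictly inside the cube; so the edge belongs to the
  boundary of the face.\<close>

lemma cuts_face:
  assumes t: "(x, y, z) \<in> cuts" and c: "bin c" "pos x y z $ k = a$k + h * c"
  shows "pos x y z \<in> \<Gamma> \<inter> face_boundary a h {X \<in> cube a h. X$k = a$k + h * c}"
proof -
  have G: "pos x y z \<in> \<Gamma>" and e: "(x, y, z) \<in> edge_points" using t unfolding cuts_iff by blast+
  have "\<exists>l E. E \<in> cube_edges_dir a h l \<and> pos x y z \<in> E \<and> l \<noteq> k"
  proof (rule edge_pointsE[OF e])
    assume r: "0 < x" "x < 1" "bin y" "bin z"
    then have "pos x y z \<in> \<Union>(cube_edges_dir a h 1)" unfolding edges_dir_Union(1)[OF h] by simp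
    moreover have "k \<noteq> 1" using c r h unfolding bin_def by auto
    ultimately show ?thesis by blast
  next
    assume r: "bin x" "0 < y" "y < 1" "bin z"
    then have "pos x y z \<in> \<Union>(cube_edges_dir a h 2)" unfolding edges_dir_Union(2)[OF h] by simp
    moreover have "k \<noteq> 2" using c r h unfolding bin_def by auto
    ultimately show ?thesis by blast
  next
    assume r: "bin x" "bin y" "0 < z" "z < 1"
    then have "pos x y z \<in> \<Union>(cube_edges_dir a h 3)" unfolding edges_dir_Union(3)[OF h] by simp
    moreover have "k \<noteq> 3" using c r h unfolding bin_def by auto
    ultimately show ?thesis by blast
  qed
  then show ?thesis using face_boundaryI[OF _ h _ c(2)] G by blast
qed

lemma face_mem: "bin c \<Longrightarrow> {X \<in> cube a h. X$k = a$k + h * c} \<in> cube_faces a h"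
proof -
  assume "bin c"
  then have "a$k + h * c = a$k \<or> a$k + h * c = a$k + h" unfolding bin_def by auto
  then show ?thesis unfolding cube_faces_def by blast
qed

lemma cofaceE:
  assumes "coface S"
  obtains c k where "bin c" "\<forall>t\<in>S. point t $ k = a$k + h * c"
proof -
  obtain c where c: "bin c" "(\<forall>(x, y, z)\<in>S. x = c) \<or> (\<forall>(x, y, z)\<in>S. y = c) \<or> (\<forall>(x, y, z)\<in>S. z = c)"
    using assms unfolding coface_def by blast
  then consider "\<forall>t\<in>S. point t $ 1 = a$1 + h * c" | "\<forall>t\<in>S. point t $ 2 = a$2 + h * c" | "\<forall>t\<in>S. point t $ 3 = a$3 + h * c"
    unfolding point_def by fastforce
  then show thesis using that c(1) by cases blast+
qed

text \<open>Three cut points on a common face would be three surface points on its boundary, against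
  \<open>face_twice\<close>.\<close>

lemma cuts_coface:
  assumes t: "p \<in> cuts" "q \<in> cuts" "u \<in> cuts" and d: "p \<noteq> q" "p \<noteq> u" "q \<noteq> u"
  shows "\<not> coface {p, q, u}"
proof
  assume "coface {p, q, u}"
  then obtain c k where c: "bin c" "\<forall>t\<in>{p, q, u}. point t $ k = a$k + h * c" by (rule cofaceE)
  define F where "F = {X \<in> cube a h. X$k = a$k + h * c}"
  have "point t \<in> \<Gamma> \<inter> face_boundary a h F" if s: "t \<in> {p, q, u}" for t
  proof -
    obtain x y z where xyz: "t = (x, y, z)" by (cases t)
    have "t \<in> cuts" using s t by blast
    then show ?thesis using cuts_face[of x y z c k] c(1) bspec[OF c(2) s] unfolding xyz F_def by simp
  qed
  then have "{point p, point q, point u} \<subseteq> \<Gamma> \<inter> face_boundary a h F" by blast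
  moreover have "finite (\<Gamma> \<inter> face_boundary a h F)" "card (\<Gamma> \<inter> face_boundary a h F) \<le> 2"
    using face_twice face_mem[OF c(1)] unfolding F_def by blast+
  ultimately have "card {point p, point q, point u} \<le> 2" using card_mono le_trans by blast
  moreover have "point p \<noteq> point q" "point p \<noteq> point u" "point q \<noteq> point u" using d inj_point unfolding inj_def by blast+
  ultimately show False by simp
qed

lemma cut_config_cuts: "cut_config cuts minus"
proof (rule cut_configI)
  show "cuts \<subseteq> edge_points" using cuts_iff by auto
  show "supported cuts minus t" if "t \<in> cuts" for t using that cuts_supported by (cases t) blast
qed (fact cuts_edge_unique cuts_crossing cuts_coface)+

lemma edges_dir_triples:
  obtains S where "S \<in> {edges1, edges2, edges3}"
    "\<forall>t\<in>cuts. t \<in> S \<longleftrightarrow> point t \<in> \<Union>(cube_edges_dir a h k)"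
proof -
  have "(x, y, z) \<in> edges1 \<longleftrightarrow> point (x, y, z) \<in> \<Union>(cube_edges_dir a h 1)"
    "(x, y, z) \<in> edges2 \<longleftrightarrow> point (x, y, z) \<in> \<Union>(cube_edges_dir a h 2)"
    "(x, y, z) \<in> edges3 \<longleftrightarrow> point (x, y, z) \<in> \<Union>(cube_edges_dir a h 3)" if "(x, y, z) \<in> cuts" for x y z
    using cuts_range[OF that] unfolding point_eq edges_dir_Union[OF h] edges1_def edges2_def edges3_def by auto
  then have e: "t \<in> edges1 \<longleftrightarrow> point t \<in> \<Union>(cube_edges_dir a h 1)"
    "t \<in> edges2 \<longleftrightarrow> point t \<in> \<Union>(cube_edges_dir a h 2)"
    "t \<in> edges3 \<longleftrightarrow> point t \<in> \<Union>(cube_edges_dir a h 3)" if "t \<in> cuts" for t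
    using that by (cases t; blast)+
  consider "k = 1" | "k = 2" | "k = 3" using exhaust_3[of k] by blast
  then show thesis
  proof cases
    case 1 show ?thesis by (rule that[of edges1]) (use e(1) 1 in auto)
  next
    case 2 show ?thesis by (rule that[of edges2]) (use e(2) 2 in auto)
  next
    case 3 show ?thesis by (rule that[of edges3]) (use e(3) 3 in auto)
  qed
qed

text \<open>Each alternative of the selection rule is relaxed. If all cut points or all but one are
  selected, there are at most four; the alternatives with parallel edges become statements about an
  edge family, and the alternating choice becomes the absence of common faces.\<close>

lemma admissible_triple_of_K:
  assumes K: "admissible_K \<Gamma> a h (point ` S)"
  shows "admissible_triple cuts S"
proof -
  note image_eq = inj_image_eq_iff[OF inj_point] inj_image_mem_iff[OF inj_point]
  have cards: "card (point ` A) = card A" for A using inj_point by (simp add: card_image inj_on_subset)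
  have S: "S \<subseteq> cuts" "card S = 3"
    using K unfolding admissible_K_def Let_def cut_points_eq cards inj_image_subset_iff[OF inj_point] by blast+
  from K have "card cuts \<le> 4 \<or> (\<exists>E\<in>{edges1, edges2, edges3}. cuts \<subseteq> E \<or> S = cuts \<inter> E) \<or>
      (\<forall>p\<in>S. \<forall>q\<in>S. p \<noteq> q \<longrightarrow> \<not> coface {p, q})"
    unfolding admissible_K_def Let_def cut_points_eq
  proof (elim disjE conjE bexE exE)
    assume "point ` S = point ` cuts"
    then show ?thesis using S(2) unfolding image_eq by simp
  next
    fix v w q assume "q \<in> point ` cuts" "point ` S = point ` cuts - {q}"
    then have "point ` cuts = insert q (point ` S)" by blast
    moreover have "finite (point ` S)" using S(2) card_ge_0_finite[of S] by simp
    ultimately have "card (point ` cuts) \<le> Suc (card (point ` S))" by (simp only: card_insert_if split: if_split) simp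
    then show ?thesis using S(2) unfolding cards by simp
  next
    fix k assume dir: "cut_edges \<Gamma> a h \<subseteq> cube_edges_dir a h k"
    obtain E where E: "E \<in> {edges1, edges2, edges3}" "\<forall>t\<in>cuts. t \<in> E \<longleftrightarrow> point t \<in> \<Union>(cube_edges_dir a h k)"
      by (rule edges_dir_triples[of k])
    have "t \<in> E" if t: "t \<in> cuts" for t
    proof -
      have "point t \<in> \<Gamma> \<inter> \<Union>(cube_edges a h)" using t cut_points_eq unfolding cut_points_def by blast
      then have "point t \<in> \<Union>(cut_edges \<Gamma> a h)" unfolding cut_edges_def by blast
      then show ?thesis using dir bspec[OF E(2) t] by blast
    qed
    then show ?thesis using E(1) by blast
  next
    fix k assume dir: "point ` S = point ` cuts \<inter> \<Union>(cube_edges_dir a h k)"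
    obtain E where E: "E \<in> {edges1, edges2, edges3}" "\<forall>t\<in>cuts. t \<in> E \<longleftrightarrow> point t \<in> \<Union>(cube_edges_dir a h k)"
      by (rule edges_dir_triples[of k])
    have "t \<in> S \<longleftrightarrow> t \<in> cuts \<and> t \<in> E" for t
    proof -
      have "point t \<in> point ` S \<longleftrightarrow> point t \<in> point ` cuts \<and> point t \<in> \<Union>(cube_edges_dir a h k)" unfolding dir by blast
      then show ?thesis unfolding image_eq using E(2) by blast
    qed
    then have "S = cuts \<inter> E" by blast
    then show ?thesis using E(1) by blast
  next
    assume six: "\<forall>p\<in>point ` S. \<forall>q\<in>point ` S. p \<noteq> q \<longrightarrow> \<not> (\<exists>F\<in>cube_faces a h. p \<in> F \<and> q \<in> F)"
    have "\<not> coface {p, q}" if pq: "p \<in> S" "q \<in> S" "p \<noteq> q" for p q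
    proof
      assume "coface {p, q}"
      then obtain c k where c: "bin c" "\<forall>t\<in>{p, q}. point t $ k = a$k + h * c" by (rule cofaceE)
      have "point t \<in> {X \<in> cube a h. X$k = a$k + h * c}" if t: "t \<in> {p, q}" for t
      proof -
        obtain x y z where xyz: "t = (x, y, z)" by (cases t)
        have "(x, y, z) \<in> edge_points" using t pq S(1) cuts_iff unfolding xyz by blast
        then have "pos x y z \<in> cube a h" unfolding corner_coords_cube[OF h] edge_points_def bin_def by auto
        then show ?thesis using bspec[OF c(2) t] unfolding xyz by simp
      qed
      moreover have "point p \<noteq> point q" using pq(3) inj_point unfolding inj_def by blast
      ultimately show False using six pq face_mem[OF c(1)] by blast
    qed
    then show ?thesis by blast
  qed
  then show ?thesis using S unfolding admissible_triple_def by blast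
qed

abbreviation corner :: "bool \<Rightarrow> bool \<Rightarrow> bool \<Rightarrow> pt" where
  "corner i j k \<equiv> pos (of_bool i) (of_bool j) (of_bool k)"

text \<open>The factor \<open>h\<close> converts the normal derivative to unit-cube
  coordinates.\<close>

lemma gradient_normal:
  assumes p: "p = scaled a h (trilinear c)" "\<And>i j k. \<bar>c i j k\<bar> \<le> M"
  shows "h * (gradv p (pos x y z) \<bullet> n) = vsum (\<lambda>i j k. True) (\<lambda>i j k. c i j k * slope x y z (n$1) (n$2) (n$3) i j k)"
proof -
  have "p = (\<lambda>X. 1 * scaled a h (trilinear c) X)" unfolding p(1) by simp
  then have "pd i p = (\<lambda>X. 1 / h * scaled a h (difference i (trilinear c)) X)" for i
    using pd_scaled[OF trilinear_multiaffine[OF p(2)] h, of i 1] by (simp only:)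
  then have pd: "h * pd i p (pos x y z) = difference i (trilinear c) x y z" for i
    using h by (simp add: scaled_corner_coords)
  show ?thesis
    unfolding slope_trilinear pd[symmetric] gradv_def inner_vec_def sum_3 by (simp add: algebra_simps)
qed

lemma centroid_coords:
  assumes "card S = 3"
  shows "(1/3) *\<^sub>R \<Sum>(point ` S) = pos ((\<Sum>(x, y, z)\<in>S. x) / 3) ((\<Sum>(x, y, z)\<in>S. y) / 3) ((\<Sum>(x, y, z)\<in>S. z) / 3)"
proof -
  have "\<Sum>(point ` S) = sum point S"
    using sum.reindex[of point S "\<lambda>x. x"] inj_on_subset[OF inj_point] by simp
  then have e: "((1/3) *\<^sub>R \<Sum>(point ` S)) $ i = (\<Sum>t\<in>S. point t $ i) / 3" for i by simp
  have "(\<Sum>t\<in>S. point t $ 1) = (\<Sum>(x, y, z)\<in>S. a$1 + h * x)" "(\<Sum>t\<in>S. point t $ 2) = (\<Sum>(x, y, z)\<in>S. a$2 + h * y)"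
    "(\<Sum>t\<in>S. point t $ 3) = (\<Sum>(x, y, z)\<in>S. a$3 + h * z)"
    unfolding point_def by (auto intro!: sum.cong)
  then show ?thesis
    unfolding vec_eq_iff forall_3 e using assms by (simp add: sum.distrib case_prod_beta add_divide_distrib sum_distrib_left)
qed

lemma mean_bounds:
  fixes f :: "triple \<Rightarrow> real"
  assumes "card S = 3" "\<And>t. t \<in> S \<Longrightarrow> 0 \<le> f t \<and> f t \<le> 1"
  shows "0 \<le> sum f S / 3" "sum f S / 3 \<le> 1"
  using sum_nonneg[of S f] sum_bounded_above[of S f 1] assms by auto

text \<open>In unit-cube coordinates this is the situation of \<open>nodal_bounds\<close>: the
  corner values of \<open>p\<close> and \<open>q\<close> differ by
  \<open>(1 - \<rho>) * \<sigma>\<close> times the level, and \<open>all_stable\<close> provides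
  coercivity at the centroid. Bounds on corner values control the trilinear pieces on the
  neighbouring cubes too.\<close>

lemma shape_function_bounds:
  assumes K: "admissible_K \<Gamma> a h K" and n: "norm n = 1" "\<forall>P\<in>K. \<forall>Q\<in>K. (P - Q) \<bullet> n = 0" and D: "D \<in> K"
    and b: "0 < bm" "bm \<le> bp" and p: "p \<in> Q1" and q: "q = CT bp bm ((1/3) *\<^sub>R (\<Sum>K)) n D p"
    and nodal: "\<And>i j k. \<bar>if corner i j k \<in> Um then p (corner i j k) else q (corner i j k)\<bar> \<le> 1"
  shows "multiaffine (64 * 12001) (trilinear (\<lambda>i j k. q (corner i j k)))" "q = scaled a h (trilinear (\<lambda>i j k. q (corner i j k)))"
    and "multiaffine (64 * (49 * (bp / bm))) (trilinear (\<lambda>i j k. p (corner i j k)))" "p = scaled a h (trilinear (\<lambda>i j k. p (corner i j k)))"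
proof -
  have h0: "h \<noteq> 0" using h by simp
  define S where "S = point -` K"
  have KS: "K = point ` S" unfolding S_def using surj_image_vimage_eq[OF surj_point] by simp
  have adm: "admissible_triple cuts S" using admissible_triple_of_K K unfolding KS by blast
  have S: "S \<subseteq> cuts" "card S = 3" using adm unfolding admissible_triple_def by blast+
  have range: "0 \<le> x \<and> x \<le> 1 \<and> 0 \<le> y \<and> y \<le> 1 \<and> 0 \<le> z \<and> z \<le> 1" if "(x, y, z) \<in> S" for x y z
    using cuts_range[OF subsetD[OF S(1) that]] .
  define x y z where "x = (\<Sum>(x, y, z)\<in>S. x) / 3" and "y = (\<Sum>(x, y, z)\<in>S. y) / 3" and "z = (\<Sum>(x, y, z)\<in>S. z) / 3"
  have F: "0 \<le> x" "x \<le> 1" "0 \<le> y" "y \<le> 1" "0 \<le> z" "z \<le> 1"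
    unfolding x_def y_def z_def by (rule mean_bounds[OF S(2)]; use range in auto)+
  have centroid: "(1/3) *\<^sub>R (\<Sum>K) = pos x y z" unfolding KS x_def y_def z_def by (rule centroid_coords[OF S(2)])
  obtain u v w where uvw: "D = pos u v w" "(u, v, w) \<in> S" using D unfolding KS by auto
  define d where "d = n$1 * u + n$2 * v + n$3 * w"
  have unit: "(n$1)\<^sup>2 + (n$2)\<^sup>2 + (n$3)\<^sup>2 = 1"
    using n(1) unfolding norm_eq_1 inner_vec_def sum_3 by (simp add: power2_eq_square)
  have "n$1 * x' + n$2 * y' + n$3 * z' = d" if "(x', y', z') \<in> S" for x' y' z'
  proof -
    have "pos x' y' z' \<in> K" using that unfolding KS by force
    then have "(pos x' y' z' - pos u v w) \<bullet> n = 0" using n(2) D uvw(1) by blast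
    then have "n$1 * (x' - u) + n$2 * (y' - v) + n$3 * (z' - w) = 0" using h0 unfolding inner_corner_coords_diff by simp
    then show ?thesis unfolding d_def by (simp add: algebra_simps)
  qed
  then have plane: "\<forall>(x', y', z')\<in>S. n$1 * x' + n$2 * y' + n$3 * z' = d" by auto
  have "centroid_bicoercive minus S" using all_stable[of minus] cut_config_cuts adm unfolding stable_def by blast
  then have "bicoercive minus x y z (n$1) (n$2) (n$3) d"
    unfolding centroid_bicoercive_def x_def y_def z_def using unit plane by simp
  then have coercive: "coercive minus x y z (n$1) (n$2) (n$3) d" unfolding bicoercive_def by blast
  define c where "c = (\<lambda>i j k. p (corner i j k))"
  have p_eq: "p = scaled a h (trilinear c)" unfolding c_def by (rule Q1_trilinear[OF p h0])
  then show "p = scaled a h (trilinear (\<lambda>i j k. p (corner i j k)))" unfolding c_def .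
  \<comment> \<open>A preliminary bound, depending on \<open>p\<close>, that makes the interpolant
    multiaffine so that it can be differentiated.\<close>
  define M where "M = vsum (\<lambda>i j k. True) (\<lambda>i j k. \<bar>c i j k\<bar>)"
  have M: "\<bar>c i j k\<bar> \<le> M" for i j k unfolding M_def using vsum_member_le[of "\<lambda>i j k. \<bar>c i j k\<bar>"] by simp
  define \<rho> where "\<rho> = bm / bp"
  have \<rho>: "0 < \<rho>" "\<rho> \<le> 1" unfolding \<rho>_def using b by simp_all
  define \<sigma> where "\<sigma> = h * (gradv p (pos x y z) \<bullet> n)"
  have \<sigma>: "\<sigma> = vsum (\<lambda>i j k. True) (\<lambda>i j k. c i j k * slope x y z (n$1) (n$2) (n$3) i j k)"
    unfolding \<sigma>_def by (rule gradient_normal[OF p_eq M])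
  have q_eq: "q = (\<lambda>X. p X + (\<rho> - 1) * (gradv p (pos x y z) \<bullet> n) * ((X - D) \<bullet> n))"
    unfolding q CT_def centroid \<rho>_def ..
  have "q \<in> Q1" unfolding q_eq by (rule Q1_add_affine[OF p])
  then show "q = scaled a h (trilinear (\<lambda>i j k. q (corner i j k)))" by (rule Q1_trilinear[OF _ h0])
  have level: "(corner i j k - D) \<bullet> n = h * lev (n$1) (n$2) (n$3) d i j k" for i j k
    unfolding uvw(1) inner_corner_coords_diff lev_def d_def by (simp add: algebra_simps)
  have qc: "q (corner i j k) = c i j k - (1 - \<rho>) * \<sigma> * lev (n$1) (n$2) (n$3) d i j k" for i j k
    unfolding q_eq level c_def \<sigma>_def by (simp add: algebra_simps)
  \<comment> \<open>The nodal values of the shape function, each read from the piece on the side of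
    its vertex.\<close>
  define e where "e = (\<lambda>i j k. if minus i j k then c i j k else q (corner i j k))"
  have e: "\<bar>e i j k\<bar> \<le> 1" for i j k using nodal[of i j k] unfolding e_def c_def minus_def .
  have c_eq: "c i j k = e i j k + (if minus i j k then 0 else (1 - \<rho>) * \<sigma> * lev (n$1) (n$2) (n$3) d i j k)" for i j k
    unfolding e_def qc by simp
  have uvw_range: "0 \<le> u" "u \<le> 1" "0 \<le> v" "v \<le> 1" "0 \<le> w" "w \<le> 1" using range[OF uvw(2)] by blast+
  note bounds = nodal_bounds[OF \<rho> unit F d_def uvw_range coercive \<sigma> e c_eq]
  show "multiaffine (64 * 12001) (trilinear (\<lambda>i j k. q (corner i j k)))"
    by (rule trilinear_multiaffine) (unfold qc, rule bounds(1))
  have "49 * (bp / bm) = 49 / \<rho>" unfolding \<rho>_def by simp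
  then show "multiaffine (64 * (49 * (bp / bm))) (trilinear (\<lambda>i j k. p (corner i j k)))"
    using bounds(2) by (intro trilinear_multiaffine) (simp add: c_def)
qed

end

section \<open>The bounds on the patch of neighbouring cubes\<close>

lemma neighbour_cube_bounds:
  assumes "x \<in> cube b h" "cube b h \<inter> cube a h \<noteq> {}"
  shows "a$i - h \<le> x$i" "x$i \<le> a$i + 2 * h"
proof -
  obtain y where y: "y \<in> cube b h" "y \<in> cube a h" using assms(2) by blast
  have "b$i \<le> x$i \<and> x$i \<le> b$i + h" "b$i \<le> y$i \<and> y$i \<le> b$i + h" "a$i \<le> y$i \<and> y$i \<le> a$i + h"
    using assms(1) y unfolding cube_iff by blast+
  then show "a$i - h \<le> x$i" "x$i \<le> a$i + 2 * h" by linarith+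
qed

text \<open>The shape function appears as a pair of pieces \<open>p\<close> and \<open>q\<close>
  with the prescribed nodal values, and its seminorms as pointwise bounds on these pieces and all
  their partial derivatives.\<close>

theorem theorem4p8:
  shows "\<exists>C::real. \<forall>(\<Omega>::pt set) (\<Gamma>::pt set) (Up::pt set) (Um::pt set) (bp::real) (bm::real)
            (h::real) (z0::pt) (Cs::pt set).
    open \<Omega> \<and> connected \<Omega> \<and> finite Cs \<and> h > 0 \<and>
    (\<forall>a\<in>Cs. \<forall>i. \<exists>k::int. a$i = z0$i + of_int k * h) \<and>
    closure \<Omega> = (\<Union>a\<in>Cs. cube a h) \<and>
    closed_C2_surface \<Gamma> \<and> \<Gamma> \<subseteq> \<Omega> \<and>
    open Up \<and> open Um \<and> Up \<inter> Um = {} \<and> Up \<union> Um = - \<Gamma> \<and>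
    \<Gamma> \<subseteq> closure (\<Omega> \<inter> Up) \<inter> closure (\<Omega> \<inter> Um) \<and>
    bp > 0 \<and> bm > 0 \<and> bm \<le> bp \<and>
    h < reach \<Gamma> / (3 * sqrt 3) \<and>
    (\<forall>a\<in>Cs. \<forall>E\<in>cube_edges a h. \<forall>x\<in>\<Gamma> \<inter> E. \<forall>y\<in>\<Gamma> \<inter> E. x = y) \<and>
    (\<forall>a\<in>Cs. \<forall>F\<in>cube_faces a h. finite (\<Gamma> \<inter> face_boundary a h F) \<and>
                                   card (\<Gamma> \<inter> face_boundary a h F) \<le> 2) \<and>
    (\<forall>a\<in>Cs. cube_vertices a h \<inter> \<Gamma> = {})
    \<longrightarrow>
    (\<forall>a\<in>Cs. cube a h \<inter> \<Gamma> \<noteq> {} \<longrightarrow>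
      (\<forall>K nb D p Ai. admissible_K \<Gamma> a h K \<longrightarrow> norm nb = 1 \<longrightarrow>
         (\<forall>P\<in>K. \<forall>Q\<in>K. (P - Q) \<bullet> nb = 0) \<longrightarrow> D \<in> K \<longrightarrow>
         Ai \<in> cube_vertices a h \<longrightarrow> p \<in> Q1 \<longrightarrow>
         (let q = CT bp bm ((1/3) *\<^sub>R (\<Sum>K)) nb D p;
              \<omega> = \<Union>{cube b h | b. b \<in> Cs \<and> cube b h \<inter> cube a h \<noteq> {}} in
          (\<forall>A\<in>cube_vertices a h. (if A \<in> Um then p A else q A) = (if A = Ai then 1 else 0)) \<longrightarrow>
          (\<forall>x\<in>\<omega> \<inter> \<Omega> \<inter> Up.
              \<bar>q x\<bar> \<le> C \<and> (\<forall>i. \<bar>pd i q x\<bar> \<le> C / h) \<and>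
              (\<forall>i j. \<bar>pd i (pd j q) x\<bar> \<le> C / h^2)) \<and>
          (\<forall>x\<in>\<omega> \<inter> \<Omega> \<inter> Um.
              \<bar>p x\<bar> \<le> C * (bp / bm) \<and> (\<forall>i. \<bar>pd i p x\<bar> \<le> C * (bp / bm) / h) \<and>
              (\<forall>i j. \<bar>pd i (pd j p) x\<bar> \<le> C * (bp / bm) / h^2)))))"
proof -
  \<comment> \<open>The factors are 4 for two derivatives, 64 for interpolation on the patch and
    12001 for the corner values of the plus piece; the corresponding 49 of the minus piece is
    smaller.\<close>
  define C :: real where "C = 4 * (64 * 12001)"
  show ?thesis
    unfolding Let_def
  proof (intro exI[of _ C] allI impI ballI, elim conjE)
    fix \<Omega> \<Gamma> Up Um :: "pt set" and bp bm h :: real and z0 :: pt and Cs :: "pt set" and a K nb D p Ai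
    assume h: "h > 0" and surface: "closed_C2_surface \<Gamma>"
      and sides: "open Up" "open Um" "Up \<inter> Um = {}" "Up \<union> Um = - \<Gamma>"
      and cl: "\<Gamma> \<subseteq> closure (\<Omega> \<inter> Up) \<inter> closure (\<Omega> \<inter> Um)"
      and b: "bp > 0" "bm > 0" "bm \<le> bp" and reach: "h < reach \<Gamma> / (3 * sqrt 3)"
      and edges: "\<forall>a\<in>Cs. \<forall>E\<in>cube_edges a h. \<forall>x\<in>\<Gamma> \<inter> E. \<forall>y\<in>\<Gamma> \<inter> E. x = y"
      and faces: "\<forall>a\<in>Cs. \<forall>F\<in>cube_faces a h. finite (\<Gamma> \<inter> face_boundary a h F) \<and> card (\<Gamma> \<inter> face_boundary a h F) \<le> 2"
      and vertices: "\<forall>a\<in>Cs. cube_vertices a h \<inter> \<Gamma> = {}"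
      and a: "a \<in> Cs" and K: "admissible_K \<Gamma> a h K" "norm nb = 1" "\<forall>P\<in>K. \<forall>Q\<in>K. (P - Q) \<bullet> nb = 0" "D \<in> K"
      and p: "p \<in> Q1"
    let ?q = "CT bp bm ((1/3) *\<^sub>R (\<Sum>K)) nb D p" and ?\<omega> = "\<Union>{cube b h | b. b \<in> Cs \<and> cube b h \<inter> cube a h \<noteq> {}}"
    assume nodal: "\<forall>A\<in>cube_vertices a h. (if A \<in> Um then p A else ?q A) = (if A = Ai then 1 else 0)"
    \<comment> \<open>Since \<open>25 / 9 \<le> 3\<close>; this turns the mesh condition into
      tangent balls of radius at least \<open>5 * h\<close>.\<close>
    have "5 \<le> 3 * sqrt 3" using real_le_rsqrt[of "5/3" 3] by (simp add: power2_eq_square)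
    have "h * (3 * sqrt 3) < reach \<Gamma>" using reach by (simp add: field_simps)
    \<comment> \<open>The strict inequality leaves room for an admissible radius even if the
      supremum is not attained.\<close>
    then obtain r where r: "reach_radius \<Gamma> r" "h * (3 * sqrt 3) < r" using reach_radius_greater[OF surface] by blast
    have "h * 5 \<le> h * (3 * sqrt 3)" using \<open>5 \<le> 3 * sqrt 3\<close> h by (intro mult_left_mono) auto
    then have "5 * h \<le> r" using r(2) by linarith
    moreover have "\<Gamma> \<subseteq> closure Up" "\<Gamma> \<subseteq> closure Um"
      using cl closure_mono[of "\<Omega> \<inter> Up" Up] closure_mono[of "\<Omega> \<inter> Um" Um] by blast+
    moreover have "X = Y" if "E \<in> cube_edges a h" "X \<in> \<Gamma> \<inter> E" "Y \<in> \<Gamma> \<inter> E" for E X Y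
      using edges a that by blast
    moreover have "finite (\<Gamma> \<inter> face_boundary a h F) \<and> card (\<Gamma> \<inter> face_boundary a h F) \<le> 2" if "F \<in> cube_faces a h" for F
      using faces a that by blast
    moreover have "cube_vertices a h \<inter> \<Gamma> = {}" using vertices a by blast
    ultimately interpret cut_cube \<Gamma> Up Um a h r
      by (intro cut_cube.intro h r(1) surface sides)
    have "corner i j k \<in> cube_vertices a h" for i j k
      using corner_coords_vertex[of h a] h unfolding bin_def by simp
    then have "\<bar>if corner i j k \<in> Um then p (corner i j k) else ?q (corner i j k)\<bar> \<le> 1" for i j k
      using bspec[OF nodal] by simp
    note bounds = shape_function_bounds[OF K b(2,3) p refl this]
    have C: "4 * (64 * 12001) \<le> C" "4 * (64 * (49 * (bp / bm))) \<le> C * (bp / bm)"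
      using mult_right_mono[of "4 * (64 * 49)" C "bp / bm"] b unfolding C_def by simp_all
    have near: "a$i - h \<le> x$i" "x$i \<le> a$i + 2 * h" if "x \<in> ?\<omega>" for x i
      using that neighbour_cube_bounds by blast+
    show "(\<forall>x\<in>?\<omega> \<inter> \<Omega> \<inter> Up. \<bar>?q x\<bar> \<le> C \<and> (\<forall>i. \<bar>pd i ?q x\<bar> \<le> C / h) \<and> (\<forall>i j. \<bar>pd i (pd j ?q) x\<bar> \<le> C / h^2)) \<and>
      (\<forall>x\<in>?\<omega> \<inter> \<Omega> \<inter> Um. \<bar>p x\<bar> \<le> C * (bp / bm) \<and> (\<forall>i. \<bar>pd i p x\<bar> \<le> C * (bp / bm) / h) \<and>
        (\<forall>i j. \<bar>pd i (pd j p) x\<bar> \<le> C * (bp / bm) / h^2))"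
    proof (intro conjI ballI allI)
      fix x i j assume "x \<in> ?\<omega> \<inter> \<Omega> \<inter> Up"
      then have x: "x \<in> ?\<omega>" by blast
      note m = multiaffine_derivative_bounds[OF bounds(1) h bounds(2) near[OF x] C(1)]
      show "\<bar>?q x\<bar> \<le> C" "\<bar>pd i ?q x\<bar> \<le> C / h" "\<bar>pd i (pd j ?q) x\<bar> \<le> C / h^2" by (rule m)+
    next
      fix x i j assume "x \<in> ?\<omega> \<inter> \<Omega> \<inter> Um"
      then have x: "x \<in> ?\<omega>" by blast
      note m = multiaffine_derivative_bounds[OF bounds(3) h bounds(4) near[OF x] C(2)]
      show "\<bar>p x\<bar> \<le> C * (bp / bm)" "\<bar>pd i p x\<bar> \<le> C * (bp / bm) / h" "\<bar>pd i (pd j p) x\<bar> \<le> C * (bp / bm) / h^2" by (rule m)+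
    qed
  qed
qed

end
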